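(* Let $(B,g_B)$ and $(F,g_F)$ be Riemannian manifolds of dimensions $n_1=\dim B$ and $n_2=\dim F$, let $n=n_1+n_2$, let $f$ be a positive differentiable function on $B$, let $M=B\times_f F$ be the warped product manifold with metric $g=g_B+f^2g_F$, and let $(\overline{M},\overline{g})$ be a Riemannian manifold. Let $\phi:(M,g)\to(\overline{M},\overline{g})$ be an isometric immersion. Then, at every point of $M$, $$\frac{\triangle f}{f}\le \frac{n^2}{4n_2}H^2+n_1\sup\overline{K}.$$ Moreover, equality holds identically (i.e. at every point of $M$) if and only if $\phi$ is a mixed totally geodesic immersion such that $\mathrm{tr}\,h_1=\mathrm{tr}\,h_2$ and $\overline{K}(X\wedge Y)=\sup\overline{K}$ for all unit vectors $X\in\mathcal{D}_1$ and $Y\in\mathcal{D}_2$ (at each point of $M$).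
   Context: Manifolds have positive dimension and "differentiable" means smooth. The warped product $M=B\times_f F$ is $B\times F$ with the metric $g$ given by $\|X\|^2=\|d\pi_1X\|^2+f^2(\pi_1(x))\|d\pi_2X\|^2$ for $X\in T_xM$, where $\pi_1:B\times F\to B$ and $\pi_2:B\times F\to F$ are the projections; functions on $B$ are regarded as functions on $M$ via $\pi_1$. $\mathcal{D}_1$ and $\mathcal{D}_2$ are the distributions on $M$ of vectors tangent to the lifts of $B$ and of $F$, respectively (so $TM=\mathcal{D}_1\oplus\mathcal{D}_2$ orthogonally, with ranks $n_1$ and $n_2$). Laplacian: $\triangle f=\sum_{i=1}^{n_1}\big((\nabla_{e_i}e_i)f-e_i^2f\big)$, where $e_1,\dots,e_{n_1}$ is a local orthonormal frame of $\mathcal{D}_1$ consisting of lifts of a local orthonormal frame of $B$ and $\nabla$ is the Levi-Civita connection of $(M,g)$; equivalently, $\triangle f=-\mathrm{div}(\mathrm{grad}\,f)$ computed on $(B,g_B)$ (note the sign). Identify $T_pM$ with $d\phi(T_pM)$. Let $h$ be the second fundamental form of $\phi$. For a local orthonormal frame $e_1,\dots,e_n$ of $TM$ with $e_1,\dots,e_{n_1}\in\mathcal{D}_1$ and $e_{n_1+1},\dots,e_n\in\mathcal{D}_2$: the mean curvature vector is $\overrightarrow{H}=\frac1n\sum_{i=1}^n h(e_i,e_i)$, the squared mean curvature is $H^2=\langle\overrightarrow{H},\overrightarrow{H}\rangle$, $\mathrm{tr}\,h_1=\sum_{i=1}^{n_1}h(e_i,e_i)$ and $\mathrm{tr}\,h_2=\sum_{j=n_1+1}^n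 h(e_j,e_j)$. The immersion $\phi$ is mixed totally geodesic if $h(e_i,e_j)=0$ for all $1\le i\le n_1$ and $n_1+1\le j\le n$. $\overline{K}(\pi)$ is the sectional curvature in $\overline{M}$ of a plane $\pi$, $X\wedge Y$ denotes the plane spanned by $X,Y$, and $\sup\overline{K}$ is the function on $M$ given by $(\sup\overline{K})(p)=\sup\{\overline{K}(\pi)\mid \pi\subset T_pM,\ \dim\pi=2\}$. *)

theory Defs
  imports "HOL-Analysis.Analysis"
begin

section \<open>Smooth manifolds\<close>

text \<open>\<open>C\<^sup>k\<close> maps on an open subset of a Euclidean space, by iterated directional derivatives.\<close>

primrec Ck_on :: "nat \<Rightarrow> 'a::euclidean_space set \<Rightarrow> ('a \<Rightarrow> 'b::real_normed_vector) \<Rightarrow> bool" where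
  "Ck_on 0 S f \<longleftrightarrow> continuous_on S f"
| "Ck_on (Suc k) S f \<longleftrightarrow> (\<forall>x\<in>S. f differentiable (at x)) \<and>
     (\<forall>v. Ck_on k S (\<lambda>x. frechet_derivative f (at x) v))"

definition smooth_on :: "'a::euclidean_space set \<Rightarrow> ('a \<Rightarrow> 'b::real_normed_vector) \<Rightarrow> bool" where
  "smooth_on S f \<longleftrightarrow> (\<forall>k. Ck_on k S f)"

datatype ('m, 'e) chart = Chart (chart_dom: "'m set") (coord: "'m \<Rightarrow> 'e")

definition chart_inv :: "('m, 'e) chart \<Rightarrow> 'e \<Rightarrow> 'm" where
  "chart_inv c = inv_into (chart_dom c) (coord c)"

definition chart_img :: "('m, 'e) chart \<Rightarrow> 'e set" where
  "chart_img c = coord c ` chart_dom c"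

definition is_chart :: "('m::topological_space, 'e::euclidean_space) chart \<Rightarrow> bool" where
  "is_chart c \<longleftrightarrow> open (chart_dom c) \<and> open (chart_img c) \<and>
     homeomorphism (chart_dom c) (chart_img c) (coord c) (chart_inv c)"

text \<open>
  A manifold modelled on the Euclidean space \<open>'e\<close> (so its dimension is \<open>DIM('e) \<ge> 1\<close>) is given by
  an atlas, not necessarily maximal, together with a choice of a chart of the atlas around every
  point. The chosen charts carry no geometric content; they are used to represent tangent vectors:
  the tangent space at \<open>p\<close> is identified with \<open>'e\<close> by means of the chart \<open>chart_at M p\<close>. The
  underlying space of the manifold is the union of the chart domains, an open subset of \<open>'m\<close>.
\<close>

record ('m, 'e) manifold =
  atlas :: "('m, 'e) chart set"
  chart_at :: "'m \<Rightarrow> ('m, 'e) chart"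

definition carrier :: "('m, 'e) manifold \<Rightarrow> 'm set" where
  "carrier M = (\<Union>c\<in>atlas M. chart_dom c)"

definition smooth_manifold ::
  "('m::{t2_space,second_countable_topology}, 'e::euclidean_space) manifold \<Rightarrow> bool" where
  "smooth_manifold M \<longleftrightarrow>
     (\<forall>c\<in>atlas M. is_chart c) \<and>
     (\<forall>c\<in>atlas M. \<forall>d\<in>atlas M.
        smooth_on (coord c ` (chart_dom c \<inter> chart_dom d)) (coord d \<circ> chart_inv c)) \<and>
     (\<forall>p\<in>carrier M. chart_at M p \<in> atlas M \<and> p \<in> chart_dom (chart_at M p))"

definition smooth_function :: "('m, 'e::euclidean_space) manifold \<Rightarrow> ('m \<Rightarrow> real) \<Rightarrow> bool" where
  "smooth_function M u \<longleftrightarrow> (\<forall>c\<in>atlas M. smooth_on (chart_img c) (u \<circ> chart_inv c))"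

definition smooth_map ::
  "('m::topological_space, 'e::euclidean_space) manifold \<Rightarrow>
   ('n::topological_space, 'd::euclidean_space) manifold \<Rightarrow> ('m \<Rightarrow> 'n) \<Rightarrow> bool" where
  "smooth_map M N \<phi> \<longleftrightarrow>
     \<phi> ` carrier M \<subseteq> carrier N \<and> continuous_on (carrier M) \<phi> \<and>
     (\<forall>c\<in>atlas M. \<forall>d\<in>atlas N.
        smooth_on (coord c ` (chart_dom c \<inter> \<phi> -` chart_dom d)) (coord d \<circ> \<phi> \<circ> chart_inv c))"

text \<open>The differential of \<open>\<phi>\<close> at \<open>p\<close>, acting on tangent vectors in the above representation.\<close>

definition differential ::
  "('m, 'e::euclidean_space) manifold \<Rightarrow> ('n, 'd::euclidean_space) manifold \<Rightarrow>
   ('m \<Rightarrow> 'n) \<Rightarrow> 'm \<Rightarrow> 'e \<Rightarrow> 'd" where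
  "differential M N \<phi> p =
     frechet_derivative (coord (chart_at N (\<phi> p)) \<circ> \<phi> \<circ> chart_inv (chart_at M p))
       (at (coord (chart_at M p) p))"


section \<open>Riemannian metrics\<close>

text \<open>
  A metric assigns to each point \<open>p\<close> an inner product on the tangent space at \<open>p\<close>, represented
  through \<open>chart_at M p\<close>. Its coefficients in an arbitrary chart \<open>c\<close> at the coordinate point \<open>x\<close>
  arise by transforming \<open>c\<close>-coordinates of tangent vectors at \<open>p = c\<inverse>(x)\<close> into
  \<open>chart_at M p\<close>-coordinates.
\<close>

type_synonym ('m, 'e) metric = "'m \<Rightarrow> 'e \<Rightarrow> 'e \<Rightarrow> real"

definition local_metric ::
  "('m, 'e::euclidean_space) manifold \<Rightarrow> ('m, 'e) metric \<Rightarrow> ('m, 'e) chart \<Rightarrow>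
   'e \<Rightarrow> 'e \<Rightarrow> 'e \<Rightarrow> real" where
  "local_metric M g c x v w =
     (let p = chart_inv c x;
          T = frechet_derivative (coord (chart_at M p) \<circ> chart_inv c) (at x)
      in g p (T v) (T w))"

definition riemannian_metric :: "('m, 'e::euclidean_space) manifold \<Rightarrow> ('m, 'e) metric \<Rightarrow> bool" where
  "riemannian_metric M g \<longleftrightarrow>
     (\<forall>p\<in>carrier M. bilinear (g p) \<and> (\<forall>v w. g p v w = g p w v) \<and> (\<forall>v. v \<noteq> 0 \<longrightarrow> g p v v > 0)) \<and>
     (\<forall>c\<in>atlas M. \<forall>v w. smooth_on (chart_img c) (\<lambda>x. local_metric M g c x v w))"

definition isometric_immersion ::
  "('m::topological_space, 'e::euclidean_space) manifold \<Rightarrow> ('m, 'e) metric \<Rightarrow>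
   ('n::topological_space, 'd::euclidean_space) manifold \<Rightarrow> ('n, 'd) metric \<Rightarrow> ('m \<Rightarrow> 'n) \<Rightarrow> bool" where
  "isometric_immersion M g N gN \<phi> \<longleftrightarrow>
     smooth_map M N \<phi> \<and>
     (\<forall>p\<in>carrier M. inj (differential M N \<phi> p) \<and>
        (\<forall>v w. gN (\<phi> p) (differential M N \<phi> p v) (differential M N \<phi> p w) = g p v w))"


section \<open>Levi-Civita connection, curvature and Laplacian\<close>

text \<open>
  In this section \<open>G\<close> denotes the coefficients of a metric in a chart, so that \<open>G x\<close> is the inner
  product at the coordinate point \<open>x\<close>. The vector \<open>christoffel G x v w\<close> is the value at \<open>x\<close> of
  \<open>\<nabla>\<^sub>v w\<close> for the Levi-Civita connection and the constant (coordinate) vector fields \<open>v\<close> and \<open>w\<close>;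
  it is determined by the Koszul formula, in which the Lie brackets vanish.
\<close>

definition christoffel ::
  "('e::euclidean_space \<Rightarrow> 'e \<Rightarrow> 'e \<Rightarrow> real) \<Rightarrow> 'e \<Rightarrow> 'e \<Rightarrow> 'e \<Rightarrow> 'e" where
  "christoffel G x v w = (THE z. \<forall>u. 2 * G x z u =
     frechet_derivative (\<lambda>y. G y w u) (at x) v +
     frechet_derivative (\<lambda>y. G y v u) (at x) w -
     frechet_derivative (\<lambda>y. G y v w) (at x) u)"

text \<open>The covariant derivative \<open>\<nabla>\<^sub>v V\<close> at \<open>x\<close> of a vector field \<open>V\<close>.\<close>

definition cov_deriv ::
  "('e::euclidean_space \<Rightarrow> 'e \<Rightarrow> 'e \<Rightarrow> real) \<Rightarrow> ('e \<Rightarrow> 'e) \<Rightarrow> 'e \<Rightarrow> 'e \<Rightarrow> 'e" where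
  "cov_deriv G V x v = frechet_derivative V (at x) v + christoffel G x v (V x)"

text \<open>
  \<open>R(u,v)w = \<nabla>\<^sub>u\<nabla>\<^sub>v w - \<nabla>\<^sub>v\<nabla>\<^sub>u w\<close>, computed on constant vector fields, for which \<open>[u,v] = 0\<close>.
\<close>

definition riemann_curvature ::
  "('e::euclidean_space \<Rightarrow> 'e \<Rightarrow> 'e \<Rightarrow> real) \<Rightarrow> 'e \<Rightarrow> 'e \<Rightarrow> 'e \<Rightarrow> 'e \<Rightarrow> 'e" where
  "riemann_curvature G x u v w =
     cov_deriv G (\<lambda>y. cov_deriv G (\<lambda>_. w) y v) x u -
     cov_deriv G (\<lambda>y. cov_deriv G (\<lambda>_. w) y u) x v"

text \<open>
  The sectional curvature of the plane \<open>\<pi>\<close> in the tangent space at \<open>p\<close>; the value is the same for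
  all bases \<open>u, v\<close> of \<open>\<pi>\<close>.
\<close>

definition sectional_curvature ::
  "('m, 'e::euclidean_space) manifold \<Rightarrow> ('m, 'e) metric \<Rightarrow> 'm \<Rightarrow> 'e set \<Rightarrow> real" where
  "sectional_curvature M g p \<pi> =
     (let c = chart_at M p; G = local_metric M g c; x = coord c p
      in THE K. \<exists>u v. u \<noteq> v \<and> independent {u, v} \<and> span {u, v} = \<pi> \<and>
           K = G x (riemann_curvature G x u v v) u / (G x u u * G x v v - (G x u v)\<^sup>2))"

text \<open>\<open>div V\<close> is the trace of the linear map \<open>v \<mapsto> \<nabla>\<^sub>v V\<close>; any basis may be used to compute it.\<close>

definition local_grad ::
  "('e::euclidean_space \<Rightarrow> 'e \<Rightarrow> 'e \<Rightarrow> real) \<Rightarrow> ('e \<Rightarrow> real) \<Rightarrow> 'e \<Rightarrow> 'e" where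
  "local_grad G u x = (THE z. \<forall>v. G x z v = frechet_derivative u (at x) v)"

definition local_div ::
  "('e::euclidean_space \<Rightarrow> 'e \<Rightarrow> 'e \<Rightarrow> real) \<Rightarrow> ('e \<Rightarrow> 'e) \<Rightarrow> 'e \<Rightarrow> real" where
  "local_div G V x = (\<Sum>b\<in>Basis. cov_deriv G V x b \<bullet> b)"

text \<open>Sign convention: the Laplacian is \<open>- div grad\<close>.\<close>

definition laplacian ::
  "('m, 'e::euclidean_space) manifold \<Rightarrow> ('m, 'e) metric \<Rightarrow> ('m \<Rightarrow> real) \<Rightarrow> 'm \<Rightarrow> real" where
  "laplacian M g u p =
     (let c = chart_at M p; G = local_metric M g c
      in - local_div G (local_grad G (u \<circ> chart_inv c)) (coord c p))"


section \<open>Geometry of an isometric immersion\<close>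

text \<open>
  The second fundamental form, by the formula of Gauss
  \<open>h(X,Y) = \<nabla>\<^sup>N\<^sub>X (d\<phi> Y) - d\<phi> (\<nabla>\<^sub>X Y)\<close>, where \<open>Y\<close> is extended to a constant vector field in the
  chart around \<open>p\<close>. The first two summands are the covariant derivative in the direction \<open>v\<close>
  of the vector field \<open>d\<phi> w\<close> along \<open>\<phi>\<close>.
\<close>

definition second_fundamental_form ::
  "('m, 'e::euclidean_space) manifold \<Rightarrow> ('m, 'e) metric \<Rightarrow>
   ('n, 'd::euclidean_space) manifold \<Rightarrow> ('n, 'd) metric \<Rightarrow> ('m \<Rightarrow> 'n) \<Rightarrow> 'm \<Rightarrow> 'e \<Rightarrow> 'e \<Rightarrow> 'd" where
  "second_fundamental_form M g N gN \<phi> p v w =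
     (let c = chart_at M p; d = chart_at N (\<phi> p);
          G = local_metric M g c; GN = local_metric N gN d;
          \<Phi> = coord d \<circ> \<phi> \<circ> chart_inv c; x = coord c p; D = (\<lambda>y. frechet_derivative \<Phi> (at y))
      in frechet_derivative (\<lambda>y. D y w) (at x) v + christoffel GN (\<Phi> x) (D x v) (D x w)
         - D x (cov_deriv G (\<lambda>_. w) x v))"

definition orthonormal_basis_of ::
  "('e::euclidean_space \<Rightarrow> 'e \<Rightarrow> real) \<Rightarrow> 'e set \<Rightarrow> 'e set \<Rightarrow> bool" where
  "orthonormal_basis_of q V E \<longleftrightarrow> span E = V \<and>
     (\<forall>e\<in>E. \<forall>e'\<in>E. q e e' = (if e = e' then 1 else 0))"

text \<open>
  The trace of a vector-valued bilinear form \<open>\<beta>\<close> over the subspace \<open>V\<close> with respect to the inner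
  product \<open>q\<close>; it does not depend on the orthonormal basis used.
\<close>

definition trace_over ::
  "('e::euclidean_space \<Rightarrow> 'e \<Rightarrow> real) \<Rightarrow> 'e set \<Rightarrow> ('e \<Rightarrow> 'e \<Rightarrow> 'd::real_vector) \<Rightarrow> 'd" where
  "trace_over q V \<beta> = (\<Sum>e\<in>(SOME E. orthonormal_basis_of q V E). \<beta> e e)"

definition mean_curvature_vector ::
  "('m, 'e::euclidean_space) manifold \<Rightarrow> ('m, 'e) metric \<Rightarrow>
   ('n, 'd::euclidean_space) manifold \<Rightarrow> ('n, 'd) metric \<Rightarrow> ('m \<Rightarrow> 'n) \<Rightarrow> 'm \<Rightarrow> 'd" where
  "mean_curvature_vector M g N gN \<phi> p =
     (1 / real DIM('e)) *\<^sub>R trace_over (g p) UNIV (second_fundamental_form M g N gN \<phi> p)"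

definition squared_mean_curvature ::
  "('m, 'e::euclidean_space) manifold \<Rightarrow> ('m, 'e) metric \<Rightarrow>
   ('n, 'd::euclidean_space) manifold \<Rightarrow> ('n, 'd) metric \<Rightarrow> ('m \<Rightarrow> 'n) \<Rightarrow> 'm \<Rightarrow> real" where
  "squared_mean_curvature M g N gN \<phi> p =
     gN (\<phi> p) (mean_curvature_vector M g N gN \<phi> p) (mean_curvature_vector M g N gN \<phi> p)"

text \<open>
  The supremum, at \<open>p\<close>, of the sectional curvatures of the ambient manifold over the planes that
  are tangent to the immersed manifold.
\<close>

definition sup_sectional ::
  "('m, 'e::euclidean_space) manifold \<Rightarrow>
   ('n, 'd::euclidean_space) manifold \<Rightarrow> ('n, 'd) metric \<Rightarrow> ('m \<Rightarrow> 'n) \<Rightarrow> 'm \<Rightarrow> real" where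
  "sup_sectional M N gN \<phi> p =
     (SUP \<pi>\<in>{\<pi>. subspace \<pi> \<and> dim \<pi> = 2}.
        sectional_curvature N gN (\<phi> p) (differential M N \<phi> p ` \<pi>))"


section \<open>Warped products\<close>

definition prod_chart :: "('b, 'e1) chart \<Rightarrow> ('f, 'e2) chart \<Rightarrow> ('b \<times> 'f, 'e1 \<times> 'e2) chart" where
  "prod_chart c d = Chart (chart_dom c \<times> chart_dom d) (map_prod (coord c) (coord d))"

definition prod_manifold ::
  "('b, 'e1) manifold \<Rightarrow> ('f, 'e2) manifold \<Rightarrow> ('b \<times> 'f, 'e1 \<times> 'e2) manifold" where
  "prod_manifold B F =
     \<lparr> atlas = {prod_chart c d | c d. c \<in> atlas B \<and> d \<in> atlas F},
       chart_at = (\<lambda>(x, y). prod_chart (chart_at B x) (chart_at F y)) \<rparr>"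

abbreviation d_fst ::
  "('b, 'e1::euclidean_space) manifold \<Rightarrow> ('f, 'e2::euclidean_space) manifold \<Rightarrow>
   'b \<times> 'f \<Rightarrow> 'e1 \<times> 'e2 \<Rightarrow> 'e1" where
  "d_fst B F \<equiv> differential (prod_manifold B F) B fst"

abbreviation d_snd ::
  "('b, 'e1::euclidean_space) manifold \<Rightarrow> ('f, 'e2::euclidean_space) manifold \<Rightarrow>
   'b \<times> 'f \<Rightarrow> 'e1 \<times> 'e2 \<Rightarrow> 'e2" where
  "d_snd B F \<equiv> differential (prod_manifold B F) F snd"

definition warped_metric ::
  "('b, 'e1::euclidean_space) manifold \<Rightarrow> ('b, 'e1) metric \<Rightarrow>
   ('f, 'e2::euclidean_space) manifold \<Rightarrow> ('f, 'e2) metric \<Rightarrow> ('b \<Rightarrow> real) \<Rightarrow>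
   ('b \<times> 'f, 'e1 \<times> 'e2) metric" where
  "warped_metric B gB F gF f p v w =
     gB (fst p) (d_fst B F p v) (d_fst B F p w) +
     (f (fst p))\<^sup>2 * gF (snd p) (d_snd B F p v) (d_snd B F p w)"

text \<open>
  \<open>\<D>\<^sub>1\<close>: the vectors tangent to the leaves \<open>B \<times> {y}\<close>; \<open>\<D>\<^sub>2\<close>: those tangent to the
  fibres \<open>{x} \<times> F\<close>.
\<close>

definition dist1 ::
  "('b, 'e1::euclidean_space) manifold \<Rightarrow> ('f, 'e2::euclidean_space) manifold \<Rightarrow>
   'b \<times> 'f \<Rightarrow> ('e1 \<times> 'e2) set" where
  "dist1 B F p = {v. d_snd B F p v = 0}"

definition dist2 ::
  "('b, 'e1::euclidean_space) manifold \<Rightarrow> ('f, 'e2::euclidean_space) manifold \<Rightarrow>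
   'b \<times> 'f \<Rightarrow> ('e1 \<times> 'e2) set" where
  "dist2 B F p = {v. d_fst B F p v = 0}"

definition mixed_totally_geodesic ::
  "('b, 'e1::euclidean_space) manifold \<Rightarrow> ('f, 'e2::euclidean_space) manifold \<Rightarrow>
   ('b \<times> 'f, 'e1 \<times> 'e2) metric \<Rightarrow>
   ('n, 'd::euclidean_space) manifold \<Rightarrow> ('n, 'd) metric \<Rightarrow> ('b \<times> 'f \<Rightarrow> 'n) \<Rightarrow> bool" where
  "mixed_totally_geodesic B F g N gN \<phi> \<longleftrightarrow>
     (\<forall>p\<in>carrier (prod_manifold B F). \<forall>E1 E2.
        orthonormal_basis_of (g p) (dist1 B F p) E1 \<longrightarrow>
        orthonormal_basis_of (g p) (dist2 B F p) E2 \<longrightarrow>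
        (\<forall>e\<in>E1. \<forall>e'\<in>E2. second_fundamental_form (prod_manifold B F) g N gN \<phi> p e e' = 0))"

end

theory Submission
  imports Defs
begin

text \<open>
  Sum the Gauss equation over the planes spanned by \<open>X \<in> \<D>\<^sub>1\<close> and \<open>Y \<in> \<D>\<^sub>2\<close> of an adapted orthonormal
  frame. In a warped product such a plane has sectional curvature \<open>- Hess f(X,X)/f\<close>, so the intrinsic
  side adds up to \<open>n\<^sub>2 \<triangle>f/f\<close>, while the extrinsic side is
  \<open>\<Sum> K(X \<and> Y) + \<langle>tr h\<^sub>1, tr h\<^sub>2\<rangle> - \<Sum> |h(X,Y)|\<^sup>2\<close>. Polarization of \<open>\<langle>tr h\<^sub>1, tr h\<^sub>2\<rangle>\<close> makes
  \<open>n\<^sup>2 H\<^sup>2/4\<close> appear, and the defect of the inequality is the sum of the nonnegative terms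
  \<open>|tr h\<^sub>1 - tr h\<^sub>2|\<^sup>2/4\<close>, \<open>sup K - K(X \<and> Y)\<close> and \<open>|h(X,Y)|\<^sup>2\<close>. Everything pointwise is computed in the
  coordinates of a product chart.
\<close>

section \<open>Inner products on a Euclidean space\<close>

text \<open>Connection and gradient are given only by definite descriptions, as solutions of linear
  equations in the metric, without an inverse matrix. Their differentiability, without which
  curvature and Laplacian cannot be computed, is obtained from the inverse function theorem applied
  to the lowering of an index. Of the warped connection only the horizontal and the mixed parts are
  computed: \<open>R(Y,X)X\<close> with \<open>X\<close> horizontal and \<open>Y\<close> vertical
  never differentiates a vertical field along a vertical one. A real supremum bounds its family only
  if the family is bounded above, so the sectional curvatures at a point have to be shown bounded;
  this comes from the boundedness of the unit vectors. The constant
  \<open>n\<^sup>2/(4 n\<^sub>2)\<close> has its denominator \<open>n\<^sub>2\<close> from the fact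
  that the sum over mixed planes counts the Laplacian once for each frame vector of
  \<open>\<D>\<^sub>2\<close>. The equality case yields conditions on frames, while the theorem
  speaks of all unit vectors; hence orthonormal bases are constructed with a prescribed
  member.\<close>

definition inner_form :: "('a::euclidean_space \<Rightarrow> 'a \<Rightarrow> real) \<Rightarrow> bool" where
  "inner_form q \<longleftrightarrow> bilinear q \<and> (\<forall>v w. q v w = q w v) \<and> (\<forall>v. v \<noteq> 0 \<longrightarrow> q v v > 0)"

lemma inner_form_bilinear: "inner_form q \<Longrightarrow> bilinear q"
  and inner_form_sym: "inner_form q \<Longrightarrow> q v w = q w v"
  and inner_form_pos: "inner_form q \<Longrightarrow> v \<noteq> 0 \<Longrightarrow> q v v > 0"
  by (auto simp: inner_form_def)

lemma inner_form_nonneg: "inner_form q \<Longrightarrow> q v v \<ge> 0"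
  by (cases "v = 0") (auto simp: inner_form_pos less_imp_le inner_form_bilinear bilinear_lzero)

lemma inner_form_eq_0_iff: "inner_form q \<Longrightarrow> q v v = 0 \<longleftrightarrow> v = 0"
  using inner_form_pos[of q v] by (cases "v = 0") (simp_all add: inner_form_bilinear bilinear_lzero)

text \<open>Nondegeneracy: test with \<open>u = v - w\<close> and use positivity. It is the
  uniqueness half of every vector defined by its inner products.\<close>

lemma inner_form_eqI:
  assumes q: "inner_form q" and "\<And>u. q v u = q w u"
  shows "v = w"
proof -
  have "q (v - w) (v - w) = 0"
    using assms by (simp add: bilinear_lsub[OF inner_form_bilinear[OF q]])
  then show ?thesis using inner_form_eq_0_iff[OF q] by simp
qed

lemma bilinear_linear_left: "bilinear \<beta> \<Longrightarrow> linear (\<lambda>v. \<beta> v w)"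
  and bilinear_linear_right: "bilinear \<beta> \<Longrightarrow> linear (\<beta> v)"
  by (auto simp: bilinear_def)

lemma bilinear_sum_left: "bilinear \<beta> \<Longrightarrow> \<beta> (\<Sum>i\<in>I. c i *\<^sub>R v i) w = (\<Sum>i\<in>I. c i *\<^sub>R \<beta> (v i) w)"
  by (induction I rule: infinite_finite_induct) (simp_all add: bilinear_lzero bilinear_ladd bilinear_lmul)

lemma bilinear_sum_right: "bilinear \<beta> \<Longrightarrow> \<beta> v (\<Sum>i\<in>I. c i *\<^sub>R w i) = (\<Sum>i\<in>I. c i *\<^sub>R \<beta> v (w i))"
  by (induction I rule: infinite_finite_induct) (simp_all add: bilinear_rzero bilinear_radd bilinear_rmul)

lemmas bilinear_simps = bilinear_ladd bilinear_radd bilinear_lmul bilinear_rmul bilinear_lneg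
  bilinear_rneg bilinear_lsub bilinear_rsub bilinear_lzero bilinear_rzero

section \<open>Orthonormal systems: independence, expansion, extension to a basis\<close>

definition orthonormal_for :: "('e::euclidean_space \<Rightarrow> 'e \<Rightarrow> real) \<Rightarrow> 'e set \<Rightarrow> bool" where
  "orthonormal_for q E \<longleftrightarrow> (\<forall>e\<in>E. \<forall>e'\<in>E. q e e' = (if e = e' then 1 else 0))"

lemma orthonormal_basis_of_iff:
  "orthonormal_basis_of q V E \<longleftrightarrow> span E = V \<and> orthonormal_for q E"
  by (simp add: orthonormal_basis_of_def orthonormal_for_def)

text \<open>Finite subsets \<open>S\<close> occur because the finiteness of \<open>E\<close> is
  itself derived from its independence, and independence from this formula.\<close>

lemma orthonormal_for_coeff:
  assumes "bilinear q" "orthonormal_for q E" "finite S" "S \<subseteq> E" "e \<in> S"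
  shows "q (\<Sum>a\<in>S. c a *\<^sub>R a) e = c e"
proof -
  have "q (\<Sum>a\<in>S. c a *\<^sub>R a) e = (\<Sum>a\<in>S. if a = e then c e else 0)"
    unfolding bilinear_sum_left[OF assms(1)]
    using assms by (intro sum.cong refl) (auto simp: orthonormal_for_def subset_iff)
  then show ?thesis using assms by simp
qed

lemma orthonormal_for_independent:
  assumes "bilinear q" "orthonormal_for q E"
  shows "independent E"
  unfolding independent_explicit_module
proof (intro allI impI)
  fix S c e
  assume S: "finite S" "S \<subseteq> E" "(\<Sum>v\<in>S. c v *\<^sub>R v) = 0" "e \<in> S"
  show "c e = 0"
    using orthonormal_for_coeff[OF assms S(1,2,4), of c] S(3) assms(1) by (simp add: bilinear_lzero)
qed

lemma orthonormal_for_finite: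
  assumes "bilinear q" "orthonormal_for q E"
  shows "finite E"
  using orthonormal_for_independent[OF assms] independent_imp_finite by blast

lemma orthonormal_basis_of_expand:
  assumes q: "bilinear q" and E: "orthonormal_basis_of q V E" and v: "v \<in> V"
  shows "v = (\<Sum>e\<in>E. q v e *\<^sub>R e)"
proof -
  have on: "orthonormal_for q E" and sp: "span E = V"
    using E by (auto simp: orthonormal_basis_of_iff)
  have fin: "finite E" by (rule orthonormal_for_finite[OF q on])
  obtain c where c: "v = (\<Sum>e\<in>E. c e *\<^sub>R e)"
    using v unfolding sp[symmetric] span_finite[OF fin] by auto
  have "q v e = c e" if "e \<in> E" for e
    unfolding c using orthonormal_for_coeff[OF q on fin subset_refl that] .
  then show ?thesis using c by simp
qed

lemma card_orthonormal_basis: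
  assumes "bilinear q" "orthonormal_basis_of q V E"
  shows "card E = dim V"
  using dim_span_eq_card_independent[OF orthonormal_for_independent[OF assms(1)], of E] assms(2)
  by (auto simp: orthonormal_basis_of_iff)

text \<open>Gram-Schmidt as a maximality argument: independence bounds the cardinality of the
  orthonormal sets between \<open>E0\<close> and \<open>V\<close>, so a largest one exists, and a
  vector of \<open>V\<close> outside its span would supply one more member. The prescribed part
  \<open>E0\<close> lets a given unit vector belong to the basis.\<close>

lemma orthonormal_basis_extend:
  assumes q: "inner_form q" and V: "subspace V" and E0: "E0 \<subseteq> V" "orthonormal_for q E0"
  obtains E where "E0 \<subseteq> E" "orthonormal_basis_of q V E"
proof -
  define P where "P E \<longleftrightarrow> E0 \<subseteq> E \<and> E \<subseteq> V \<and> orthonormal_for q E" for E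
  note bl = inner_form_bilinear[OF q]
  have bound: "card E \<le> DIM('a)" if "P E" for E
    using that orthonormal_for_independent[OF bl] independent_bound unfolding P_def by blast
  have "P E0" using E0 by (simp add: P_def)
  then obtain E where E: "P E" and max: "\<And>E'. P E' \<Longrightarrow> card E' \<le> card E"
    using ex_has_greatest_nat[of P E0 card "Suc DIM('a)"] bound by (auto simp: less_Suc_eq_le)
  have on: "orthonormal_for q E" and fin: "finite E" and EV: "E \<subseteq> V"
    using E orthonormal_for_finite[OF bl] by (auto simp: P_def)
  have "span E = V"
  proof (rule ccontr)
    assume "span E \<noteq> V"
    moreover have "span E \<subseteq> V" using EV V by (rule span_minimal)
    ultimately obtain v where v: "v \<in> V" "v \<notin> span E" by blast
    \<comment> \<open>The part of \<open>v\<close> orthogonal to \<open>E\<close>; normalized, it is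
      the additional member.\<close>
    define w where "w = v - (\<Sum>e\<in>E. q v e *\<^sub>R e)"
    have sumspan: "(\<Sum>e\<in>E. q v e *\<^sub>R e) \<in> span E"
      by (intro span_sum span_mul span_base)
    have "w \<noteq> 0" using v sumspan unfolding w_def by auto
    then have pos: "q w w > 0" by (rule inner_form_pos[OF q])
    have wV: "w \<in> V" unfolding w_def
      using v sumspan \<open>span E \<subseteq> V\<close> V by (meson in_mono subspace_diff)
    have orth: "q w e = 0" if "e \<in> E" for e
      using orthonormal_for_coeff[OF bl on fin subset_refl that, of "q v"]
      by (simp add: w_def bilinear_lsub[OF bl])
    define u where "u = (1 / sqrt (q w w)) *\<^sub>R w"
    have uu: "q u u = 1" using pos
      by (simp add: u_def bilinear_simps[OF bl])
    have ue: "q u e = 0" "q e u = 0" if "e \<in> E" for e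
      using orth[OF that] inner_form_sym[OF q] by (simp_all add: u_def bilinear_simps[OF bl])
    have "u \<notin> E" using uu ue(1)[of u] by auto
    have "u \<in> V" unfolding u_def using V wV by (rule subspace_scale)
    moreover have "orthonormal_for q (insert u E)"
      unfolding orthonormal_for_def
    proof (intro ballI)
      fix a b assume ab: "a \<in> insert u E" "b \<in> insert u E"
      show "q a b = (if a = b then 1 else 0)"
      proof (cases "a \<in> E \<and> b \<in> E")
        case True
        then show ?thesis using on by (simp add: orthonormal_for_def)
      next
        case False
        then show ?thesis using ab uu ue \<open>u \<notin> E\<close> by (cases "a = u"; cases "b = u") simp_all
      qed
    qed
    ultimately have "P (insert u E)" using E by (auto simp: P_def)
    from max[OF this] show False using fin \<open>u \<notin> E\<close> by simp
  qed
  then show thesis using that[of E] E on by (auto simp: P_def orthonormal_basis_of_iff)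
qed

lemma orthonormal_basis_exists:
  assumes "inner_form q" "subspace V"
  obtains E where "orthonormal_basis_of q V E"
  using orthonormal_basis_extend[OF assms, of "{}"] by (auto simp: orthonormal_for_def)

text \<open>Expanding each \<open>e\<close> over \<open>F\<close> in the first slot, exchanging the
  sums and using \<open>q e a = q a e\<close> reassembles \<open>a\<close> in the second slot. This
  removes the arbitrary choice made in \<open>trace_over\<close>.\<close>

lemma sum_orthonormal_basis_unique:
  assumes q: "inner_form q" and \<beta>: "bilinear \<beta>"
    and E: "orthonormal_basis_of q V E" and F: "orthonormal_basis_of q V F"
  shows "(\<Sum>e\<in>E. \<beta> e e) = (\<Sum>e\<in>F. \<beta> e e)"
proof -
  note bl = inner_form_bilinear[OF q]
  have inV: "e \<in> V" if "e \<in> E \<or> e \<in> F" for e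
    using that E F by (auto simp: orthonormal_basis_of_def intro: span_base)
  have "(\<Sum>e\<in>E. \<beta> e e) = (\<Sum>e\<in>E. \<Sum>a\<in>F. q e a *\<^sub>R \<beta> a e)"
  proof (rule sum.cong[OF refl])
    fix e assume "e \<in> E"
    then have "(\<Sum>a\<in>F. q e a *\<^sub>R a) = e"
      using orthonormal_basis_of_expand[OF bl F inV] by simp
    then show "\<beta> e e = (\<Sum>a\<in>F. q e a *\<^sub>R \<beta> a e)"
      using bilinear_sum_left[OF \<beta>, of "\<lambda>a. q e a" "\<lambda>a. a" F e] by simp
  qed
  also have "\<dots> = (\<Sum>a\<in>F. \<Sum>e\<in>E. q a e *\<^sub>R \<beta> a e)"
    by (subst sum.swap) (intro sum.cong refl, metis inner_form_sym[OF q])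
  also have "\<dots> = (\<Sum>a\<in>F. \<beta> a a)"
  proof (rule sum.cong[OF refl])
    fix a assume "a \<in> F"
    then have "(\<Sum>e\<in>E. q a e *\<^sub>R e) = a"
      using orthonormal_basis_of_expand[OF bl E inV] by simp
    then show "(\<Sum>e\<in>E. q a e *\<^sub>R \<beta> a e) = \<beta> a a"
      using bilinear_sum_right[OF \<beta>, of a "\<lambda>e. q a e" "\<lambda>e. e" E] by simp
  qed
  finally show ?thesis .
qed

lemma trace_over_eq:
  assumes "inner_form q" "bilinear \<beta>" "orthonormal_basis_of q V E"
  shows "trace_over q V \<beta> = (\<Sum>e\<in>E. \<beta> e e)"
  unfolding trace_over_def
  by (rule sum_orthonormal_basis_unique[OF assms(1,2) someI assms(3)]) (rule assms(3))

text \<open>The divergence is defined with the Euclidean basis, the frames are orthonormal for the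
  metric. Expanding \<open>b\<close> over \<open>E\<close> and exchanging the sums passes from one
  trace to the other.\<close>

lemma trace_linear_eq:
  fixes L :: "'a::euclidean_space \<Rightarrow> 'a"
  assumes q: "inner_form q" and L: "linear L" and E: "orthonormal_basis_of q UNIV E"
  shows "(\<Sum>b\<in>Basis. L b \<bullet> b) = (\<Sum>e\<in>E. q (L e) e)"
proof -
  note bl = inner_form_bilinear[OF q]
  have "(\<Sum>b\<in>Basis. L b \<bullet> b) = (\<Sum>b\<in>Basis. \<Sum>e\<in>E. q b e * (L e \<bullet> b))"
  proof (rule sum.cong[OF refl])
    fix b :: 'a
    have "L b = L (\<Sum>e\<in>E. q b e *\<^sub>R e)"
      using orthonormal_basis_of_expand[OF bl E, of b] by simp
    then have "L b = (\<Sum>e\<in>E. q b e *\<^sub>R L e)"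
      by (simp add: linear_sum[OF L] linear_cmul[OF L])
    then show "L b \<bullet> b = (\<Sum>e\<in>E. q b e * (L e \<bullet> b))" by (simp add: inner_sum_left)
  qed
  also have "\<dots> = (\<Sum>e\<in>E. q (\<Sum>b\<in>Basis. (L e \<bullet> b) *\<^sub>R b) e)"
    by (subst sum.swap) (simp only: bilinear_sum_left[OF bl] real_scaleR_def mult.commute)
  finally show ?thesis by (simp add: euclidean_representation)
qed

text \<open>Riesz representation: the vector with coefficients \<open>l e\<close> in an orthonormal
  basis works. It justifies the definite descriptions in \<open>christoffel\<close> and
  \<open>local_grad\<close>.\<close>

lemma inner_form_representation:
  assumes q: "inner_form q" and l: "linear l"
  shows "\<exists>!z. \<forall>u. q z u = l u"
proof -
  note bl = inner_form_bilinear[OF q]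
  obtain E where E: "orthonormal_basis_of q UNIV E"
    using orthonormal_basis_exists[OF q subspace_UNIV] .
  have "q (\<Sum>e\<in>E. l e *\<^sub>R e) u = l u" for u
  proof -
    have "l u = l (\<Sum>e\<in>E. q u e *\<^sub>R e)"
      using orthonormal_basis_of_expand[OF bl E, of u] by simp
    also have "\<dots> = (\<Sum>e\<in>E. l e * q e u)"
      by (simp add: linear_sum[OF l] linear_cmul[OF l] inner_form_sym[OF q, of u] mult.commute)
    finally show ?thesis by (simp add: bilinear_sum_left[OF bl])
  qed
  then show ?thesis by (intro ex1I[of _ "\<Sum>e\<in>E. l e *\<^sub>R e"]) (auto intro: inner_form_eqI[OF q])
qed

text \<open>Each coefficient of a unit vector in a \<open>q\<close>-orthonormal basis is at most
  \<open>1\<close> in absolute value, since removing one component leaves a vector of nonnegative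
  square \<open>1 - (q v e)\<^sup>2\<close>.\<close>

lemma inner_form_unit_bounded:
  assumes q: "inner_form q"
  obtains r where "\<And>v. q v v = 1 \<Longrightarrow> norm v \<le> r"
proof -
  note bl = inner_form_bilinear[OF q]
  obtain E where E: "orthonormal_basis_of q UNIV E"
    using orthonormal_basis_exists[OF q subspace_UNIV] .
  have fin: "finite E" using E orthonormal_for_finite[OF bl] by (auto simp: orthonormal_basis_of_iff)
  have "norm v \<le> (\<Sum>e\<in>E. norm e)" if "q v v = 1" for v
  proof -
    have "\<bar>q v e\<bar> \<le> 1" if e: "e \<in> E" for e
    proof -
      have ee: "q e e = 1" using E e by (simp add: orthonormal_basis_of_def)
      have ev: "q e v = q v e" by (rule inner_form_sym[OF q])
      have "q (v - q v e *\<^sub>R e) (v - q v e *\<^sub>R e) = 1 - (q v e)\<^sup>2"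
        by (simp add: bilinear_simps[OF bl] \<open>q v v = 1\<close> ee ev power2_eq_square)
      with inner_form_nonneg[OF q] have "(q v e)\<^sup>2 \<le> 1" by (metis diff_ge_0_iff_ge)
      then show ?thesis by (simp add: abs_square_le_1)
    qed
    then have "norm (\<Sum>e\<in>E. q v e *\<^sub>R e) \<le> (\<Sum>e\<in>E. norm e)"
      by (intro sum_norm_le) (simp add: mult_left_le_one_le)
    then show ?thesis using orthonormal_basis_of_expand[OF bl E, of v] by simp
  qed
  then show thesis by (rule that)
qed

lemma orthonormal_pair_independent:
  assumes q: "inner_form q" and uv: "q u u = 1" "q v v = 1" "q u v = 0"
  shows "u \<noteq> v" "independent {u, v}"
proof -
  show "u \<noteq> v" using uv by auto
  have "orthonormal_for q {u, v}"
    using uv inner_form_sym[OF q, of v u] by (auto simp: orthonormal_for_def)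
  then show "independent {u, v}" using orthonormal_for_independent[OF inner_form_bilinear[OF q]] by blast
qed

section \<open>Second derivatives and families of bilinear maps\<close>

text \<open>The mean value theorem turns the second difference into a difference of two values of
  \<open>f' y u\<close>, and the derivative \<open>A\<close> at \<open>x\<close> linearizes both.
  Differentiability of \<open>f' y u\<close> at the single point \<open>x\<close> suffices, so no
  continuity of second derivatives enters.\<close>

lemma second_difference_quotient_tendsto:
  fixes f :: "'a::real_normed_vector \<Rightarrow> real"
  assumes S: "open S" "x \<in> S" and f: "\<And>y. y \<in> S \<Longrightarrow> (f has_derivative f' y) (at y)"
    and A: "((\<lambda>y. f' y u) has_derivative A) (at x)"
  shows "((\<lambda>t. (f (x + t *\<^sub>R u + t *\<^sub>R v) - f (x + t *\<^sub>R u) - f (x + t *\<^sub>R v) + f x) / t\<^sup>2) \<longlongrightarrow> A v)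
           (at_right 0)"
proof (rule tendstoI)
  fix e :: real assume "e > 0"
  \<comment> \<open>The two linearization errors below are at most
    \<open>e' * t * (norm u + norm v)\<close> and \<open>e' * t * norm u\<close>; \<open>K\<close>
    dominates the sum of the factors, and the summand \<open>1\<close> keeps it positive when
    \<open>u = v = 0\<close>.\<close>
  define K where "K = 2 * norm u + norm v + 1"
  have K: "K > 0" by (simp add: K_def add_nonneg_pos)
  define e' where "e' = e / (2 * K)"
  have e': "e' > 0" using \<open>e > 0\<close> K by (simp add: e'_def)
  have lin: "linear A" using A has_derivative_linear by blast
  obtain d1 where d1: "d1 > 0"
    "\<And>y. norm (y - x) < d1 \<Longrightarrow> \<bar>f' y u - f' x u - A (y - x)\<bar> \<le> e' * norm (y - x)"
    using A e' unfolding has_derivative_at_alt by (auto simp: real_norm_def)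
  obtain d2 where d2: "d2 > 0" "ball x d2 \<subseteq> S" using S openE by blast
  \<comment> \<open>For \<open>t < d\<close> the parallelogram spanned by \<open>t u\<close> and
    \<open>t v\<close> at \<open>x\<close> lies in \<open>S\<close> and in the ball on which
    \<open>f' y u\<close> is linearized.\<close>
  define d where "d = min d1 d2 / K"
  have "d > 0" using d1 d2 K by (simp add: d_def)
  have main: "dist ((f (x + t *\<^sub>R u + t *\<^sub>R v) - f (x + t *\<^sub>R u) - f (x + t *\<^sub>R v) + f x) / t\<^sup>2) (A v) < e"
    if t: "0 < t" "t < d" for t
  proof -
    have tK: "t * K < min d1 d2" using t K by (simp add: d_def field_simps)
    have small: "norm (s *\<^sub>R u + r *\<^sub>R v) \<le> t * (norm u + norm v)"
      if "0 \<le> s" "s \<le> t" "0 \<le> r" "r \<le> t" for s r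
    proof -
      have "norm (s *\<^sub>R u + r *\<^sub>R v) \<le> s * norm u + r * norm v"
        using norm_triangle_ineq[of "s *\<^sub>R u" "r *\<^sub>R v"] that by simp
      also have "\<dots> \<le> t * norm u + t * norm v"
        using that by (intro add_mono mult_right_mono) auto
      finally show ?thesis by (simp add: algebra_simps)
    qed
    have "norm u + norm v \<le> K" by (simp add: K_def)
    then have "t * (norm u + norm v) \<le> t * K" using t by (intro mult_left_mono) auto
    then have near: "norm (s *\<^sub>R u + r *\<^sub>R v) < min d1 d2" 
      if "0 \<le> s" "s \<le> t" "0 \<le> r" "r \<le> t" for s r
      using small[OF that] tK by linarith
    have inS: "x + s *\<^sub>R u + r *\<^sub>R v \<in> S" if "0 \<le> s" "s \<le> t" "0 \<le> r" "r \<le> t" for s r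
      using near[OF that] d2(2) by (auto simp: subset_iff dist_norm add.assoc norm_minus_commute)
    have der: "((\<lambda>s. f (x + s *\<^sub>R u + t *\<^sub>R v) - f (x + s *\<^sub>R u)) has_derivative
        (\<lambda>h. f' (x + s *\<^sub>R u + t *\<^sub>R v) (h *\<^sub>R u) - f' (x + s *\<^sub>R u) (h *\<^sub>R u))) (at s)"
      if "0 \<le> s" "s \<le> t" for s
    proof (rule has_derivative_diff)
      show "((\<lambda>s. f (x + s *\<^sub>R u + t *\<^sub>R v)) has_derivative
          (\<lambda>h. f' (x + s *\<^sub>R u + t *\<^sub>R v) (h *\<^sub>R u))) (at s)"
        using inS[of s t] that t
        by (intro has_derivative_compose[OF _ f]) (auto intro!: derivative_eq_intros)
      show "((\<lambda>s. f (x + s *\<^sub>R u)) has_derivative (\<lambda>h. f' (x + s *\<^sub>R u) (h *\<^sub>R u))) (at s)"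
        using inS[of s 0] that t
        by (intro has_derivative_compose[OF _ f]) (auto intro!: derivative_eq_intros)
    qed
    \<comment> \<open>The mean value theorem in the direction \<open>u\<close>, applied to the
      increment of \<open>f\<close> along \<open>t v\<close>.\<close>
    have "\<exists>\<xi>\<in>{0<..<t}. (f (x + t *\<^sub>R u + t *\<^sub>R v) - f (x + t *\<^sub>R u)) - (f (x + 0 *\<^sub>R u + t *\<^sub>R v) - f (x + 0 *\<^sub>R u))
        = f' (x + \<xi> *\<^sub>R u + t *\<^sub>R v) ((t - 0) *\<^sub>R u) - f' (x + \<xi> *\<^sub>R u) ((t - 0) *\<^sub>R u)"
      by (rule mvt_simple[OF t(1)]) (rule has_derivative_at_withinI, rule der, auto)
    then obtain \<xi> where \<xi>: "0 < \<xi>" "\<xi> < t" and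
      eq: "f (x + t *\<^sub>R u + t *\<^sub>R v) - f (x + t *\<^sub>R u) - f (x + t *\<^sub>R v) + f x =
        f' (x + \<xi> *\<^sub>R u + t *\<^sub>R v) (t *\<^sub>R u) - f' (x + \<xi> *\<^sub>R u) (t *\<^sub>R u)"
      by auto
    have l1: "f' y (t *\<^sub>R u) = t * f' y u" if "y \<in> S" for y
      using linear_cmul[OF has_derivative_linear[OF f[OF that]]] by simp
    have eq': "f (x + t *\<^sub>R u + t *\<^sub>R v) - f (x + t *\<^sub>R u) - f (x + t *\<^sub>R v) + f x =
        t * (f' (x + \<xi> *\<^sub>R u + t *\<^sub>R v) u - f' (x + \<xi> *\<^sub>R u) u)"
      using inS[of \<xi> t] inS[of \<xi> 0] \<xi> by (simp add: eq l1 right_diff_distrib)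
    have b1: "\<bar>f' (x + \<xi> *\<^sub>R u + t *\<^sub>R v) u - f' x u - A (\<xi> *\<^sub>R u + t *\<^sub>R v)\<bar> \<le> e' * (t * (norm u + norm v))"
      using d1(2)[of "x + \<xi> *\<^sub>R u + t *\<^sub>R v"] near[of \<xi> t] small[of \<xi> t] \<xi> e'
      by (smt (verit, best) add.assoc add_diff_cancel_left' mult_left_mono)
    have "norm (\<xi> *\<^sub>R u) \<le> t * norm u" using \<xi> by (simp add: mult_right_mono)
    then have b2: "\<bar>f' (x + \<xi> *\<^sub>R u) u - f' x u - A (\<xi> *\<^sub>R u)\<bar> \<le> e' * (t * norm u)"
      using d1(2)[of "x + \<xi> *\<^sub>R u"] near[of \<xi> 0] \<xi> e'
      by (smt (verit, best) add_diff_cancel_left' mult_left_mono scale_zero_left add.right_neutral)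
    have Aeq: "A (\<xi> *\<^sub>R u + t *\<^sub>R v) - A (\<xi> *\<^sub>R u) = t * A v"
      by (simp add: linear_add[OF lin] linear_cmul[OF lin])
    define Q where "Q = f' (x + \<xi> *\<^sub>R u + t *\<^sub>R v) u - f' (x + \<xi> *\<^sub>R u) u"
    have "\<bar>Q - t * A v\<bar> \<le> e' * (t * (norm u + norm v)) + e' * (t * norm u)"
      using b1 b2 Aeq unfolding Q_def by linarith
    also have "\<dots> = (e' * (K - 1)) * t" by (simp add: K_def algebra_simps)
    also have "\<dots> \<le> (e' * K) * t" using e' t by (intro mult_right_mono mult_left_mono) auto
    also have "\<dots> = (e / 2) * t" using K by (simp add: e'_def)
    finally have "\<bar>Q - t * A v\<bar> \<le> (e / 2) * t" .
    then have "\<bar>Q / t - A v\<bar> \<le> e / 2"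
      using t by (simp add: field_simps abs_le_iff)
    moreover have "t * Q / t\<^sup>2 = Q / t" using t by (simp add: power2_eq_square)
    ultimately show ?thesis using \<open>e > 0\<close> by (simp add: eq' Q_def[symmetric] dist_real_def)
  qed
  show "\<forall>\<^sub>F t in at_right 0. dist ((f (x + t *\<^sub>R u + t *\<^sub>R v) - f (x + t *\<^sub>R u) - f (x + t *\<^sub>R v) + f x) / t\<^sup>2) (A v) < e"
    unfolding eventually_at_right_field using main \<open>d > 0\<close> by blast
qed

text \<open>The second difference quotient does not change when \<open>u\<close> and
  \<open>v\<close> are exchanged, so its limit is both \<open>A v\<close> and
  \<open>B u\<close>.\<close>

lemma symmetric_second_derivative_real:
  fixes f :: "'a::real_normed_vector \<Rightarrow> real"
  assumes S: "open S" "x \<in> S" and f: "\<And>y. y \<in> S \<Longrightarrow> (f has_derivative f' y) (at y)"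
    and A: "((\<lambda>y. f' y u) has_derivative A) (at x)"
    and B: "((\<lambda>y. f' y v) has_derivative B) (at x)"
  shows "A v = B u"
proof (rule tendsto_unique)
  let ?Q = "\<lambda>t. (f (x + t *\<^sub>R u + t *\<^sub>R v) - f (x + t *\<^sub>R u) - f (x + t *\<^sub>R v) + f x) / t\<^sup>2"
  show "(?Q \<longlongrightarrow> A v) (at_right 0)"
    by (rule second_difference_quotient_tendsto[OF S f A])
  have "?Q = (\<lambda>t. (f (x + t *\<^sub>R v + t *\<^sub>R u) - f (x + t *\<^sub>R v) - f (x + t *\<^sub>R u) + f x) / t\<^sup>2)"
    by (intro ext arg_cong2[where f="(/)"] refl) (simp add: ac_simps)
  then show "(?Q \<longlongrightarrow> B u) (at_right 0)"
    using second_difference_quotient_tendsto[OF S f B, of u] by simp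
qed simp

text \<open>Pairing with an arbitrary \<open>c\<close> reduces to real functions, to which the mean
  value theorem applies with equality.\<close>

lemma symmetric_second_derivative:
  fixes f :: "'a::real_normed_vector \<Rightarrow> 'b::real_inner"
  assumes S: "open S" "x \<in> S" and f: "\<And>y. y \<in> S \<Longrightarrow> f differentiable (at y)"
    and A: "(\<lambda>y. frechet_derivative f (at y) u) differentiable (at x)"
    and B: "(\<lambda>y. frechet_derivative f (at y) v) differentiable (at x)"
  shows "frechet_derivative (\<lambda>y. frechet_derivative f (at y) u) (at x) v =
    frechet_derivative (\<lambda>y. frechet_derivative f (at y) v) (at x) u" (is "?l = ?r")
proof -
  have "?l \<bullet> c = ?r \<bullet> c" for c
  proof -
    show ?thesis
    using f A B unfolding frechet_derivative_works
    by (intro symmetric_second_derivative_real[where f="\<lambda>y. f y \<bullet> c" and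
          f'="\<lambda>y h. frechet_derivative f (at y) h \<bullet> c" and S=S and x=x and
          A="\<lambda>h. frechet_derivative (\<lambda>y. frechet_derivative f (at y) u) (at x) h \<bullet> c" and
          B="\<lambda>h. frechet_derivative (\<lambda>y. frechet_derivative f (at y) v) (at x) h \<bullet> c"] S)
       (auto intro!: has_derivative_inner_left)
  qed
  then show ?thesis by (subst vector_eq_rdot[symmetric]) blast
qed

section \<open>Derivatives of bilinear expressions and of solutions of linear equations with
  variable coefficients\<close>

lemma bilinear_expand:
  fixes \<beta> :: "'a::euclidean_space \<Rightarrow> 'b::euclidean_space \<Rightarrow> 'c::real_vector"
  assumes "bilinear \<beta>"
  shows "\<beta> v w = (\<Sum>b\<in>Basis. \<Sum>c\<in>Basis. ((v \<bullet> b) * (w \<bullet> c)) *\<^sub>R \<beta> b c)"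
proof -
  have "\<beta> v w = \<beta> (\<Sum>b\<in>Basis. (v \<bullet> b) *\<^sub>R b) (\<Sum>c\<in>Basis. (w \<bullet> c) *\<^sub>R c)"
    by (simp add: euclidean_representation)
  then show ?thesis
    unfolding bilinear_sum_left[OF assms] bilinear_sum_right[OF assms]
    by (subst sum.swap) (simp add: scaleR_sum_right mult.commute)
qed

text \<open>Leibniz rule with three factors: the form and its two arguments all vary. Expansion in
  the Euclidean basis reduces it to products of scalar functions with the entries
  \<open>\<beta> y b c\<close>.\<close>

lemma has_derivative_bilinear_family:
  fixes \<beta> :: "'x::real_normed_vector \<Rightarrow> 'a::euclidean_space \<Rightarrow> 'b::euclidean_space \<Rightarrow> 'c::real_normed_vector"
  assumes U: "open U" "x \<in> U" and \<beta>: "\<And>y. y \<in> U \<Longrightarrow> bilinear (\<beta> y)"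
    and d\<beta>: "\<And>v w. ((\<lambda>y. \<beta> y v w) has_derivative \<beta>' v w) (at x)"
    and V: "(V has_derivative V') (at x)" and W: "(W has_derivative W') (at x)"
  shows "((\<lambda>y. \<beta> y (V y) (W y)) has_derivative
           (\<lambda>u. \<beta>' (V x) (W x) u + \<beta> x (V' u) (W x) + \<beta> x (V x) (W' u))) (at x)"
proof -
  have gen: "((\<lambda>y. \<beta> y (V y) (W y)) has_derivative
      (\<lambda>u. \<Sum>b\<in>Basis. \<Sum>c\<in>Basis. ((V x \<bullet> b) * (W x \<bullet> c)) *\<^sub>R \<beta>' b c u +
         ((V x \<bullet> b) * (W' u \<bullet> c) + (V' u \<bullet> b) * (W x \<bullet> c)) *\<^sub>R \<beta> x b c)) (at x)"
    if V: "(V has_derivative V') (at x)" and W: "(W has_derivative W') (at x)" for V V' W W'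
  proof (rule has_derivative_transform_within_open[OF _ U])
    show "((\<lambda>y. \<Sum>b\<in>Basis. \<Sum>c\<in>Basis. ((V y \<bullet> b) * (W y \<bullet> c)) *\<^sub>R \<beta> y b c) has_derivative
      (\<lambda>u. \<Sum>b\<in>Basis. \<Sum>c\<in>Basis. ((V x \<bullet> b) * (W x \<bullet> c)) *\<^sub>R \<beta>' b c u +
         ((V x \<bullet> b) * (W' u \<bullet> c) + (V' u \<bullet> b) * (W x \<bullet> c)) *\<^sub>R \<beta> x b c)) (at x)"
      by (intro has_derivative_sum has_derivative_scaleR has_derivative_mult
          has_derivative_inner_left V W d\<beta>)
  qed (rule bilinear_expand[OF \<beta>, symmetric])
  \<comment> \<open>The expansion with constant arguments, compared with \<open>d\<beta>\<close> by
    uniqueness of the derivative, shows that \<open>\<beta>'\<close> is determined by its values on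
    basis vectors.\<close>
  have eq: "\<beta>' v w = (\<lambda>u. \<Sum>b\<in>Basis. \<Sum>c\<in>Basis. ((v \<bullet> b) * (w \<bullet> c)) *\<^sub>R \<beta>' b c u)" for v w
    using gen[OF has_derivative_const has_derivative_const, of v w] d\<beta>[of v w]
    by (intro has_derivative_unique[of "\<lambda>y. \<beta> y v w"]) auto
  show ?thesis
    by (rule has_derivative_eq_rhs[OF gen[OF V W]])
       (simp add: fun_eq_iff eq[of "V x" "W x"] bilinear_expand[OF \<beta>[OF U(2)], of "V' _"]
          bilinear_expand[OF \<beta>[OF U(2)], of "V x"] sum.distrib scaleR_left_distrib)
qed

lemma frechet_derivative_eqI: "(f has_derivative f') (at x) \<Longrightarrow> frechet_derivative f (at x) = f'"
  using frechet_derivative_at by metis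

text \<open>\<open>z\<close> solves a linear equation whose coefficients depend on the point.
  Lowering the index, \<open>(y, v) \<mapsto> (y, G y v)\<close>, is differentiable with invertible
  derivative, so by the inverse function theorem raising the index is differentiable too, and
  \<open>z\<close> is obtained by raising the index of \<open>k\<close>.\<close>

lemma differentiable_representation:
  fixes G :: "'a::euclidean_space \<Rightarrow> 'a \<Rightarrow> 'a \<Rightarrow> real"
  assumes U: "open U" "x \<in> U" and G: "\<And>y. y \<in> U \<Longrightarrow> inner_form (G y)"
    and dG: "\<And>y v w. y \<in> U \<Longrightarrow> (\<lambda>y. G y v w) differentiable (at y)"
    and z: "\<And>y u. y \<in> U \<Longrightarrow> G y (z y) u = k y u"
    and k: "\<And>u. (\<lambda>y. k y u) differentiable (at x)"
  shows "z differentiable (at x)"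
proof -
  \<comment> \<open>Covectors are encoded as vectors through the Euclidean basis, and the base point
    is carried along so that \<open>f\<close> maps a space to itself.\<close>
  define f where "f p = (fst p, \<Sum>b\<in>Basis. G (fst p) (snd p) b *\<^sub>R b)" for p :: "'a \<times> 'a"
  define R where "R y w = (THE z. \<forall>u. G y z u = w \<bullet> u)" for y w
  define g where "g p = (fst p, R (fst p) (snd p))" for p :: "'a \<times> 'a"
  have RI: "R y w = z" if "y \<in> U" "\<And>u. G y z u = w \<bullet> u" for y w z
    unfolding R_def
    by (rule the1_equality[OF inner_form_representation[OF G[OF \<open>y \<in> U\<close>]]])
       (auto intro: that bounded_linear.linear bounded_linear_inner_right)
  have R: "G y (R y w) u = w \<bullet> u" if "y \<in> U" for y w u
    using theI'[OF inner_form_representation[OF G[OF that], of "\<lambda>u. w \<bullet> u"]]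
    unfolding R_def by (simp add: bounded_linear.linear bounded_linear_inner_right)
  have rep: "(\<Sum>b\<in>Basis. q b *\<^sub>R b) \<bullet> u = q u" if "linear q" for q :: "'a \<Rightarrow> real" and u
  proof -
    have "q u = q (\<Sum>b\<in>Basis. (u \<bullet> b) *\<^sub>R b)" by (simp add: euclidean_representation)
    then show ?thesis
      by (simp add: linear_sum[OF that] linear_cmul[OF that] inner_sum_left inner_commute[of u] mult.commute)
  qed
  have lin: "linear (G y v)" if "y \<in> U" for y v
    by (rule bilinear_linear_right[OF inner_form_bilinear[OF G[OF that]]])
  define DG where "DG y v w = frechet_derivative (\<lambda>y. G y v w) (at y)" for y v w
  have DG: "((\<lambda>y. G y v w) has_derivative DG y v w) (at y)" if "y \<in> U" for y v w
    using dG[OF that] unfolding frechet_derivative_works DG_def .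
  define f' where "f' p h = (fst h, \<Sum>b\<in>Basis. (DG (fst p) (snd p) b (fst h) + G (fst p) (snd h) b) *\<^sub>R b)"
    for p h :: "'a \<times> 'a"
  have open_UU: "open (U \<times> (UNIV::'a set))" using U by (simp add: open_Times)
  have f': "(f has_derivative f' p) (at p)" if p: "fst p \<in> U" for p
  proof -
    have "((\<lambda>p. G (fst p) (snd p) b) has_derivative
        (\<lambda>h. DG (fst p) (snd p) b (fst h) + G (fst p) (snd h) b)) (at p)" for b
    proof -
      have "((\<lambda>p. G (fst p) (snd p) b) has_derivative
        (\<lambda>h. DG (fst p) (snd p) b (fst h) + G (fst p) (snd h) b + G (fst p) (snd p) 0)) (at p)"
        by (rule has_derivative_bilinear_family[where \<beta>="\<lambda>p. G (fst p)" and U="U \<times> UNIV" and W="\<lambda>_. b"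
              and \<beta>'="\<lambda>v w h. DG (fst p) v w (fst h)"])
           (use p open_UU inner_form_bilinear[OF G] in
            \<open>auto simp: mem_Times_iff intro!: has_derivative_const has_derivative_snd has_derivative_ident
              has_derivative_compose[OF has_derivative_fst[OF has_derivative_ident] DG[OF p]]\<close>)
      then show ?thesis using linear_0[OF lin[OF p]] by simp
    qed
    then show ?thesis unfolding f_def f'_def
      by (intro has_derivative_Pair has_derivative_fst has_derivative_ident has_derivative_sum
          has_derivative_scaleR_left)
  qed
  \<comment> \<open>The derivative of \<open>f\<close> is block triangular: the base component is
    copied, and the vector component is recovered by raising the index of what remains after
    subtracting the variation of \<open>G\<close>.\<close>
  define g' where "g' h = (fst h, R x (snd h - (\<Sum>b\<in>Basis. DG x (z x) b (fst h) *\<^sub>R b)))" for h :: "'a \<times> 'a"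
  have "(g has_derivative g') (at (f (x, z x)))"
  proof (rule has_derivative_inverse_strong[OF open_UU, of "(x, z x)"])
    show "(x, z x) \<in> U \<times> UNIV" using U by simp
    show "continuous_on (U \<times> UNIV) f"
      using f' has_derivative_continuous by (intro continuous_at_imp_continuous_on) fastforce
    show "g (f p) = p" if "p \<in> U \<times> UNIV" for p
    proof -
      have "fst p \<in> U" using that by auto
      then show ?thesis
        unfolding f_def g_def by (auto intro!: prod_eqI RI simp: rep[OF lin])
    qed
    show "(f has_derivative f' (x, z x)) (at (x, z x))" using f' U by simp
    show "f' (x, z x) \<circ> g' = id"
    proof
      fix h :: "'a \<times> 'a"
      have "(\<Sum>b\<in>Basis. (w \<bullet> b) *\<^sub>R b) = w" for w :: 'a by (rule euclidean_representation)
      then show "(f' (x, z x) \<circ> g') h = id h"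
        by (intro prod_eqI)
           (simp_all add: f'_def g'_def R[OF U(2)] scaleR_left_distrib sum.distrib)
    qed
  qed
  moreover have fx: "f (x, z x) = (x, \<Sum>b\<in>Basis. k x b *\<^sub>R b)"
    using U z by (simp add: f_def)
  moreover have "(\<lambda>y. (y, \<Sum>b\<in>Basis. k y b *\<^sub>R b)) differentiable (at x)"
  proof -
    have "((\<lambda>y. (y, \<Sum>b\<in>Basis. k y b *\<^sub>R b)) has_derivative
      (\<lambda>h. (h, \<Sum>b\<in>Basis. frechet_derivative (\<lambda>y. k y b) (at x) h *\<^sub>R b))) (at x)"
      using k unfolding frechet_derivative_works
      by (intro has_derivative_Pair has_derivative_ident has_derivative_sum has_derivative_scaleR_left) auto
    then show ?thesis by (auto simp: differentiable_def)
  qed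
  ultimately have "(\<lambda>y. g (y, \<Sum>b\<in>Basis. k y b *\<^sub>R b)) differentiable (at x)"
    by (intro differentiable_compose[of g "\<lambda>y. (y, \<Sum>b\<in>Basis. k y b *\<^sub>R b)"]) (auto intro: differentiableI)
  then obtain D where "((\<lambda>y. g (y, \<Sum>b\<in>Basis. k y b *\<^sub>R b)) has_derivative D) (at x)"
    by (auto simp: differentiable_def)
  then have "((\<lambda>y. snd (g (y, \<Sum>b\<in>Basis. k y b *\<^sub>R b))) has_derivative (\<lambda>h. snd (D h))) (at x)"
    by (rule has_derivative_snd)
  then have "(z has_derivative (\<lambda>h. snd (D h))) (at x)"
  proof (rule has_derivative_transform_within_open[OF _ U])
    fix y assume y: "y \<in> U"
    have "linear (k y)" using lin[OF y, of "z y"] z[OF y] by (simp add: fun_eq_iff[symmetric] linear_iff)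
    then show "snd (g (y, \<Sum>b\<in>Basis. k y b *\<^sub>R b)) = z y"
      unfolding g_def using y z by (auto intro!: RI simp: rep)
  qed
  then show ?thesis by (auto simp: differentiable_def)
qed

section \<open>Christoffel symbols and curvature of a metric in coordinates\<close>

abbreviation FD :: "('a::real_normed_vector \<Rightarrow> 'b::real_normed_vector) \<Rightarrow> 'a \<Rightarrow> 'a \<Rightarrow> 'b" where
  "FD f x \<equiv> frechet_derivative f (at x)"

lemma FD_works: "f differentiable (at x) \<Longrightarrow> (f has_derivative FD f x) (at x)"
  by (simp add: frechet_derivative_works)

lemma linear_FD: "f differentiable (at x) \<Longrightarrow> linear (FD f x)"
  using FD_works has_derivative_linear by blast

lemma FD_cong:
  assumes "open U" "x \<in> U" "\<And>y. y \<in> U \<Longrightarrow> f y = g y"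
  shows "FD f x = FD g x"
proof -
  have "(f has_derivative D) (at x) \<longleftrightarrow> (g has_derivative D) (at x)" for D
    using has_derivative_transform_within_open[OF _ assms(1,2)] assms(3) by metis
  then show ?thesis by (simp add: frechet_derivative_def)
qed

lemma bilinear_FD:
  assumes U: "open U" "x \<in> U" and \<beta>: "\<And>y. y \<in> U \<Longrightarrow> bilinear (\<beta> y)"
    and d: "\<And>v w. (\<lambda>y. \<beta> y v w) differentiable (at x)"
  shows "bilinear (\<lambda>v w. FD (\<lambda>y. \<beta> y v w) x h)"
proof -
  note w = FD_works[OF d]
  have "FD (\<lambda>y. \<beta> y (v + v') w) x h = FD (\<lambda>y. \<beta> y v w) x h + FD (\<lambda>y. \<beta> y v' w) x h" for v v' w
    using FD_cong[OF U, of "\<lambda>y. \<beta> y (v + v') w" "\<lambda>y. \<beta> y v w + \<beta> y v' w"]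
      frechet_derivative_eqI[OF has_derivative_add[OF w w], of v w v' w]
    by (simp add: bilinear_ladd[OF \<beta>])
  moreover have "FD (\<lambda>y. \<beta> y w (v + v')) x h = FD (\<lambda>y. \<beta> y w v) x h + FD (\<lambda>y. \<beta> y w v') x h" for v v' w
    using FD_cong[OF U, of "\<lambda>y. \<beta> y w (v + v')" "\<lambda>y. \<beta> y w v + \<beta> y w v'"]
      frechet_derivative_eqI[OF has_derivative_add[OF w w], of w v w v']
    by (simp add: bilinear_radd[OF \<beta>])
  moreover have "FD (\<lambda>y. \<beta> y (c *\<^sub>R v) w) x h = c *\<^sub>R FD (\<lambda>y. \<beta> y v w) x h" for v w c
    using FD_cong[OF U, of "\<lambda>y. \<beta> y (c *\<^sub>R v) w" "\<lambda>y. c *\<^sub>R \<beta> y v w"]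
      frechet_derivative_eqI[OF has_derivative_scaleR_right[OF w], of c v w]
    by (simp add: bilinear_lmul[OF \<beta>])
  moreover have "FD (\<lambda>y. \<beta> y v (c *\<^sub>R w)) x h = c *\<^sub>R FD (\<lambda>y. \<beta> y v w) x h" for v w c
    using FD_cong[OF U, of "\<lambda>y. \<beta> y v (c *\<^sub>R w)" "\<lambda>y. c *\<^sub>R \<beta> y v w"]
      frechet_derivative_eqI[OF has_derivative_scaleR_right[OF w], of c v w]
    by (simp add: bilinear_rmul[OF \<beta>])
  ultimately show ?thesis by (auto simp: bilinear_def intro!: linearI)
qed

lemma Ck_on_Suc_differentiable: "Ck_on (Suc k) S f \<Longrightarrow> x \<in> S \<Longrightarrow> f differentiable (at x)"
  by simp

lemma Ck_on_2_differentiable: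
  assumes "Ck_on 2 S f" "x \<in> S"
  shows "f differentiable (at x)" "(\<lambda>y. FD f y v) differentiable (at x)"
  using assms by (auto simp: numeral_2_eq_2)

text \<open>First-order regularity is what the Koszul formula uses; the second-order condition
  \<open>Ck_on 2\<close> enters separately, where Christoffel symbols or gradients are
  differentiated.\<close>

definition metric_field :: "'a::euclidean_space set \<Rightarrow> ('a \<Rightarrow> 'a \<Rightarrow> 'a \<Rightarrow> real) \<Rightarrow> bool" where
  "metric_field U G \<longleftrightarrow> open U \<and> (\<forall>x\<in>U. inner_form (G x)) \<and>
     (\<forall>x\<in>U. \<forall>v w. (\<lambda>y. G y v w) differentiable (at x))"

lemma riemann_curvature_eq:
  "riemann_curvature G x u v w =
     (FD (\<lambda>y. christoffel G y v w) x u + christoffel G x u (christoffel G x v w)) -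
     (FD (\<lambda>y. christoffel G y u w) x v + christoffel G x v (christoffel G x u w))"
  by (simp add: riemann_curvature_def cov_deriv_def)

lemma riemann_curvature_antisym: "riemann_curvature G x u v w = - riemann_curvature G x v u w"
  by (simp add: riemann_curvature_def)

context
  fixes U :: "'a::euclidean_space set" and G
  assumes G: "metric_field U G"
begin

lemma metric_field_open: "open U"
  and metric_field_inner_form: "x \<in> U \<Longrightarrow> inner_form (G x)"
  and metric_field_bilinear: "x \<in> U \<Longrightarrow> bilinear (G x)"
  and metric_field_differentiable: "x \<in> U \<Longrightarrow> (\<lambda>y. G y v w) differentiable (at x)"
  using G by (auto simp: metric_field_def inner_form_def)

lemma metric_field_sym: "x \<in> U \<Longrightarrow> G x v w = G x w v"
  using metric_field_inner_form inner_form_sym by blast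

lemma FD_metric_sym: "x \<in> U \<Longrightarrow> FD (\<lambda>y. G y v w) x = FD (\<lambda>y. G y w v) x"
  by (rule FD_cong[OF metric_field_open]) (auto intro: metric_field_sym)

lemma bilinear_FD_metric: "x \<in> U \<Longrightarrow> bilinear (\<lambda>v w. FD (\<lambda>y. G y v w) x h)"
  by (rule bilinear_FD[OF metric_field_open])
     (auto intro: metric_field_bilinear metric_field_differentiable)

lemma linear_FD_metric: "x \<in> U \<Longrightarrow> linear (FD (\<lambda>y. G y v w) x)"
  by (rule linear_FD) (rule metric_field_differentiable)

lemma koszul_unique:
  assumes x: "x \<in> U"
  shows "\<exists>!z. \<forall>u. 2 * G x z u = FD (\<lambda>y. G y w u) x v + FD (\<lambda>y. G y v u) x w - FD (\<lambda>y. G y v w) x u"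
proof -
  let ?l = "\<lambda>u. (FD (\<lambda>y. G y w u) x v + FD (\<lambda>y. G y v u) x w - FD (\<lambda>y. G y v w) x u) / 2"
  have "linear ?l"
    by (rule linearI)
       (simp_all add: bilinear_radd[OF bilinear_FD_metric[OF x]] bilinear_rmul[OF bilinear_FD_metric[OF x]]
          linear_add[OF linear_FD_metric[OF x]] linear_cmul[OF linear_FD_metric[OF x]] field_simps)
  from inner_form_representation[OF metric_field_inner_form[OF x] this]
  show ?thesis by (simp add: field_simps)
qed

lemma christoffel_koszul:
  assumes x: "x \<in> U"
  shows "2 * G x (christoffel G x v w) u =
    FD (\<lambda>y. G y w u) x v + FD (\<lambda>y. G y v u) x w - FD (\<lambda>y. G y v w) x u"
  using theI'[OF koszul_unique[OF x]] unfolding christoffel_def by blast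

lemma christoffel_eqI:
  assumes x: "x \<in> U"
    and "\<And>u. 2 * G x z u = FD (\<lambda>y. G y w u) x v + FD (\<lambda>y. G y v u) x w - FD (\<lambda>y. G y v w) x u"
  shows "christoffel G x v w = z"
  unfolding christoffel_def by (rule the1_equality[OF koszul_unique[OF x]]) (use assms in blast)

lemma christoffel_sym: "x \<in> U \<Longrightarrow> christoffel G x v w = christoffel G x w v"
  by (rule christoffel_eqI) (simp_all add: christoffel_koszul FD_metric_sym[of x v w])

lemma bilinear_christoffel:
  assumes x: "x \<in> U"
  shows "bilinear (christoffel G x)"
proof -
  note simps = bilinear_simps[OF metric_field_bilinear[OF x]] bilinear_simps[OF bilinear_FD_metric[OF x]]
    linear_add[OF linear_FD_metric[OF x]] linear_cmul[OF linear_FD_metric[OF x]] distrib_left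
    mult.left_commute[of 2] christoffel_koszul[OF x]
  have r: "linear (christoffel G x v)" for v
  proof (rule linearI)
    show "christoffel G x v (a + b) = christoffel G x v a + christoffel G x v b" for a b
      by (rule christoffel_eqI[OF x]) (simp add: simps)
    show "christoffel G x v (c *\<^sub>R a) = c *\<^sub>R christoffel G x v a" for a c
      by (rule christoffel_eqI[OF x]) (simp add: simps right_diff_distrib)
  qed
  then show ?thesis using christoffel_sym[OF x] by (simp add: bilinear_def)
qed

text \<open>Metric compatibility: in the sum of the Koszul formulas for \<open>(u, v; w)\<close> and
  \<open>(u, w; v)\<close> all terms cancel except the two derivatives in the direction
  \<open>u\<close>.\<close>

lemma christoffel_metric:
  assumes x: "x \<in> U"
  shows "FD (\<lambda>y. G y v w) x u = G x (christoffel G x u v) w + G x v (christoffel G x u w)"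
  using christoffel_koszul[OF x, of u v w] christoffel_koszul[OF x, of u w v]
    FD_metric_sym[OF x, of v w] FD_metric_sym[OF x, of u w]  FD_metric_sym[OF x, of u v]
    metric_field_sym[OF x, of v "christoffel G x u w"]
  by simp

text \<open>Compatibility for variable fields: the variation of the form itself supplies the two
  Christoffel terms that complete \<open>V'\<close> and \<open>W'\<close> to covariant
  derivatives.\<close>

lemma has_derivative_metric:
  assumes x: "x \<in> U" and V: "(V has_derivative V') (at x)" and W: "(W has_derivative W') (at x)"
  shows "((\<lambda>y. G y (V y) (W y)) has_derivative
    (\<lambda>u. G x (V' u + christoffel G x u (V x)) (W x) + G x (V x) (W' u + christoffel G x u (W x)))) (at x)"
proof -
  have "((\<lambda>y. G y (V y) (W y)) has_derivative
    (\<lambda>u. FD (\<lambda>y. G y (V x) (W x)) x u + G x (V' u) (W x) + G x (V x) (W' u))) (at x)"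
    by (rule has_derivative_bilinear_family[OF metric_field_open x metric_field_bilinear
          FD_works[OF metric_field_differentiable[OF x]] V W])
  then show ?thesis
    by (rule has_derivative_eq_rhs)
       (simp add: fun_eq_iff christoffel_metric[OF x] bilinear_simps[OF metric_field_bilinear[OF x]])
qed

lemma local_grad_eq:
  assumes x: "x \<in> U" and u: "u differentiable (at x)"
  shows "G x (local_grad G u x) v = FD u x v"
  using theI'[OF inner_form_representation[OF metric_field_inner_form[OF x] linear_FD[OF u]]]
  unfolding local_grad_def by blast

context
  assumes G2: "\<And>v w. Ck_on 2 U (\<lambda>x. G x v w)"
begin

text \<open>The Koszul formula is a linear equation for the symbol whose right-hand side contains
  first derivatives of \<open>G\<close>; \<open>Ck_on 2\<close> makes that side
  differentiable.\<close>

lemma christoffel_differentiable: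
  assumes x: "x \<in> U"
  shows "(\<lambda>y. christoffel G y v w) differentiable (at x)"
proof (rule differentiable_representation[OF metric_field_open x metric_field_inner_form
      metric_field_differentiable])
  show "G y (christoffel G y v w) u =
    (1/2) * (FD (\<lambda>y. G y w u) y v + FD (\<lambda>y. G y v u) y w - FD (\<lambda>y. G y v w) y u)"
    if "y \<in> U" for y u
    using christoffel_koszul[OF that, of v w u] by simp
  show "(\<lambda>y. (1/2) * (FD (\<lambda>y. G y w u) y v + FD (\<lambda>y. G y v u) y w - FD (\<lambda>y. G y v w) y u))
    differentiable (at x)" for u
    by (intro differentiable_mult differentiable_const differentiable_diff differentiable_add
        Ck_on_2_differentiable[OF G2 x])
qed

lemma local_grad_differentiable:
  assumes x: "x \<in> U" and u: "Ck_on 2 U u"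
  shows "local_grad G u differentiable (at x)"
proof (rule differentiable_representation[OF metric_field_open x metric_field_inner_form
      metric_field_differentiable])
  show "G y (local_grad G u y) v = FD u y v" if "y \<in> U" for y v
    using that u by (intro local_grad_eq Ck_on_2_differentiable)
  show "(\<lambda>y. FD u y v) differentiable (at x)" for v
    by (rule Ck_on_2_differentiable[OF u x])
qed

section \<open>Linearity and skew-adjointness of the curvature operator\<close>

lemma bilinear_FD_christoffel: "x \<in> U \<Longrightarrow> bilinear (\<lambda>v w. FD (\<lambda>y. christoffel G y v w) x h)"
  by (rule bilinear_FD[OF metric_field_open])
     (auto intro: bilinear_christoffel christoffel_differentiable)

lemma linear_FD_christoffel: "x \<in> U \<Longrightarrow> linear (FD (\<lambda>y. christoffel G y v w) x)"
  by (rule linear_FD) (rule christoffel_differentiable)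

lemma linear_riemann_curvature:
  assumes x: "x \<in> U"
  shows "linear (\<lambda>u. riemann_curvature G x u v w)" "linear (\<lambda>v. riemann_curvature G x u v w)"
    "linear (\<lambda>w. riemann_curvature G x u v w)"
proof -
  note simps = bilinear_simps[OF bilinear_christoffel[OF x]] bilinear_simps[OF bilinear_FD_christoffel[OF x]]
    linear_add[OF linear_FD_christoffel[OF x]] linear_cmul[OF linear_FD_christoffel[OF x]]
  show "linear (\<lambda>u. riemann_curvature G x u v w)"
    by (rule linearI) (simp_all add: riemann_curvature_eq simps scaleR_diff_right scaleR_add_right)
  show "linear (\<lambda>v. riemann_curvature G x u v w)"
    by (rule linearI) (simp_all add: riemann_curvature_eq simps scaleR_diff_right scaleR_add_right)
  show "linear (\<lambda>w. riemann_curvature G x u v w)"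
    by (rule linearI) (simp_all add: riemann_curvature_eq simps scaleR_diff_right scaleR_add_right)
qed

text \<open>Skew-adjointness of the curvature operator comes from the symmetry of the second derivatives
  of \<open>G(w,w)\<close>, since \<open>2G(\<nabla>\<^sub>v w, w) = v(G(w,w))\<close>.\<close>

lemma riemann_curvature_skew:
  assumes x: "x \<in> U"
  shows "G x (riemann_curvature G x u v w) w = 0"
proof -
  \<comment> \<open>The product of the two first covariant derivatives is symmetric in
    \<open>u\<close> and \<open>v\<close>, so it drops out when the two instances are
    subtracted.\<close>
  have key: "2 * G x (FD (\<lambda>y. christoffel G y v w) x u + christoffel G x u (christoffel G x v w)) w +
      2 * G x (christoffel G x v w) (christoffel G x u w) = FD (\<lambda>y. FD (\<lambda>y. G y w w) y v) x u" for u v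
  proof -
    have "((\<lambda>y. G y (christoffel G y v w) w) has_derivative
      (\<lambda>u. G x (FD (\<lambda>y. christoffel G y v w) x u + christoffel G x u (christoffel G x v w)) w +
           G x (christoffel G x v w) (0 + christoffel G x u w))) (at x)"
      by (rule has_derivative_metric[OF x FD_works[OF christoffel_differentiable[OF x]] has_derivative_const])
    then have "((\<lambda>y. 2 * G y (christoffel G y v w) w) has_derivative
      (\<lambda>u. 2 * (G x (FD (\<lambda>y. christoffel G y v w) x u + christoffel G x u (christoffel G x v w)) w +
           G x (christoffel G x v w) (0 + christoffel G x u w)))) (at x)"
      by (rule has_derivative_mult_right)
    then have "((\<lambda>y. FD (\<lambda>y. G y w w) y v) has_derivative
      (\<lambda>u. 2 * (G x (FD (\<lambda>y. christoffel G y v w) x u + christoffel G x u (christoffel G x v w)) w +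
           G x (christoffel G x v w) (0 + christoffel G x u w)))) (at x)"
      by (rule has_derivative_transform_within_open[OF _ metric_field_open x])
         (simp add: christoffel_metric metric_field_sym)
    from frechet_derivative_eqI[OF this] show ?thesis by simp
  qed
  have "FD (\<lambda>y. FD (\<lambda>y. G y w w) y v) x u = FD (\<lambda>y. FD (\<lambda>y. G y w w) y u) x v"
    by (rule symmetric_second_derivative[OF metric_field_open x])
       (auto intro: metric_field_differentiable Ck_on_2_differentiable[OF G2 x])
  with key[of v u] key[of u v] metric_field_sym[OF x, of "christoffel G x v w" "christoffel G x u w"]
  show ?thesis
    by (simp add: riemann_curvature_eq bilinear_simps[OF metric_field_bilinear[OF x]])
qed

end

end

section \<open>The Gauss equation\<close>

lemma Ck_on_3_differentiable:
  assumes "Ck_on 3 S f" "x \<in> S"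
  shows "f differentiable (at x)" "(\<lambda>y. FD f y v) differentiable (at x)"
    "(\<lambda>y. FD (\<lambda>y. FD f y v) y w) differentiable (at x)"
  using assms by (auto simp: numeral_3_eq_3)

text \<open>Coordinate form of an isometric immersion. The Gauss equation differentiates the
  covariant derivative of \<open>d\<Phi> w\<close>, which already contains second derivatives of
  \<open>\<Phi>\<close> and the ambient Christoffel symbols; hence the order \<open>3\<close> for
  \<open>\<Phi>\<close> and \<open>2\<close> for the ambient metric.\<close>

locale local_isometry =
  fixes U :: "'a::euclidean_space set" and G and V :: "'d::euclidean_space set" and K and \<Phi>
  assumes G: "metric_field U G" and K: "metric_field V K" and K2: "\<And>v w. Ck_on 2 V (\<lambda>x. K x v w)"
    and \<Phi>: "Ck_on 3 U \<Phi>" and \<Phi>V: "\<And>x. x \<in> U \<Longrightarrow> \<Phi> x \<in> V"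
    and isom: "\<And>x v w. x \<in> U \<Longrightarrow> K (\<Phi> x) (FD \<Phi> x v) (FD \<Phi> x w) = G x v w"
begin

lemmas openU = metric_field_open[OF G]
lemmas Kbl = metric_field_bilinear[OF K \<Phi>V]
lemmas Gbl = metric_field_bilinear[OF G]

lemma linear_FD_\<Phi>: "x \<in> U \<Longrightarrow> linear (FD \<Phi> x)"
  by (rule linear_FD) (rule Ck_on_3_differentiable[OF \<Phi>])

text \<open>The covariant derivative along \<open>\<Phi>\<close> of the vector field \<open>d\<Phi> w\<close>, \<open>w\<close> constant.\<close>

definition pull :: "'a \<Rightarrow> 'a \<Rightarrow> 'a \<Rightarrow> 'd" where
  "pull x v w = FD (\<lambda>y. FD \<Phi> y w) x v + christoffel K (\<Phi> x) (FD \<Phi> x v) (FD \<Phi> x w)"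

definition II :: "'a \<Rightarrow> 'a \<Rightarrow> 'a \<Rightarrow> 'd" where
  "II x v w = pull x v w - FD \<Phi> x (christoffel G x v w)"

lemma FD2_sym: "x \<in> U \<Longrightarrow> FD (\<lambda>y. FD \<Phi> y w) x v = FD (\<lambda>y. FD \<Phi> y v) x w"
  by (rule symmetric_second_derivative[OF openU]) (auto intro: Ck_on_3_differentiable[OF \<Phi>])

lemma pull_sym: "x \<in> U \<Longrightarrow> pull x v w = pull x w v"
  by (simp add: pull_def FD2_sym[of x v w] christoffel_sym[OF K \<Phi>V])

lemma has_derivative_\<Phi>: "x \<in> U \<Longrightarrow> (\<Phi> has_derivative FD \<Phi> x) (at x)"
  by (rule FD_works) (rule Ck_on_3_differentiable[OF \<Phi>])

lemma has_derivative_FD_\<Phi>: "x \<in> U \<Longrightarrow> ((\<lambda>y. FD \<Phi> y v) has_derivative FD (\<lambda>y. FD \<Phi> y v) x) (at x)"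
  by (rule FD_works) (rule Ck_on_3_differentiable[OF \<Phi>])

text \<open>Metric compatibility of the pullback connection: the chain rule differentiates
  \<open>K\<close> in the direction \<open>FD \<Phi> x u\<close>, and compatibility of
  \<open>K\<close> absorbs the result into Christoffel terms.\<close>

lemma has_derivative_along:
  assumes x: "x \<in> U" and X: "(X has_derivative X') (at x)" and Y: "(Y has_derivative Y') (at x)"
  shows "((\<lambda>y. K (\<Phi> y) (X y) (Y y)) has_derivative
    (\<lambda>u. K (\<Phi> x) (X' u + christoffel K (\<Phi> x) (FD \<Phi> x u) (X x)) (Y x) +
         K (\<Phi> x) (X x) (Y' u + christoffel K (\<Phi> x) (FD \<Phi> x u) (Y x)))) (at x)"
proof -
  have "((\<lambda>y. K (\<Phi> y) (X y) (Y y)) has_derivative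
    (\<lambda>u. FD (\<lambda>z. K z (X x) (Y x)) (\<Phi> x) (FD \<Phi> x u) + K (\<Phi> x) (X' u) (Y x) + K (\<Phi> x) (X x) (Y' u))) (at x)"
    by (rule has_derivative_bilinear_family[OF openU x Kbl
         has_derivative_compose[OF has_derivative_\<Phi>[OF x]
           FD_works[OF metric_field_differentiable[OF K \<Phi>V[OF x]]]] X Y])
  then show ?thesis
    by (rule has_derivative_eq_rhs)
       (simp add: fun_eq_iff christoffel_metric[OF K \<Phi>V[OF x]] bilinear_simps[OF Kbl[OF x]])
qed

text \<open>The tangential part of the ambient derivative is the intrinsic connection, by the
  argument that makes the Levi-Civita connection unique: \<open>pull\<close> is symmetric and
  compatible with the induced metric, so it satisfies the Koszul formula of \<open>G\<close> against
  tangent vectors.\<close>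

lemma pull_tangential:
  assumes x: "x \<in> U"
  shows "K (\<Phi> x) (pull x v w) (FD \<Phi> x z) = G x (christoffel G x v w) z"
proof -
  have FDG: "FD (\<lambda>y. G y w z) x u = K (\<Phi> x) (pull x u w) (FD \<Phi> x z) + K (\<Phi> x) (FD \<Phi> x w) (pull x u z)"
    for w z u
    using frechet_derivative_eqI[OF has_derivative_along[OF x has_derivative_FD_\<Phi>[OF x] has_derivative_FD_\<Phi>[OF x],
          of w z]]
      FD_cong[OF openU x, of "\<lambda>y. K (\<Phi> y) (FD \<Phi> y w) (FD \<Phi> y z)" "\<lambda>y. G y w z"] isom
    by (simp add: pull_def)
  show ?thesis
    using christoffel_koszul[OF G x, of v w z]
    by (simp add: FDG pull_sym[OF x, of w v] pull_sym[OF x, of z v] pull_sym[OF x, of z w]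
      metric_field_sym[OF K \<Phi>V[OF x], of "FD \<Phi> x w" "pull x v z"])
qed

lemma II_normal: "x \<in> U \<Longrightarrow> K (\<Phi> x) (II x v w) (FD \<Phi> x z) = 0"
  by (simp add: II_def bilinear_lsub[OF Kbl] pull_tangential isom)

lemma bilinear_pull: "x \<in> U \<Longrightarrow> bilinear (pull x)"
proof -
  assume x: "x \<in> U"
  have l: "linear (\<lambda>v. pull x v w)" for w
    by (rule linearI)
       (simp_all add: pull_def bilinear_simps[OF bilinear_christoffel[OF K \<Phi>V[OF x]]] linear_add linear_cmul
         linear_FD_\<Phi>[OF x] linear_FD Ck_on_3_differentiable[OF \<Phi> x] scaleR_add_right)
  moreover have "linear (\<lambda>v. pull x w v)" for w
    by (subst pull_sym[OF x]) (rule l)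
  ultimately show ?thesis by (simp add: bilinear_def)
qed

lemma bilinear_II: "x \<in> U \<Longrightarrow> bilinear (II x)"
proof -
  assume x: "x \<in> U"
  show ?thesis
    unfolding bilinear_def II_def
    by (auto intro!: linearI simp: bilinear_simps[OF bilinear_pull[OF x]]
        bilinear_simps[OF bilinear_christoffel[OF G x]] linear_add[OF linear_FD_\<Phi>[OF x]]
        linear_cmul[OF linear_FD_\<Phi>[OF x]] scaleR_diff_right)
qed

text \<open>The derivative of \<open>y \<mapsto> pull y v w\<close> in the direction
  \<open>u\<close>, expanded by the Leibniz rule so that its terms can be cancelled one by one in
  the curvature formula.\<close>

definition dpull :: "'a \<Rightarrow> 'a \<Rightarrow> 'a \<Rightarrow> 'a \<Rightarrow> 'd" where
  "dpull x v w u = FD (\<lambda>y. FD (\<lambda>y. FD \<Phi> y w) y v) x u +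
     (FD (\<lambda>z. christoffel K z (FD \<Phi> x v) (FD \<Phi> x w)) (\<Phi> x) (FD \<Phi> x u) +
      christoffel K (\<Phi> x) (FD (\<lambda>y. FD \<Phi> y v) x u) (FD \<Phi> x w) +
      christoffel K (\<Phi> x) (FD \<Phi> x v) (FD (\<lambda>y. FD \<Phi> y w) x u))"

lemma has_derivative_pull:
  assumes x: "x \<in> U"
  shows "((\<lambda>y. pull y v w) has_derivative dpull x v w) (at x)"
  unfolding pull_def dpull_def
  by (rule has_derivative_add[OF FD_works[OF Ck_on_3_differentiable(3)[OF \<Phi> x]]
      has_derivative_bilinear_family[OF openU x bilinear_christoffel[OF K \<Phi>V]
         has_derivative_compose[OF has_derivative_\<Phi>[OF x]
           FD_works[OF christoffel_differentiable[OF K K2 \<Phi>V[OF x]]]]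
         has_derivative_FD_\<Phi>[OF x] has_derivative_FD_\<Phi>[OF x]]])

text \<open>The pullback connection has the pulled back curvature. Third derivatives of
  \<open>\<Phi>\<close> cancel by symmetry; second derivatives cancel by \<open>FD2_sym\<close> or
  against those inside \<open>pull\<close>; the ambient curvature in coordinates is left.\<close>

lemma pull_curvature:
  assumes x: "x \<in> U"
  shows "(dpull x v w u + christoffel K (\<Phi> x) (FD \<Phi> x u) (pull x v w)) -
      (dpull x u w v + christoffel K (\<Phi> x) (FD \<Phi> x v) (pull x u w)) =
    riemann_curvature K (\<Phi> x) (FD \<Phi> x u) (FD \<Phi> x v) (FD \<Phi> x w)"
proof -
  have "FD (\<lambda>y. FD (\<lambda>y. FD \<Phi> y w) y v) x u = FD (\<lambda>y. FD (\<lambda>y. FD \<Phi> y w) y u) x v"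
    by (rule symmetric_second_derivative[OF openU x]) (auto intro: Ck_on_3_differentiable[OF \<Phi>] x)
  then show ?thesis
    by (simp add: dpull_def pull_def riemann_curvature_eq FD2_sym[OF x, of u v]
        bilinear_simps[OF bilinear_christoffel[OF K \<Phi>V[OF x]]])
qed

text \<open>The identity of \<open>pull_tangential\<close> holds on an open set, so both of its
  sides are differentiated in the direction \<open>u\<close> and compared. The second fundamental
  form enters through the product of two first derivatives.\<close>

lemma dpull_tangential:
  assumes x: "x \<in> U" and d: "(\<lambda>y. christoffel G y v w) differentiable (at x)"
  shows "K (\<Phi> x) (dpull x v w u + christoffel K (\<Phi> x) (FD \<Phi> x u) (pull x v w)) (FD \<Phi> x z) =
    G x (FD (\<lambda>y. christoffel G y v w) x u + christoffel G x u (christoffel G x v w)) z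
    - K (\<Phi> x) (II x v w) (II x u z)"
proof -
  have "((\<lambda>y. K (\<Phi> y) (pull y v w) (FD \<Phi> y z)) has_derivative
      (\<lambda>u. K (\<Phi> x) (dpull x v w u + christoffel K (\<Phi> x) (FD \<Phi> x u) (pull x v w)) (FD \<Phi> x z) +
           K (\<Phi> x) (pull x v w) (pull x u z))) (at x)"
    using has_derivative_along[OF x has_derivative_pull[OF x] has_derivative_FD_\<Phi>[OF x]]
    by (simp only: pull_def)
  from has_derivative_transform_within_open[OF this openU x pull_tangential]
  have 1: "((\<lambda>y. G y (christoffel G y v w) z) has_derivative
      (\<lambda>u. K (\<Phi> x) (dpull x v w u + christoffel K (\<Phi> x) (FD \<Phi> x u) (pull x v w)) (FD \<Phi> x z) +
           K (\<Phi> x) (pull x v w) (pull x u z))) (at x)" .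
  have 2: "((\<lambda>y. G y (christoffel G y v w) z) has_derivative
      (\<lambda>u. G x (FD (\<lambda>y. christoffel G y v w) x u + christoffel G x u (christoffel G x v w)) z +
           G x (christoffel G x v w) (0 + christoffel G x u z))) (at x)"
    by (rule has_derivative_metric[OF G x FD_works[OF d] has_derivative_const])
  have *: "K (\<Phi> x) (dpull x v w u + christoffel K (\<Phi> x) (FD \<Phi> x u) (pull x v w)) (FD \<Phi> x z) +
           K (\<Phi> x) (pull x v w) (pull x u z) =
      G x (FD (\<lambda>y. christoffel G y v w) x u + christoffel G x u (christoffel G x v w)) z +
           G x (christoffel G x v w) (christoffel G x u z)"
    using fun_cong[OF has_derivative_unique[OF 1 2], of u] by simp
  \<comment> \<open>Orthogonal splitting of both factors into a normal part \<open>II\<close> and a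
    tangential Christoffel part; the mixed products vanish.\<close>
  have "K (\<Phi> x) (pull x v w) (pull x u z) =
      K (\<Phi> x) (II x v w) (II x u z) + G x (christoffel G x v w) (christoffel G x u z)"
    using II_normal[OF x, of v w "christoffel G x u z"] pull_tangential[OF x, of u z "christoffel G x v w"]
      metric_field_sym[OF K \<Phi>V[OF x], of "FD \<Phi> x (christoffel G x v w)" "pull x u z"]
      metric_field_sym[OF G x, of "christoffel G x v w" "christoffel G x u z"]
    by (simp add: II_def bilinear_simps[OF Kbl[OF x]])
  with * show ?thesis by simp
qed

text \<open>Antisymmetrizing \<open>dpull_tangential\<close> in \<open>u\<close> and
  \<open>v\<close> produces the ambient curvature on one side, the intrinsic curvature on the other,
  and leaves the products of normal parts.\<close>

theorem gauss_equation:
  assumes x: "x \<in> U" and "(\<lambda>y. christoffel G y v w) differentiable (at x)"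
    "(\<lambda>y. christoffel G y u w) differentiable (at x)"
  shows "K (\<Phi> x) (riemann_curvature K (\<Phi> x) (FD \<Phi> x u) (FD \<Phi> x v) (FD \<Phi> x w)) (FD \<Phi> x z) =
    G x (riemann_curvature G x u v w) z - K (\<Phi> x) (II x v w) (II x u z) + K (\<Phi> x) (II x u w) (II x v z)"
proof -
  have "K (\<Phi> x) (riemann_curvature K (\<Phi> x) (FD \<Phi> x u) (FD \<Phi> x v) (FD \<Phi> x w)) (FD \<Phi> x z) =
    K (\<Phi> x) (dpull x v w u + christoffel K (\<Phi> x) (FD \<Phi> x u) (pull x v w)) (FD \<Phi> x z) -
    K (\<Phi> x) (dpull x u w v + christoffel K (\<Phi> x) (FD \<Phi> x v) (pull x u w)) (FD \<Phi> x z)"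
    by (simp only: pull_curvature[OF x, symmetric] bilinear_lsub[OF Kbl[OF x]])
  then show ?thesis
    by (simp add: dpull_tangential[OF x assms(2)] dpull_tangential[OF x assms(3)]
      riemann_curvature_eq[of G] bilinear_lsub[OF Gbl[OF x]])
qed

end

section \<open>Warped products in coordinates\<close>

text \<open>The covariant Hessian \<open>v(w u) - (\<nabla>\<^sub>v w) u\<close>, evaluated on
  constant coordinate fields.\<close>

definition hess :: "('a::euclidean_space \<Rightarrow> 'a \<Rightarrow> 'a \<Rightarrow> real) \<Rightarrow> ('a \<Rightarrow> real) \<Rightarrow> 'a \<Rightarrow> 'a \<Rightarrow> 'a \<Rightarrow> real" where
  "hess G u x v w = FD (\<lambda>y. FD u y w) x v - FD u x (christoffel G x v w)"

text \<open>Differentiating \<open>G(grad u, e) = du(e)\<close> for constant \<open>e\<close> gives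
  \<open>G(\<nabla>\<^sub>e grad u, e) = Hess u(e, e)\<close>, and the divergence may be traced in a
  basis that is orthonormal for the metric at \<open>x\<close>.\<close>

lemma local_div_local_grad:
  assumes G: "metric_field U G" and G2: "\<And>v w. Ck_on 2 U (\<lambda>x. G x v w)"
    and x: "x \<in> U" and u: "Ck_on 2 U u" and E: "orthonormal_basis_of (G x) UNIV E"
  shows "local_div G (local_grad G u) x = (\<Sum>e\<in>E. hess G u x e e)"
proof -
  let ?L = "cov_deriv G (local_grad G u) x"
  have dgrad: "local_grad G u differentiable (at x)"
    by (rule local_grad_differentiable[OF G G2 x u])
  have grad: "G y (local_grad G u y) v = FD u y v" if "y \<in> U" for y v
    by (rule local_grad_eq[OF G that]) (rule Ck_on_2_differentiable[OF u that])
  have "linear ?L"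
    using linear_FD[OF dgrad] bilinear_linear_left[OF bilinear_christoffel[OF G x]]
    unfolding cov_deriv_def by (intro linear_compose_add) auto
  then have "local_div G (local_grad G u) x = (\<Sum>e\<in>E. G x (?L e) e)"
    unfolding local_div_def by (rule trace_linear_eq[OF metric_field_inner_form[OF G x] _ E])
  also have "\<dots> = (\<Sum>e\<in>E. hess G u x e e)"
  proof (rule sum.cong[OF refl])
    fix e
    have "((\<lambda>y. G y (local_grad G u y) e) has_derivative
      (\<lambda>v. G x (FD (local_grad G u) x v + christoffel G x v (local_grad G u x)) e +
           G x (local_grad G u x) (0 + christoffel G x v e))) (at x)"
      by (rule has_derivative_metric[OF G x FD_works[OF dgrad] has_derivative_const])
    from has_derivative_transform_within_open[OF this metric_field_open[OF G] x grad]
    have "FD (\<lambda>y. FD u y e) x = (\<lambda>v. G x (?L v) e + FD u x (christoffel G x v e))"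
      using grad[OF x] by (simp add: frechet_derivative_eqI cov_deriv_def)
    then show "G x (?L e) e = hess G u x e e" by (simp add: hess_def)
  qed
  finally show ?thesis .
qed

locale local_warped_product =
  fixes A :: "'a::euclidean_space set" and GA and C :: "'c::euclidean_space set" and GC and f and G
  assumes GA: "metric_field A GA" and GA2: "\<And>v w. Ck_on 2 A (\<lambda>x. GA x v w)"
    and GC: "metric_field C GC"
    and f2: "Ck_on 2 A f" and fpos: "\<And>x. x \<in> A \<Longrightarrow> f x > 0"
    and G_eq: "\<And>x y v w. x \<in> A \<Longrightarrow> y \<in> C \<Longrightarrow>
      G (x, y) v w = GA x (fst v) (fst w) + (f x)\<^sup>2 * GC y (snd v) (snd w)"
begin

lemmas openA = metric_field_open[OF GA]
lemmas openC = metric_field_open[OF GC]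

lemma openAC: "open (A \<times> C)"
  by (rule open_Times[OF openA openC])

lemma has_derivative_G:
  assumes x: "x \<in> A" and y: "y \<in> C"
  shows "((\<lambda>p. G p v w) has_derivative
    (\<lambda>u. FD (\<lambda>x. GA x (fst v) (fst w)) x (fst u) +
      (2 * f x * FD f x (fst u) * GC y (snd v) (snd w) +
       (f x)\<^sup>2 * FD (\<lambda>y. GC y (snd v) (snd w)) y (snd u)))) (at (x, y))"
proof (rule has_derivative_transform_within_open[OF _ openAC])
  show "((\<lambda>p. GA (fst p) (fst v) (fst w) + (f (fst p) * f (fst p)) * GC (snd p) (snd v) (snd w)) has_derivative
    (\<lambda>u. FD (\<lambda>x. GA x (fst v) (fst w)) x (fst u) +
      (2 * f x * FD f x (fst u) * GC y (snd v) (snd w) +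
       (f x)\<^sup>2 * FD (\<lambda>y. GC y (snd v) (snd w)) y (snd u)))) (at (x, y))"
  proof -
    have 1: "((\<lambda>p. f (fst p)) has_derivative (\<lambda>u. FD f x (fst u))) (at (x, y))"
      by (rule has_derivative_compose[OF has_derivative_fst[OF has_derivative_ident]])
         (use Ck_on_2_differentiable(1)[OF f2 x] in \<open>simp add: FD_works\<close>)
    have 2: "((\<lambda>p. GA (fst p) v w) has_derivative (\<lambda>u. FD (\<lambda>x. GA x v w) x (fst u))) (at (x, y))" for v w
      by (rule has_derivative_compose[OF has_derivative_fst[OF has_derivative_ident]])
         (use metric_field_differentiable[OF GA x] in \<open>simp add: FD_works\<close>)
    have 3: "((\<lambda>p. GC (snd p) v w) has_derivative (\<lambda>u. FD (\<lambda>y. GC y v w) y (snd u))) (at (x, y))" for v w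
      by (rule has_derivative_compose[OF has_derivative_snd[OF has_derivative_ident]])
         (use metric_field_differentiable[OF GC y] in \<open>simp add: FD_works\<close>)
    show ?thesis
      by (rule has_derivative_eq_rhs[OF has_derivative_add[OF 2 has_derivative_mult[OF has_derivative_mult[OF 1 1] 3]]])
         (simp add: fun_eq_iff power2_eq_square algebra_simps)
  qed
  show "(x, y) \<in> A \<times> C" using x y by simp
qed (auto simp: G_eq power2_eq_square)

lemma FD_G: "x \<in> A \<Longrightarrow> y \<in> C \<Longrightarrow> FD (\<lambda>p. G p v w) (x, y) u =
    FD (\<lambda>x. GA x (fst v) (fst w)) x (fst u) +
      (2 * f x * FD f x (fst u) * GC y (snd v) (snd w) +
       (f x)\<^sup>2 * FD (\<lambda>y. GC y (snd v) (snd w)) y (snd u))"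
  by (subst frechet_derivative_eqI[OF has_derivative_G]) simp_all

lemma metric_field_G: "metric_field (A \<times> C) G"
  unfolding metric_field_def
proof (intro conjI ballI allI)
  show "open (A \<times> C)" by (rule openAC)
  fix p assume "p \<in> A \<times> C"
  then obtain x y where p: "p = (x, y)" and x: "x \<in> A" and y: "y \<in> C" by auto
  show "(\<lambda>p. G p v w) differentiable (at p)" for v w
    unfolding p by (rule differentiableI) (rule has_derivative_G[OF x y])
  note simps = bilinear_simps[OF metric_field_bilinear[OF GA x]] bilinear_simps[OF metric_field_bilinear[OF GC y]]
  show "inner_form (G p)"
    unfolding inner_form_def p
  proof (intro conjI allI impI)
    show "bilinear (G (x, y))"
      unfolding bilinear_def
      by (auto intro!: linearI simp: G_eq[OF x y] simps algebra_simps)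
    show "G (x, y) v w = G (x, y) w v" for v w
      by (simp add: G_eq[OF x y] metric_field_sym[OF GA x, of "fst v"] metric_field_sym[OF GC y, of "snd v"])
    fix v :: "'a \<times> 'c" assume "v \<noteq> 0"
    then have "fst v \<noteq> 0 \<or> snd v \<noteq> 0" by (simp add: prod_eq_iff)
    moreover have "GA x (fst v) (fst v) \<ge> 0" "GC y (snd v) (snd v) \<ge> 0"
      using metric_field_inner_form[OF GA x] metric_field_inner_form[OF GC y] by (auto intro: inner_form_nonneg)
    ultimately show "0 < G (x, y) v v"
      using inner_form_pos[OF metric_field_inner_form[OF GA x], of "fst v"]
        inner_form_pos[OF metric_field_inner_form[OF GC y], of "snd v"] fpos[OF x]
      by (auto simp: G_eq[OF x y] intro: add_pos_nonneg add_nonneg_pos)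
  qed
qed

text \<open>The leaves are totally geodesic: on two horizontal vectors the warped metric is the base
  metric, which is constant along the fibre, so vertical test vectors see nothing.\<close>

lemma christoffel_horizontal:
  assumes x: "x \<in> A" and y: "y \<in> C"
  shows "christoffel G (x, y) (v, 0) (w, 0) = (christoffel GA x v w, 0)"
  by (rule christoffel_eqI[OF metric_field_G])
     (simp_all add: x y FD_G G_eq bilinear_simps[OF metric_field_bilinear[OF GC y]]
       bilinear_simps[OF bilinear_FD_metric[OF GC y]] linear_0[OF linear_FD_metric[OF GC y]]
       christoffel_koszul[OF GA x] distrib_left)

text \<open>In the Koszul formula only the derivative of the warping factor survives,
  \<open>2 f df(v) GC(w, u)\<close>; dividing by the \<open>2 f\<^sup>2\<close> of the left-hand
  side gives the coefficient \<open>df(v)/f\<close>.\<close>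

lemma christoffel_mixed:
  assumes x: "x \<in> A" and y: "y \<in> C"
  shows "christoffel G (x, y) (v, 0) (0, w) = (FD f x v / f x) *\<^sub>R (0, w)"
  using fpos[OF x]
  by (intro christoffel_eqI[OF metric_field_G])
     (simp_all add: x y FD_G G_eq bilinear_simps[OF metric_field_bilinear[OF GC y]]
       bilinear_simps[OF bilinear_FD_metric[OF GC y]] linear_0[OF linear_FD_metric[OF GC y]]
       bilinear_simps[OF metric_field_bilinear[OF GA x]]
       bilinear_simps[OF bilinear_FD_metric[OF GA x]] linear_0[OF linear_FD_metric[OF GA x]]
       power2_eq_square)

lemma christoffel_mixed_swap:
  assumes x: "x \<in> A" and y: "y \<in> C"
  shows "christoffel G (x, y) (0, w) (v, 0) = (FD f x v / f x) *\<^sub>R (0, w)"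
  using christoffel_mixed[OF assms] by (subst christoffel_sym[OF metric_field_G]) (simp_all add: x y)

lemma has_derivative_christoffel_horizontal:
  assumes x: "x \<in> A" and y: "y \<in> C"
  shows "((\<lambda>p. christoffel G p (v, 0) (w, 0)) has_derivative
    (\<lambda>u. (FD (\<lambda>x. christoffel GA x v w) x (fst u), 0))) (at (x, y))"
proof (rule has_derivative_transform_within_open[OF _ openAC])
  have "((\<lambda>p. christoffel GA (fst p) v w) has_derivative (\<lambda>u. FD (\<lambda>x. christoffel GA x v w) x (fst u))) (at (x, y))"
    by (rule has_derivative_compose[OF has_derivative_fst[OF has_derivative_ident]])
       (use christoffel_differentiable[OF GA GA2 x] in \<open>simp add: FD_works\<close>)
  then show "((\<lambda>p. (christoffel GA (fst p) v w, 0)) has_derivative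
    (\<lambda>u. (FD (\<lambda>x. christoffel GA x v w) x (fst u), 0))) (at (x, y))"
    by (intro has_derivative_Pair has_derivative_const)
  show "(x, y) \<in> A \<times> C" using x y by simp
qed (auto simp: christoffel_horizontal)

lemma has_derivative_christoffel_mixed:
  assumes x: "x \<in> A" and y: "y \<in> C"
  shows "((\<lambda>p. christoffel G p (0, w) (v, 0)) has_derivative
    (\<lambda>u. (FD (\<lambda>x. FD f x v) x (fst u) / f x - FD f x v * FD f x (fst u) / (f x)\<^sup>2) *\<^sub>R (0, w))) (at (x, y))"
proof (rule has_derivative_transform_within_open[OF _ openAC])
  have 1: "((\<lambda>p. f (fst p)) has_derivative (\<lambda>u. FD f x (fst u))) (at (x, y))"
    by (rule has_derivative_compose[OF has_derivative_fst[OF has_derivative_ident]])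
       (use Ck_on_2_differentiable(1)[OF f2 x] in \<open>simp add: FD_works\<close>)
  have 2: "((\<lambda>p. FD f (fst p) v) has_derivative (\<lambda>u. FD (\<lambda>x. FD f x v) x (fst u))) (at (x, y))"
    by (rule has_derivative_compose[OF has_derivative_fst[OF has_derivative_ident]])
       (use Ck_on_2_differentiable(2)[OF f2 x] in \<open>simp add: FD_works\<close>)
  have "((\<lambda>p. FD f (fst p) v / f (fst p)) has_derivative
    (\<lambda>u. FD (\<lambda>x. FD f x v) x (fst u) / f x - FD f x v * FD f x (fst u) / (f x)\<^sup>2)) (at (x, y))"
    using fpos[OF x]
    by (intro has_derivative_eq_rhs[OF has_derivative_divide'[OF 2 1]])
       (auto simp: fun_eq_iff field_simps power2_eq_square)
  then show "((\<lambda>p. (FD f (fst p) v / f (fst p)) *\<^sub>R (0, w)) has_derivative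
    (\<lambda>u. (FD (\<lambda>x. FD f x v) x (fst u) / f x - FD f x v * FD f x (fst u) / (f x)\<^sup>2) *\<^sub>R (0, w))) (at (x, y))"
    by (rule has_derivative_scaleR_left)
  show "(x, y) \<in> A \<times> C" using x y by simp
qed (auto simp: christoffel_mixed_swap)

text \<open>\<open>(df(v)/f)\<^sup>2\<close> arises twice with opposite signs, from differentiating
  the quotient \<open>df(v)/f\<close> and from applying the mixed connection twice. After the
  cancellation the second derivative of \<open>f\<close> and the term
  \<open>df(\<nabla>\<^sub>v v)\<close> form the Hessian.\<close>

lemma riemann_curvature_warped:
  assumes x: "x \<in> A" and y: "y \<in> C"
  shows "riemann_curvature G (x, y) (0, w) (v, 0) (v, 0) = - (hess GA f x v v / f x) *\<^sub>R (0, w)"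
proof -
  have xy: "(x, y) \<in> A \<times> C" using x y by simp
  have bl: "bilinear (christoffel G (x, y))" by (rule bilinear_christoffel[OF metric_field_G xy])
  have "christoffel G (x, y) (v, 0) ((FD f x v / f x) *\<^sub>R (0, w)) = (FD f x v / f x)\<^sup>2 *\<^sub>R (0, w)"
    unfolding bilinear_rmul[OF bl] by (simp only: christoffel_mixed[OF x y] scaleR_scaleR power2_eq_square)
  then show ?thesis
    unfolding riemann_curvature_eq christoffel_horizontal[OF x y] christoffel_mixed_swap[OF x y]
      frechet_derivative_eqI[OF has_derivative_christoffel_horizontal[OF x y]]
      frechet_derivative_eqI[OF has_derivative_christoffel_mixed[OF x y]]
    using fpos[OF x]
    by (simp add: linear_0[OF linear_FD[OF christoffel_differentiable[OF GA GA2 x]]] hess_def zero_prod_def[symmetric]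
        scaleR_left_distrib[symmetric] scaleR_left_diff_distrib[symmetric] field_simps power2_eq_square)
       (simp add: scaleR_minus_left[symmetric] minus_divide_left del: scaleR_minus_left)
qed

end

section \<open>Charts, products and isometric immersions\<close>

lemma is_chart_open_dom: "is_chart c \<Longrightarrow> open (chart_dom c)"
  and is_chart_open_img: "is_chart c \<Longrightarrow> open (chart_img c)"
  and is_chart_continuous_coord: "is_chart c \<Longrightarrow> continuous_on (chart_dom c) (coord c)"
  and is_chart_continuous_inv: "is_chart c \<Longrightarrow> continuous_on (chart_img c) (chart_inv c)"
  by (auto simp: is_chart_def homeomorphism_def)

lemma is_chart_inv_coord: "is_chart c \<Longrightarrow> p \<in> chart_dom c \<Longrightarrow> chart_inv c (coord c p) = p"
  by (auto simp: is_chart_def homeomorphism_def)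

lemma coord_chart_inv: "x \<in> chart_img c \<Longrightarrow> coord c (chart_inv c x) = x"
  by (auto simp: chart_inv_def chart_img_def f_inv_into_f)

lemma chart_inv_in_dom: "x \<in> chart_img c \<Longrightarrow> chart_inv c x \<in> chart_dom c"
  by (auto simp: chart_inv_def chart_img_def inv_into_into)

lemma coord_in_img: "p \<in> chart_dom c \<Longrightarrow> coord c p \<in> chart_img c"
  by (simp add: chart_img_def)

lemma is_chart_open_preimage:
  assumes c: "is_chart c" and \<phi>: "continuous_on (chart_dom c) \<phi>" and S: "open S"
  shows "open {x \<in> chart_img c. \<phi> (chart_inv c x) \<in> S}"
proof -
  have "continuous_on (chart_img c) (\<lambda>x. \<phi> (chart_inv c x))"
    by (rule continuous_on_compose2[OF \<phi> is_chart_continuous_inv[OF c]]) (auto intro: chart_inv_in_dom)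
  then have "open (chart_img c \<inter> (\<lambda>x. \<phi> (chart_inv c x)) -` S)"
    using continuous_on_open_vimage[OF is_chart_open_img[OF c]] S by (metis inf_commute)
  then show ?thesis by (simp add: vimage_def Int_def)
qed

lemma coord_image_eq:
  assumes "is_chart c"
  shows "coord c ` (chart_dom c \<inter> S) = {x \<in> chart_img c. chart_inv c x \<in> S}"
proof (intro set_eqI iffI)
  fix x assume "x \<in> {x \<in> chart_img c. chart_inv c x \<in> S}"
  then show "x \<in> coord c ` (chart_dom c \<inter> S)"
    using chart_inv_in_dom[of x c] coord_chart_inv[of x c] by (auto intro!: image_eqI[of x _ "chart_inv c x"])
qed (auto simp: is_chart_inv_coord[OF assms] coord_in_img)

text \<open>Tangent vectors and metric coefficients involve only first derivatives of chart changes.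
  Kept at first order, the notion passes to products by pairing derivatives, without iterated
  derivatives of product maps.\<close>

definition differentiable_manifold ::
  "('m::topological_space, 'e::euclidean_space) manifold \<Rightarrow> bool" where
  "differentiable_manifold M \<longleftrightarrow>
     (\<forall>c\<in>atlas M. is_chart c) \<and>
     (\<forall>c\<in>atlas M. \<forall>d\<in>atlas M. \<forall>x\<in>chart_img c. chart_inv c x \<in> chart_dom d \<longrightarrow>
        (coord d \<circ> chart_inv c) differentiable (at x)) \<and>
     (\<forall>p\<in>carrier M. chart_at M p \<in> atlas M \<and> p \<in> chart_dom (chart_at M p))"

lemma smooth_on_differentiable: "smooth_on S f \<Longrightarrow> x \<in> S \<Longrightarrow> f differentiable (at x)"
  unfolding smooth_on_def using Ck_on_Suc_differentiable by blast

lemma smooth_manifold_imp_differentiable: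
  assumes "smooth_manifold M"
  shows "differentiable_manifold M"
  unfolding differentiable_manifold_def
proof (intro conjI ballI impI)
  fix c d x
  assume c: "c \<in> atlas M" "d \<in> atlas M" "x \<in> chart_img c" "chart_inv c x \<in> chart_dom d"
  then have "is_chart c" "smooth_on (coord c ` (chart_dom c \<inter> chart_dom d)) (coord d \<circ> chart_inv c)"
    using assms by (auto simp: smooth_manifold_def)
  then show "(coord d \<circ> chart_inv c) differentiable (at x)"
    using c by (intro smooth_on_differentiable[where S="coord c ` (chart_dom c \<inter> chart_dom d)"])
      (auto simp: coord_image_eq)
qed (use assms in \<open>auto simp: smooth_manifold_def\<close>)

section \<open>Tangent vectors and metric coefficients under a change of chart\<close>

context
  fixes M :: "('m::topological_space, 'e::euclidean_space) manifold"
  assumes M: "differentiable_manifold M"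
begin

lemma atlas_is_chart: "c \<in> atlas M \<Longrightarrow> is_chart c"
  and chart_at_atlas: "p \<in> carrier M \<Longrightarrow> chart_at M p \<in> atlas M"
  and chart_at_dom: "p \<in> carrier M \<Longrightarrow> p \<in> chart_dom (chart_at M p)"
  and transition_differentiable: "c \<in> atlas M \<Longrightarrow> d \<in> atlas M \<Longrightarrow> x \<in> chart_img c \<Longrightarrow>
    chart_inv c x \<in> chart_dom d \<Longrightarrow> (coord d \<circ> chart_inv c) differentiable (at x)"
  using M by (auto simp: differentiable_manifold_def)

lemma chart_dom_subset_carrier: "c \<in> atlas M \<Longrightarrow> chart_dom c \<subseteq> carrier M"
  by (auto simp: carrier_def)

lemma chart_inv_in_carrier: "c \<in> atlas M \<Longrightarrow> x \<in> chart_img c \<Longrightarrow> chart_inv c x \<in> carrier M"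
  by (rule subsetD[OF chart_dom_subset_carrier chart_inv_in_dom])

text \<open>The chain rule through the transition map. The factorization is valid only on the
  overlap of the two charts, which is open by continuity of \<open>chart_inv c\<close>.\<close>

lemma has_derivative_change_chart:
  assumes c: "c \<in> atlas M" "c' \<in> atlas M" and x: "x \<in> chart_img c" "chart_inv c x \<in> chart_dom c'"
    and F: "(F \<circ> chart_inv c') differentiable (at (coord c' (chart_inv c x)))"
  shows "((F \<circ> chart_inv c) has_derivative
    FD (F \<circ> chart_inv c') (coord c' (chart_inv c x)) \<circ> FD (coord c' \<circ> chart_inv c) x) (at x)"
proof (rule has_derivative_transform_within_open)
  let ?S = "{x \<in> chart_img c. id (chart_inv c x) \<in> chart_dom c'}"
  show "open ?S"
    by (rule is_chart_open_preimage) (simp_all add: atlas_is_chart c is_chart_open_dom)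
  show "x \<in> ?S" using x by simp
  show "(((F \<circ> chart_inv c') \<circ> (coord c' \<circ> chart_inv c)) has_derivative
    FD (F \<circ> chart_inv c') (coord c' (chart_inv c x)) \<circ> FD (coord c' \<circ> chart_inv c) x) (at x)"
    by (rule diff_chain_at) (use transition_differentiable[OF c x] F in \<open>simp_all add: FD_works\<close>)
qed (simp add: is_chart_inv_coord atlas_is_chart c)

lemma has_derivative_coord_chart_inv:
  assumes "c \<in> atlas M" "x \<in> chart_img c"
  shows "((coord c \<circ> chart_inv c) has_derivative id) (at x)"
  by (rule has_derivative_transform_within_open[OF has_derivative_id is_chart_open_img[OF atlas_is_chart] ])
     (use assms in \<open>auto simp: coord_chart_inv\<close>)

lemma linear_transition:
  assumes "c \<in> atlas M" "d \<in> atlas M" "x \<in> chart_img c" "chart_inv c x \<in> chart_dom d"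
  shows "linear (FD (coord d \<circ> chart_inv c) x)"
  by (rule linear_FD) (rule transition_differentiable[OF assms])

text \<open>The derivative of the reverse transition is a left inverse, by differentiating
  \<open>coord c \<circ> chart_inv c\<close>, the identity on the chart image. It keeps local
  metrics positive definite.\<close>

lemma inj_transition:
  assumes c: "c \<in> atlas M" "d \<in> atlas M" and x: "x \<in> chart_img c" "chart_inv c x \<in> chart_dom d"
  shows "inj (FD (coord d \<circ> chart_inv c) x)"
proof -
  have "(coord c \<circ> chart_inv d) differentiable (at (coord d (chart_inv c x)))"
    using c x by (intro transition_differentiable)
      (auto simp: coord_in_img is_chart_inv_coord atlas_is_chart chart_inv_in_dom)
  from has_derivative_unique[OF has_derivative_change_chart[OF c x this] has_derivative_coord_chart_inv[OF c(1) x(1)]]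
  show ?thesis by (metis inj_on_id inj_on_imageI2)
qed

lemma local_metric_eq:
  "local_metric M g c x v w = g (chart_inv c x)
     (FD (coord (chart_at M (chart_inv c x)) \<circ> chart_inv c) x v)
     (FD (coord (chart_at M (chart_inv c x)) \<circ> chart_inv c) x w)"
  by (simp add: local_metric_def Let_def)

text \<open>In the chart chosen at \<open>p\<close> the change of coordinates at \<open>p\<close> is
  the identity; this is the bridge between objects at a point and their coordinate
  expressions.\<close>

lemma local_metric_chart_at:
  assumes p: "p \<in> carrier M"
  shows "local_metric M g (chart_at M p) (coord (chart_at M p) p) = g p"
proof -
  let ?c = "chart_at M p"
  have c: "?c \<in> atlas M" "p \<in> chart_dom ?c" using p chart_at_atlas chart_at_dom by auto
  have "chart_inv ?c (coord ?c p) = p" using c by (simp add: is_chart_inv_coord atlas_is_chart)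
  moreover have "FD (coord ?c \<circ> chart_inv ?c) (coord ?c p) = id"
    by (rule frechet_derivative_eqI[OF has_derivative_coord_chart_inv]) (use c in \<open>auto simp: coord_in_img\<close>)
  ultimately show ?thesis by (simp add: local_metric_eq fun_eq_iff)
qed

lemma metric_field_local_metric:
  assumes g: "riemannian_metric M g" and c: "c \<in> atlas M"
  shows "metric_field (chart_img c) (local_metric M g c)"
  unfolding metric_field_def
proof (intro conjI ballI allI)
  show "open (chart_img c)" using atlas_is_chart[OF c] by (rule is_chart_open_img)
  fix x assume x: "x \<in> chart_img c"
  show "(\<lambda>y. local_metric M g c y v w) differentiable (at x)" for v w
    by (rule smooth_on_differentiable[OF _ x]) (use g c in \<open>auto simp: riemannian_metric_def\<close>)
  let ?p = "chart_inv c x" let ?d = "chart_at M ?p"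
  have p: "?p \<in> carrier M" using chart_inv_in_carrier[OF c x] .
  have d: "?d \<in> atlas M" "?p \<in> chart_dom ?d" using chart_at_atlas[OF p] chart_at_dom[OF p] .
  let ?T = "FD (coord ?d \<circ> chart_inv c) x"
  have T: "linear ?T" "inj ?T" using linear_transition[OF c d(1) x d(2)] inj_transition[OF c d(1) x d(2)] .
  have "?T v \<noteq> 0" if "v \<noteq> 0" for v using T that linear_injective_0 by blast
  moreover have gp: "bilinear (g ?p)" "\<And>v w. g ?p v w = g ?p w v" "\<And>v. v \<noteq> 0 \<Longrightarrow> g ?p v v > 0"
    using g p by (auto simp: riemannian_metric_def)
  ultimately show "inner_form (local_metric M g c x)"
    unfolding inner_form_def local_metric_eq bilinear_def
    by (auto intro!: linearI simp: linear_add[OF T(1)] linear_cmul[OF T(1)] bilinear_simps[OF gp(1)])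
qed

end

section \<open>Products of charts and manifolds, and the warped metric in product charts\<close>

lemma chart_dom_prod [simp]: "chart_dom (prod_chart c d) = chart_dom c \<times> chart_dom d"
  and coord_prod [simp]: "coord (prod_chart c d) = map_prod (coord c) (coord d)"
  by (simp_all add: prod_chart_def)

lemma chart_img_prod [simp]: "chart_img (prod_chart c d) = chart_img c \<times> chart_img d"
  by (auto simp: chart_img_def)

text \<open>Restricted to the chart images because \<open>inv_into\<close> is not determined by the
  chart elsewhere; injectivity of the product coordinates identifies the inverse.\<close>

lemma chart_inv_prod:
  assumes "is_chart c" "is_chart d" "x \<in> chart_img c" "y \<in> chart_img d"
  shows "chart_inv (prod_chart c d) (x, y) = (chart_inv c x, chart_inv d y)"
proof -
  have inj: "inj_on (coord (prod_chart c d)) (chart_dom (prod_chart c d))"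
    unfolding chart_dom_prod coord_prod
    using inj_on_inverseI[of "chart_dom c" "chart_inv c" "coord c"] is_chart_inv_coord[OF assms(1)]
      inj_on_inverseI[of "chart_dom d" "chart_inv d" "coord d"] is_chart_inv_coord[OF assms(2)]
    by (intro map_prod_inj_on) simp_all
  have "coord (prod_chart c d) (chart_inv c x, chart_inv d y) = (x, y)"
    using assms by (simp add: coord_chart_inv)
  then show ?thesis
    unfolding chart_inv_def[of "prod_chart c d"]
    using assms by (intro inv_into_f_eq[OF inj]) (auto simp: chart_inv_in_dom)
qed

lemma continuous_on_map_prod:
  assumes f: "continuous_on S f" and g: "continuous_on T g"
  shows "continuous_on (S \<times> T) (map_prod f g)"
proof -
  have "continuous_on (S \<times> T) (\<lambda>p. f (fst p))"
    by (rule continuous_on_compose2[OF f continuous_on_fst[OF continuous_on_id]]) auto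
  moreover have "continuous_on (S \<times> T) (\<lambda>p. g (snd p))"
    by (rule continuous_on_compose2[OF g continuous_on_snd[OF continuous_on_id]]) auto
  ultimately show ?thesis
    unfolding map_prod_def case_prod_unfold by (rule continuous_on_Pair)
qed

lemma is_chart_prod:
  assumes "is_chart c" "is_chart d"
  shows "is_chart (prod_chart c d)"
  unfolding is_chart_def
proof (intro conjI)
  show "open (chart_dom (prod_chart c d))" "open (chart_img (prod_chart c d))"
    using assms by (auto intro!: open_Times is_chart_open_dom is_chart_open_img)
  show "homeomorphism (chart_dom (prod_chart c d)) (chart_img (prod_chart c d))
    (coord (prod_chart c d)) (chart_inv (prod_chart c d))"
  proof (rule homeomorphismI)
    show "continuous_on (chart_dom (prod_chart c d)) (coord (prod_chart c d))"
      unfolding chart_dom_prod coord_prod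
      by (rule continuous_on_map_prod[OF is_chart_continuous_coord[OF assms(1)] is_chart_continuous_coord[OF assms(2)]])
    have "continuous_on (chart_img c \<times> chart_img d) (map_prod (chart_inv c) (chart_inv d))"
      by (rule continuous_on_map_prod[OF is_chart_continuous_inv[OF assms(1)] is_chart_continuous_inv[OF assms(2)]])
    then show "continuous_on (chart_img (prod_chart c d)) (chart_inv (prod_chart c d))"
      unfolding chart_img_prod by (rule continuous_on_eq) (auto simp: chart_inv_prod[OF assms])
    show "coord (prod_chart c d) ` chart_dom (prod_chart c d) \<subseteq> chart_img (prod_chart c d)"
      by (simp add: chart_img_def)
    show "chart_inv (prod_chart c d) ` chart_img (prod_chart c d) \<subseteq> chart_dom (prod_chart c d)"
      by (rule image_subsetI) (rule chart_inv_in_dom)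
    show "coord (prod_chart c d) (chart_inv (prod_chart c d) y) = y" if "y \<in> chart_img (prod_chart c d)" for y
      using that by (rule coord_chart_inv)
    show "chart_inv (prod_chart c d) (coord (prod_chart c d) x) = x" if "x \<in> chart_dom (prod_chart c d)" for x
      using that assms by (auto simp: chart_inv_prod coord_in_img is_chart_inv_coord)
  qed
qed

lemma has_derivative_map_prod:
  assumes "(f has_derivative f') (at (fst p))" "(g has_derivative g') (at (snd p))"
  shows "(map_prod f g has_derivative map_prod f' g') (at p)"
  unfolding map_prod_def case_prod_unfold
  by (intro has_derivative_Pair has_derivative_compose[OF has_derivative_fst[OF has_derivative_ident] assms(1)]
      has_derivative_compose[OF has_derivative_snd[OF has_derivative_ident] assms(2)])

lemma carrier_prod_manifold: "carrier (prod_manifold B F) = carrier B \<times> carrier F"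
proof -
  have "atlas (prod_manifold B F) = (\<lambda>(c, d). prod_chart c d) ` (atlas B \<times> atlas F)"
    by (auto simp: prod_manifold_def)
  then show ?thesis by (auto simp: carrier_def)
qed

lemma chart_at_prod_manifold: "chart_at (prod_manifold B F) p = prod_chart (chart_at B (fst p)) (chart_at F (snd p))"
  by (simp add: prod_manifold_def case_prod_unfold)

lemma atlas_prod_manifold: "c \<in> atlas B \<Longrightarrow> d \<in> atlas F \<Longrightarrow> prod_chart c d \<in> atlas (prod_manifold B F)"
  by (auto simp: prod_manifold_def)

context
  fixes B :: "('b::topological_space, 'e1::euclidean_space) manifold"
    and F :: "('f::topological_space, 'e2::euclidean_space) manifold"
  assumes B: "differentiable_manifold B" and F: "differentiable_manifold F"
begin

lemma has_derivative_transition_prod: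
  assumes c: "c \<in> atlas B" "c' \<in> atlas B" "d \<in> atlas F" "d' \<in> atlas F"
    and x: "x \<in> chart_img c" "chart_inv c x \<in> chart_dom c'"
    and y: "y \<in> chart_img d" "chart_inv d y \<in> chart_dom d'"
  shows "((coord (prod_chart c' d') \<circ> chart_inv (prod_chart c d)) has_derivative
    map_prod (FD (coord c' \<circ> chart_inv c) x) (FD (coord d' \<circ> chart_inv d) y)) (at (x, y))"
proof (rule has_derivative_transform_within_open)
  show "(map_prod (coord c' \<circ> chart_inv c) (coord d' \<circ> chart_inv d) has_derivative
    map_prod (FD (coord c' \<circ> chart_inv c) x) (FD (coord d' \<circ> chart_inv d) y)) (at (x, y))"
    using transition_differentiable[OF B c(1,2) x] transition_differentiable[OF F c(3,4) y]
    by (intro has_derivative_map_prod) (simp_all add: FD_works)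
  show "open (chart_img c \<times> chart_img d)"
    using c by (intro open_Times is_chart_open_img) (auto intro: atlas_is_chart[OF B] atlas_is_chart[OF F])
qed (use x y c in \<open>auto simp: chart_inv_prod atlas_is_chart[OF B] atlas_is_chart[OF F]\<close>)

lemma differentiable_manifold_prod: "differentiable_manifold (prod_manifold B F)"
  unfolding differentiable_manifold_def
proof (intro conjI ballI impI)
  fix c assume "c \<in> atlas (prod_manifold B F)"
  then show "is_chart c"
    by (auto simp: prod_manifold_def intro!: is_chart_prod atlas_is_chart[OF B] atlas_is_chart[OF F])
next
  fix c d p
  assume "c \<in> atlas (prod_manifold B F)" "d \<in> atlas (prod_manifold B F)"
    and *: "p \<in> chart_img c" "chart_inv c p \<in> chart_dom d"
  then obtain c1 c2 d1 d2 where c: "c = prod_chart c1 c2" "c1 \<in> atlas B" "c2 \<in> atlas F"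
    and d: "d = prod_chart d1 d2" "d1 \<in> atlas B" "d2 \<in> atlas F"
    by (auto simp: prod_manifold_def)
  obtain x y where p: "p = (x, y)" by fastforce
  have xy: "x \<in> chart_img c1" "y \<in> chart_img c2" using * by (auto simp: c p)
  then have "chart_inv c p = (chart_inv c1 x, chart_inv c2 y)"
    by (simp add: c p chart_inv_prod atlas_is_chart[OF B] atlas_is_chart[OF F])
  with * have "chart_inv c1 x \<in> chart_dom d1" "chart_inv c2 y \<in> chart_dom d2" by (auto simp: d)
  from has_derivative_transition_prod[OF c(2) d(2) c(3) d(3) xy(1) this(1) xy(2) this(2)]
  show "(coord d \<circ> chart_inv c) differentiable (at p)"
    unfolding c d p by (rule differentiableI)
next
  fix p assume "p \<in> carrier (prod_manifold B F)"
  then have "fst p \<in> carrier B" "snd p \<in> carrier F" by (auto simp: carrier_prod_manifold)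
  then show "chart_at (prod_manifold B F) p \<in> atlas (prod_manifold B F)"
    "p \<in> chart_dom (chart_at (prod_manifold B F) p)"
    unfolding chart_at_prod_manifold
    by (auto intro!: atlas_prod_manifold chart_at_atlas[OF B] chart_at_atlas[OF F] simp: mem_Times_iff
        chart_at_dom[OF B] chart_at_dom[OF F])
qed

text \<open>The chart chosen at \<open>p\<close> is the product of the charts chosen at its
  components, so in these coordinates both projections are linear projections. The distributions
  thereby become coordinate subspaces.\<close>

lemma
  assumes p: "p \<in> carrier (prod_manifold B F)"
  shows d_fst_eq: "d_fst B F p v = fst v" and d_snd_eq: "d_snd B F p v = snd v"
proof -
  let ?c = "chart_at B (fst p)" let ?d = "chart_at F (snd p)"
  have "fst p \<in> carrier B" "snd p \<in> carrier F" using p by (auto simp: carrier_prod_manifold)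
  then have c: "is_chart ?c" "is_chart ?d" "fst p \<in> chart_dom ?c" "snd p \<in> chart_dom ?d"
    by (auto simp: chart_at_dom[OF B] chart_at_dom[OF F] atlas_is_chart[OF B] atlas_is_chart[OF F]
        chart_at_atlas[OF B] chart_at_atlas[OF F])
  let ?x = "(coord ?c (fst p), coord ?d (snd p))"
  have x: "?x \<in> chart_img ?c \<times> chart_img ?d" using c by (simp add: coord_in_img)
  have o: "open (chart_img ?c \<times> chart_img ?d)" using c by (intro open_Times is_chart_open_img)
  have "((coord ?c \<circ> fst \<circ> chart_inv (prod_chart ?c ?d)) has_derivative fst) (at ?x)"
    by (rule has_derivative_transform_within_open[OF has_derivative_fst[OF has_derivative_ident] o x])
       (auto simp: chart_inv_prod c coord_chart_inv)
  then show "d_fst B F p v = fst v"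
    unfolding differential_def chart_at_prod_manifold
    by (simp add: frechet_derivative_eqI map_prod_def case_prod_unfold)
  have "((coord ?d \<circ> snd \<circ> chart_inv (prod_chart ?c ?d)) has_derivative snd) (at ?x)"
    by (rule has_derivative_transform_within_open[OF has_derivative_snd[OF has_derivative_ident] o x])
       (auto simp: chart_inv_prod c coord_chart_inv)
  then show "d_snd B F p v = snd v"
    unfolding differential_def chart_at_prod_manifold
    by (simp add: frechet_derivative_eqI map_prod_def case_prod_unfold)
qed

text \<open>Stated over the whole product chart, since derivatives of the metric compare nearby
  points at which other charts may be chosen. Transitions between product charts are block diagonal,
  which keeps the two summands separate.\<close>

lemma local_metric_warped:
  assumes c: "c \<in> atlas B" and d: "d \<in> atlas F" and x: "x \<in> chart_img c" and y: "y \<in> chart_img d"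
  shows "local_metric (prod_manifold B F) (warped_metric B gB F gF f) (prod_chart c d) (x, y) v w =
    local_metric B gB c x (fst v) (fst w) +
    (f (chart_inv c x))\<^sup>2 * local_metric F gF d y (snd v) (snd w)"
proof -
  let ?p = "chart_inv c x" let ?q = "chart_inv d y"
  have pq: "?p \<in> carrier B" "?q \<in> carrier F"
    using chart_inv_in_carrier[OF B c x] chart_inv_in_carrier[OF F d y] .
  have inv: "chart_inv (prod_chart c d) (x, y) = (?p, ?q)"
    using c d x y by (simp add: chart_inv_prod atlas_is_chart[OF B] atlas_is_chart[OF F])
  have M: "(?p, ?q) \<in> carrier (prod_manifold B F)" using pq by (simp add: carrier_prod_manifold)
  note FDp = frechet_derivative_eqI[OF has_derivative_transition_prod[OF c chart_at_atlas[OF B pq(1)]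
        d chart_at_atlas[OF F pq(2)] x chart_at_dom[OF B pq(1)] y chart_at_dom[OF F pq(2)]]]
  show ?thesis
    unfolding local_metric_eq[OF B] local_metric_eq[OF F] local_metric_eq[OF differentiable_manifold_prod]
      inv chart_at_prod_manifold fst_conv snd_conv FDp
    by (simp add: warped_metric_def d_fst_eq[OF M] d_snd_eq[OF M])
qed

end

section \<open>Smooth maps and isometric immersions in coordinates\<close>

lemma smooth_map_open_coord_domain:
  assumes M: "differentiable_manifold M" and N: "differentiable_manifold N" and \<phi>: "smooth_map M N \<phi>"
    and c: "c \<in> atlas M" and d: "d \<in> atlas N"
  shows "open {x \<in> chart_img c. \<phi> (chart_inv c x) \<in> chart_dom d}"
proof (rule is_chart_open_preimage[OF atlas_is_chart[OF M c] _ is_chart_open_dom[OF atlas_is_chart[OF N d]]])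
  show "continuous_on (chart_dom c) \<phi>"
    using \<phi> chart_dom_subset_carrier[OF M c] unfolding smooth_map_def by (blast intro: continuous_on_subset)
qed

lemma smooth_map_coord_smooth:
  assumes M: "differentiable_manifold M" and \<phi>: "smooth_map M N \<phi>"
    and c: "c \<in> atlas M" and d: "d \<in> atlas N"
  shows "smooth_on {x \<in> chart_img c. \<phi> (chart_inv c x) \<in> chart_dom d} (coord d \<circ> \<phi> \<circ> chart_inv c)"
proof -
  have "smooth_on (coord c ` (chart_dom c \<inter> \<phi> -` chart_dom d)) (coord d \<circ> \<phi> \<circ> chart_inv c)"
    using \<phi> c d by (simp add: smooth_map_def)
  then show ?thesis by (simp add: coord_image_eq[OF atlas_is_chart[OF M c]])
qed

text \<open>The hypothesis speaks of each point in the charts chosen there. The map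
  \<open>coord ?d \<circ> \<phi> \<circ> chart_inv c\<close> is differentiated in two ways, through
  the chosen source chart and through the given target chart; uniqueness of the derivative matches
  the vectors that the two local metrics insert.\<close>

lemma isometric_immersion_coord:
  assumes M: "differentiable_manifold M" and N: "differentiable_manifold N"
    and \<phi>: "isometric_immersion M g N gN \<phi>" and c: "c \<in> atlas M" and d: "d \<in> atlas N"
    and x: "x \<in> chart_img c" "\<phi> (chart_inv c x) \<in> chart_dom d"
  defines "\<Phi> \<equiv> coord d \<circ> \<phi> \<circ> chart_inv c"
  shows "local_metric N gN d (\<Phi> x) (FD \<Phi> x v) (FD \<Phi> x w) = local_metric M g c x v w"
proof -
  let ?q = "chart_inv c x"
  let ?c = "chart_at M ?q" let ?d = "chart_at N (\<phi> ?q)"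
  have sm: "smooth_map M N \<phi>" using \<phi> by (simp add: isometric_immersion_def)
  have q: "?q \<in> carrier M" using chart_inv_in_carrier[OF M c x(1)] .
  have \<phi>q: "\<phi> ?q \<in> carrier N" using sm q by (auto simp: smooth_map_def)
  have c': "?c \<in> atlas M" "?q \<in> chart_dom ?c" using chart_at_atlas[OF M q] chart_at_dom[OF M q] .
  have d': "?d \<in> atlas N" "\<phi> ?q \<in> chart_dom ?d" using chart_at_atlas[OF N \<phi>q] chart_at_dom[OF N \<phi>q] .
  have \<Phi>x: "\<Phi> x \<in> chart_img d" "chart_inv d (\<Phi> x) = \<phi> ?q"
    using x by (simp_all add: \<Phi>_def coord_in_img is_chart_inv_coord[OF atlas_is_chart[OF N d]])
  have "((coord ?d \<circ> \<phi>) \<circ> chart_inv ?c) differentiable (at (coord ?c ?q))"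
    by (rule smooth_on_differentiable[OF smooth_map_coord_smooth[OF M sm c'(1) d'(1)]])
       (use c' d' in \<open>simp add: coord_in_img is_chart_inv_coord[OF atlas_is_chart[OF M]]\<close>)
  from has_derivative_change_chart[OF M c c'(1) x(1) c'(2) this]
  have 1: "((coord ?d \<circ> \<phi> \<circ> chart_inv c) has_derivative
      FD (coord ?d \<circ> \<phi> \<circ> chart_inv ?c) (coord ?c ?q) \<circ> FD (coord ?c \<circ> chart_inv c) x) (at x)" .
  have 2: "((coord ?d \<circ> \<phi> \<circ> chart_inv c) has_derivative
      FD (coord ?d \<circ> chart_inv d) (\<Phi> x) \<circ> FD \<Phi> x) (at x)"
  proof (rule has_derivative_transform_within_open[OF _ smooth_map_open_coord_domain[OF M N sm c d]])
    have "\<Phi> differentiable (at x)"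
      unfolding \<Phi>_def
      by (rule smooth_on_differentiable[OF smooth_map_coord_smooth[OF M sm c d]]) (use x in simp)
    moreover have "(coord ?d \<circ> chart_inv d) differentiable (at (\<Phi> x))"
      using transition_differentiable[OF N d d'(1) \<Phi>x(1)] \<Phi>x(2) d'(2) by simp
    ultimately show "((coord ?d \<circ> chart_inv d) \<circ> \<Phi> has_derivative
      FD (coord ?d \<circ> chart_inv d) (\<Phi> x) \<circ> FD \<Phi> x) (at x)"
      by (intro diff_chain_at) (simp_all add: FD_works)
    show "x \<in> {x \<in> chart_img c. \<phi> (chart_inv c x) \<in> chart_dom d}" using x by simp
  qed (simp add: \<Phi>_def is_chart_inv_coord[OF atlas_is_chart[OF N d]])
  have eq: "differential M N \<phi> ?q (FD (coord ?c \<circ> chart_inv c) x v) =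
      FD (coord ?d \<circ> chart_inv d) (\<Phi> x) (FD \<Phi> x v)" for v
    using fun_cong[OF has_derivative_unique[OF 1 2], of v] by (simp add: differential_def)
  have "local_metric M g c x v w = gN (\<phi> ?q)
      (differential M N \<phi> ?q (FD (coord ?c \<circ> chart_inv c) x v))
      (differential M N \<phi> ?q (FD (coord ?c \<circ> chart_inv c) x w))"
    using \<phi> q by (simp add: local_metric_eq[OF M] isometric_immersion_def)
  then show ?thesis by (simp add: eq local_metric_eq[OF N] \<Phi>x)
qed

section \<open>Sectional curvature\<close>

context
  fixes U :: "'a::euclidean_space set" and G
  assumes G: "metric_field U G" and G2: "\<And>v w. Ck_on 2 U (\<lambda>x. G x v w)"
begin

text \<open>One factor \<open>a d - b c\<close> comes from antisymmetry in the first two arguments,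
  the other from skew-adjointness of the curvature operator.\<close>

lemma riemann_curvature_change_basis:
  assumes x: "x \<in> U"
  shows "G x (riemann_curvature G x (a *\<^sub>R u + b *\<^sub>R v) (c *\<^sub>R u + d *\<^sub>R v) (c *\<^sub>R u + d *\<^sub>R v)) (a *\<^sub>R u + b *\<^sub>R v) =
    (a * d - b * c)\<^sup>2 * G x (riemann_curvature G x u v v) u"
proof -
  let ?R = "riemann_curvature G x"
  note bl = bilinear_simps[OF metric_field_bilinear[OF G x]]
  note l1 = linear_add[OF linear_riemann_curvature(1)[OF G G2 x]] linear_cmul[OF linear_riemann_curvature(1)[OF G G2 x]]
  note l2 = linear_add[OF linear_riemann_curvature(2)[OF G G2 x]] linear_cmul[OF linear_riemann_curvature(2)[OF G G2 x]]
  note l3 = linear_add[OF linear_riemann_curvature(3)[OF G G2 x]] linear_cmul[OF linear_riemann_curvature(3)[OF G G2 x]]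
  note skew = riemann_curvature_skew[OF G G2 x]
  have uu: "?R w w z = 0" for w z
    by (simp add: riemann_curvature_def)
  \<comment> \<open>Polarization of the skewness identity at the vector
    \<open>u + v\<close>.\<close>
  have "G x (?R u v u) v + G x (?R u v v) u = 0"
    using skew[of u v "u + v"] by (simp add: l3 bl skew)
  then have T: "G x (?R u v u) v = - G x (?R u v v) u" by simp
  have eq: "?R (a *\<^sub>R u + b *\<^sub>R v) (c *\<^sub>R u + d *\<^sub>R v) z = (a * d - b * c) *\<^sub>R ?R u v z" for z
    by (simp add: l1 l2 uu riemann_curvature_antisym[of G x v u] scaleR_diff_left mult.commute)
  show ?thesis
    unfolding eq by (simp add: l3 bl skew T power2_eq_square) (simp add: algebra_simps)
qed

lemma gram_change_basis:
  assumes x: "x \<in> U"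
  shows "G x (a *\<^sub>R u + b *\<^sub>R v) (a *\<^sub>R u + b *\<^sub>R v) * G x (c *\<^sub>R u + d *\<^sub>R v) (c *\<^sub>R u + d *\<^sub>R v)
      - (G x (a *\<^sub>R u + b *\<^sub>R v) (c *\<^sub>R u + d *\<^sub>R v))\<^sup>2 =
    (a * d - b * c)\<^sup>2 * (G x u u * G x v v - (G x u v)\<^sup>2)"
  using metric_field_sym[OF G x, of v u]
  by (simp add: bilinear_simps[OF metric_field_bilinear[OF G x]] power2_eq_square algebra_simps)

text \<open>Curvature term and Gram determinant scale by the same squared determinant, nonzero
  because \<open>u'\<close> and \<open>v'\<close> are independent. Hence the definite description in
  \<open>sectional_curvature\<close> has a unique candidate for each plane.\<close>

lemma curvature_quotient_span_eq:
  assumes x: "x \<in> U" and uv: "u' \<noteq> v'" "independent {u', v'}" "span {u', v'} = span {u, v}"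
  shows "G x (riemann_curvature G x u' v' v') u' / (G x u' u' * G x v' v' - (G x u' v')\<^sup>2) =
    G x (riemann_curvature G x u v v) u / (G x u u * G x v v - (G x u v)\<^sup>2)"
proof -
  have span2: "span {u, v} = {a *\<^sub>R u + b *\<^sub>R v | a b. True}" for u v :: 'a
    by (auto simp: span_insert span_breakdown_eq algebra_simps)
  have "u' \<in> span {u, v}" "v' \<in> span {u, v}" using uv(3) span_base[of _ "{u', v'}"] by auto
  then obtain a b c d where u': "u' = a *\<^sub>R u + b *\<^sub>R v" and v': "v' = c *\<^sub>R u + d *\<^sub>R v"
    unfolding span2 by blast
  have "a * d - b * c \<noteq> 0"
  proof
    assume 0: "a * d - b * c = 0"
    have indep: "r = 0 \<and> s = 0" if "r *\<^sub>R u' + s *\<^sub>R v' = 0" for r s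
    proof -
      have "(\<Sum>w\<in>{u', v'}. (if w = u' then r else s) *\<^sub>R w) = 0" using uv(1) that by simp
      from independentD[OF uv(2) _ subset_refl this]
      have "(if w = u' then r else s) = 0" if "w \<in> {u', v'}" for w using that by simp
      from this[of u'] this[of v'] show ?thesis using uv(1) by simp
    qed
    \<comment> \<open>The adjugate matrix inverts the basis change up to the determinant; if that
      vanished, independence would annihilate all four coefficients.\<close>
    have "d *\<^sub>R u' + (- b) *\<^sub>R v' = (a * d - b * c) *\<^sub>R u"
      "(- c) *\<^sub>R u' + a *\<^sub>R v' = (a * d - b * c) *\<^sub>R v"
      by (simp_all add: u' v' algebra_simps)
    with 0 have "d = 0 \<and> - b = 0" "- c = 0 \<and> a = 0"
      using indep[of d "- b"] indep[of "- c" a] by simp_all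
    then have "u' = 0" by (simp add: u')
    with uv(2) dependent_zero[of "{u', v'}"] show False by simp
  qed
  then show ?thesis
    unfolding u' v' riemann_curvature_change_basis[OF x] gram_change_basis[OF x] by simp
qed

text \<open>The first argument is expanded in the Euclidean basis; for each of the finitely many
  basis vectors the curvature is bilinear in the other arguments and has a bound of bilinear
  type.\<close>

lemma riemann_curvature_bounded:
  assumes x: "x \<in> U"
  obtains C where "\<And>u v. norm u \<le> r \<Longrightarrow> norm v \<le> r \<Longrightarrow> \<bar>G x (riemann_curvature G x u v v) u\<bar> \<le> C"
proof -
  let ?R = "riemann_curvature G x"
  have "bilinear (?R b)" for b
    using linear_riemann_curvature(2,3)[OF G G2 x] by (simp add: bilinear_def)
  then have "\<exists>B>0. \<forall>v w. norm (?R b v w) \<le> B * norm v * norm w" for b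
    by (rule bilinear_bounded_pos)
  then obtain B where B: "\<And>b. B b > 0" "\<And>b v w. norm (?R b v w) \<le> B b * norm v * norm w" by metis
  obtain C where C: "C > 0" "\<And>v w. norm (G x v w) \<le> C * norm v * norm w"
    using bilinear_bounded_pos[OF metric_field_bilinear[OF G x]] by blast
  have "\<bar>G x (?R u v v) u\<bar> \<le> C * (\<Sum>b\<in>Basis. r * (B b * r * r)) * r" if uv: "norm u \<le> r" "norm v \<le> r" for u v
  proof -
    have r: "r \<ge> 0" using uv(1) norm_ge_zero order_trans by blast
    have "?R u v v = ?R (\<Sum>b\<in>Basis. (u \<bullet> b) *\<^sub>R b) v v" by (simp add: euclidean_representation)
    also have "\<dots> = (\<Sum>b\<in>Basis. (u \<bullet> b) *\<^sub>R ?R b v v)"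
      by (simp only: linear_sum[OF linear_riemann_curvature(1)[OF G G2 x]]
          linear_cmul[OF linear_riemann_curvature(1)[OF G G2 x]])
    also have "norm \<dots> \<le> (\<Sum>b\<in>Basis. r * (B b * r * r))"
    proof (rule sum_norm_le)
      fix b :: 'a assume b: "b \<in> Basis"
      have "norm (?R b v v) \<le> B b * r * r"
        using uv(2) B(1)[of b] r by (intro order_trans[OF B(2)] mult_mono) auto
      moreover have "\<bar>u \<bullet> b\<bar> \<le> r" using Basis_le_norm[OF b, of u] uv(1) by simp
      ultimately show "norm ((u \<bullet> b) *\<^sub>R ?R b v v) \<le> r * (B b * r * r)"
        using r by (simp add: mult_mono)
    qed
    finally have "norm (?R u v v) \<le> (\<Sum>b\<in>Basis. r * (B b * r * r))" .
    then show ?thesis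
      using uv(1) C r by (intro order_trans[OF C(2)[unfolded real_norm_def]] mult_mono) (auto intro!: mult_nonneg_nonneg sum_nonneg less_imp_le[OF B(1)])
  qed
  then show thesis by (rule that)
qed

end

section \<open>Sectional curvature of planes and its boundedness at a point\<close>

lemma local_metric_Ck:
  assumes "riemannian_metric M g" "c \<in> atlas M"
  shows "Ck_on k (chart_img c) (\<lambda>x. local_metric M g c x v w)"
  using assms by (simp add: riemannian_metric_def smooth_on_def)

context
  fixes N :: "('n::{t2_space,second_countable_topology}, 'd::euclidean_space) manifold" and gN
  assumes N: "smooth_manifold N" and gN: "riemannian_metric N gN"
begin

lemma riemannian_metric_inner_form: "p \<in> carrier N \<Longrightarrow> inner_form (gN p)"
  using gN by (auto simp: riemannian_metric_def inner_form_def)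

lemma sectional_curvature_span:
  assumes p: "p \<in> carrier N" and uv: "u \<noteq> v" "independent {u, v}"
  defines "K \<equiv> local_metric N gN (chart_at N p)" and "x \<equiv> coord (chart_at N p) p"
  shows "sectional_curvature N gN p (span {u, v}) =
    K x (riemann_curvature K x u v v) u / (gN p u u * gN p v v - (gN p u v)\<^sup>2)"
proof -
  note c = chart_at_atlas[OF smooth_manifold_imp_differentiable[OF N] p] chart_at_dom[OF smooth_manifold_imp_differentiable[OF N] p]
  have x: "x \<in> chart_img (chart_at N p)" using c by (simp add: x_def coord_in_img)
  have K: "metric_field (chart_img (chart_at N p)) K"
    unfolding K_def by (rule metric_field_local_metric[OF smooth_manifold_imp_differentiable[OF N] gN c(1)])
  have K2: "Ck_on 2 (chart_img (chart_at N p)) (\<lambda>x. K x v w)" for v w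
    unfolding K_def by (rule local_metric_Ck[OF gN c(1)])
  have Kx: "K x = gN p" unfolding K_def x_def by (rule local_metric_chart_at[OF smooth_manifold_imp_differentiable[OF N] p])
  have "sectional_curvature N gN p (span {u, v}) =
    K x (riemann_curvature K x u v v) u / (K x u u * K x v v - (K x u v)\<^sup>2)"
    unfolding sectional_curvature_def Let_def K_def[symmetric] x_def[symmetric]
    by (rule the_equality) (use uv curvature_quotient_span_eq[OF K K2 x] in blast)+
  then show ?thesis by (simp add: Kx)
qed

lemma sectional_curvature_orthonormal:
  assumes p: "p \<in> carrier N" and uv: "gN p u u = 1" "gN p v v = 1" "gN p u v = 0"
  defines "K \<equiv> local_metric N gN (chart_at N p)" and "x \<equiv> coord (chart_at N p) p"
  shows "sectional_curvature N gN p (span {u, v}) = K x (riemann_curvature K x u v v) u"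
  unfolding K_def x_def
    sectional_curvature_span[OF p orthonormal_pair_independent(1,2)[OF riemannian_metric_inner_form[OF p] uv]]
  by (simp add: uv)

text \<open>Every plane has an orthonormal basis, in which the Gram determinant is \<open>1\<close>;
  unit vectors have bounded norm, and the curvature expression is bounded on bounded sets.\<close>

lemma sectional_curvature_bounded:
  assumes p: "p \<in> carrier N"
  obtains C where "\<And>\<pi>. subspace \<pi> \<Longrightarrow> dim \<pi> = 2 \<Longrightarrow> \<bar>sectional_curvature N gN p \<pi>\<bar> \<le> C"
proof -
  let ?K = "local_metric N gN (chart_at N p)" let ?x = "coord (chart_at N p) p"
  note q = riemannian_metric_inner_form[OF p]
  note c = chart_at_atlas[OF smooth_manifold_imp_differentiable[OF N] p] chart_at_dom[OF smooth_manifold_imp_differentiable[OF N] p]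
  have x: "?x \<in> chart_img (chart_at N p)" using c by (simp add: coord_in_img)
  obtain r where r: "\<And>v. gN p v v = 1 \<Longrightarrow> norm v \<le> r" using inner_form_unit_bounded[OF q] by blast
  obtain C where C: "\<And>u v. norm u \<le> r \<Longrightarrow> norm v \<le> r \<Longrightarrow> \<bar>?K ?x (riemann_curvature ?K ?x u v v) u\<bar> \<le> C"
    using riemann_curvature_bounded[OF metric_field_local_metric[OF smooth_manifold_imp_differentiable[OF N] gN c(1)] local_metric_Ck[OF gN c(1)] x] by blast
  have "\<bar>sectional_curvature N gN p \<pi>\<bar> \<le> C" if \<pi>: "subspace \<pi>" "dim \<pi> = 2" for \<pi>
  proof -
    obtain E where E: "orthonormal_basis_of (gN p) \<pi> E" using orthonormal_basis_exists[OF q \<pi>(1)] .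
    then have "card E = 2" using card_orthonormal_basis[OF inner_form_bilinear[OF q]] \<pi>(2) by metis
    then obtain u v where uv: "E = {u, v}" "u \<noteq> v" by (auto simp: card_2_iff)
    with E have on: "gN p u u = 1" "gN p v v = 1" "gN p u v = 0" and sp: "span {u, v} = \<pi>"
      by (auto simp: orthonormal_basis_of_def)
    show ?thesis
      using C[OF r r, OF on(1,2)] by (simp add: sp[symmetric] sectional_curvature_orthonormal[OF p on])
  qed
  then show thesis by (rule that)
qed

end

section \<open>Isometric immersions of warped products\<close>

lemma metric_field_subset: "metric_field U G \<Longrightarrow> open U' \<Longrightarrow> U' \<subseteq> U \<Longrightarrow> metric_field U' G"
  by (auto simp: metric_field_def)

text \<open>Used with the partial traces of the second fundamental form as \<open>a\<close> and
  \<open>b\<close>: the sum carries the mean curvature, the difference is the resulting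
  defect.\<close>

lemma inner_form_polarization:
  assumes "inner_form q"
  shows "q (a + b) (a + b) / 4 - q a b = q (a - b) (a - b) / 4"
  using inner_form_sym[OF assms, of b a]
  by (simp add: bilinear_simps[OF inner_form_bilinear[OF assms]])

locale warped_immersion =
  fixes B :: "('b::{t2_space,second_countable_topology}, 'e1::euclidean_space) manifold"
    and F :: "('f::{t2_space,second_countable_topology}, 'e2::euclidean_space) manifold"
    and N :: "('n::{t2_space,second_countable_topology}, 'd::euclidean_space) manifold"
    and gB gF gN f \<phi>
  assumes B: "smooth_manifold B" and gB: "riemannian_metric B gB"
    and F: "smooth_manifold F" and gF: "riemannian_metric F gF"
    and N: "smooth_manifold N" and gN: "riemannian_metric N gN"
    and f: "smooth_function B f" and fpos: "\<forall>x\<in>carrier B. f x > 0"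
    and \<phi>: "isometric_immersion (prod_manifold B F) (warped_metric B gB F gF f) N gN \<phi>"
begin

abbreviation "M \<equiv> prod_manifold B F"
abbreviation "g \<equiv> warped_metric B gB F gF f"
abbreviation "h \<equiv> second_fundamental_form M g N gN \<phi>"
abbreviation "d\<phi> \<equiv> differential M N \<phi>"
abbreviation "sec p X Y \<equiv> sectional_curvature N gN (\<phi> p) (span {d\<phi> p X, d\<phi> p Y})"

lemmas dB = smooth_manifold_imp_differentiable[OF B]
lemmas dF = smooth_manifold_imp_differentiable[OF F]
lemmas dN = smooth_manifold_imp_differentiable[OF N]
lemmas dM = differentiable_manifold_prod[OF dB dF]

lemma local_warped_product_chart:
  assumes c: "c \<in> atlas B" and d: "d \<in> atlas F"
  shows "local_warped_product (chart_img c) (local_metric B gB c) (chart_img d) (local_metric F gF d)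
    (f \<circ> chart_inv c) (local_metric M g (prod_chart c d))"
proof
  show "metric_field (chart_img c) (local_metric B gB c)"
    by (rule metric_field_local_metric[OF dB gB c])
  show "metric_field (chart_img d) (local_metric F gF d)"
    by (rule metric_field_local_metric[OF dF gF d])
  show "Ck_on 2 (chart_img c) (\<lambda>x. local_metric B gB c x v w)" for v w
    by (rule local_metric_Ck[OF gB c])
  show "Ck_on 2 (chart_img c) (f \<circ> chart_inv c)"
    using f c by (simp add: smooth_function_def smooth_on_def)
  show "(f \<circ> chart_inv c) x > 0" if "x \<in> chart_img c" for x
    using fpos chart_inv_in_carrier[OF dB c that] by simp
  show "local_metric M g (prod_chart c d) (x, y) v w = local_metric B gB c x (fst v) (fst w) +
      ((f \<circ> chart_inv c) x)\<^sup>2 * local_metric F gF d y (snd v) (snd w)"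
    if "x \<in> chart_img c" "y \<in> chart_img d" for x y v w
    using local_metric_warped[OF dB dF c d that] by simp
qed

lemma local_isometry_chart:
  assumes c: "c \<in> atlas B" and c': "c' \<in> atlas F" and d: "d \<in> atlas N"
  defines "cM \<equiv> prod_chart c c'"
  shows "local_isometry {x \<in> chart_img cM. \<phi> (chart_inv cM x) \<in> chart_dom d}
    (local_metric M g cM) (chart_img d) (local_metric N gN d) (coord d \<circ> \<phi> \<circ> chart_inv cM)"
proof
  let ?U = "{x \<in> chart_img cM. \<phi> (chart_inv cM x) \<in> chart_dom d}"
  have sm: "smooth_map M N \<phi>" using \<phi> by (simp add: isometric_immersion_def)
  have cM: "cM \<in> atlas M" unfolding cM_def by (rule atlas_prod_manifold[OF c c'])
  interpret W: local_warped_product "chart_img c" "local_metric B gB c" "chart_img c'"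
    "local_metric F gF c'" "f \<circ> chart_inv c" "local_metric M g cM"
    unfolding cM_def by (rule local_warped_product_chart[OF c c'])
  show "metric_field ?U (local_metric M g cM)"
    by (rule metric_field_subset[OF W.metric_field_G smooth_map_open_coord_domain[OF dM dN sm cM d]])
       (auto simp: cM_def)
  show "metric_field (chart_img d) (local_metric N gN d)"
    by (rule metric_field_local_metric[OF dN gN d])
  show "Ck_on 2 (chart_img d) (\<lambda>x. local_metric N gN d x v w)" for v w
    by (rule local_metric_Ck[OF gN d])
  show "Ck_on 3 ?U (coord d \<circ> \<phi> \<circ> chart_inv cM)"
    using smooth_map_coord_smooth[OF dM sm cM d] by (simp add: smooth_on_def)
  show "(coord d \<circ> \<phi> \<circ> chart_inv cM) x \<in> chart_img d" if "x \<in> ?U" for x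
    using that by (simp add: coord_in_img)
  show "local_metric N gN d ((coord d \<circ> \<phi> \<circ> chart_inv cM) x) (FD (coord d \<circ> \<phi> \<circ> chart_inv cM) x v)
      (FD (coord d \<circ> \<phi> \<circ> chart_inv cM) x w) = local_metric M g cM x v w" if "x \<in> ?U" for x v w
    using that by (intro isometric_immersion_coord[OF dM dN \<phi> cM d]) auto
qed

section \<open>The immersion at a fixed point\<close>

context
  fixes p assumes p: "p \<in> carrier M"
begin

lemma \<phi>p: "\<phi> p \<in> carrier N"
  using \<phi> p by (auto simp: isometric_immersion_def smooth_map_def)

lemma fst_carrier: "fst p \<in> carrier B" and snd_carrier: "snd p \<in> carrier F"
  using p by (auto simp: carrier_prod_manifold)

lemma inner_form_gN: "inner_form (gN (\<phi> p))"
  by (rule riemannian_metric_inner_form[OF N gN \<phi>p])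

lemma g_eq: "g p v w = gB (fst p) (fst v) (fst w) + (f (fst p))\<^sup>2 * gF (snd p) (snd v) (snd w)"
  by (simp add: warped_metric_def d_fst_eq[OF dB dF p] d_snd_eq[OF dB dF p])

lemma dist1_eq: "dist1 B F p = {v. snd v = 0}" and dist2_eq: "dist2 B F p = {v. fst v = 0}"
  by (simp_all add: dist1_def dist2_def d_fst_eq[OF dB dF p] d_snd_eq[OF dB dF p])

lemma inner_form_gB: "inner_form (gB (fst p))" and inner_form_gF: "inner_form (gF (snd p))"
  using riemannian_metric_inner_form[OF B gB fst_carrier] riemannian_metric_inner_form[OF F gF snd_carrier] .

lemma g_orthogonal: "X \<in> dist1 B F p \<Longrightarrow> Y \<in> dist2 B F p \<Longrightarrow> g p X Y = 0"
  by (simp add: dist1_eq dist2_eq g_eq bilinear_simps[OF inner_form_bilinear[OF inner_form_gB]]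
      bilinear_simps[OF inner_form_bilinear[OF inner_form_gF]])

text \<open>Grouped so that one interpretation of the two coordinate locales at \<open>p\<close>
  serves all parts. The last part is the Gauss equation for the plane of \<open>X\<close> and
  \<open>Y\<close>, with the intrinsic term supplied by the warped product.\<close>

lemma
  shows inner_form_g: "inner_form (g p)"
    and bilinear_h: "bilinear (h p)"
    and linear_d\<phi>: "linear (d\<phi> p)"
    and sec_eq: "\<lbrakk>X \<in> dist1 B F p; Y \<in> dist2 B F p; g p X X = 1; g p Y Y = 1\<rbrakk> \<Longrightarrow>
      sec p X Y = - hess (local_metric B gB (chart_at B (fst p))) (f \<circ> chart_inv (chart_at B (fst p)))
          (coord (chart_at B (fst p)) (fst p)) (fst X) (fst X) / f (fst p)
        - gN (\<phi> p) (h p X X) (h p Y Y) + gN (\<phi> p) (h p X Y) (h p X Y)"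
proof -
  let ?c = "chart_at B (fst p)" and ?c' = "chart_at F (snd p)" and ?d = "chart_at N (\<phi> p)"
  let ?cM = "prod_chart ?c ?c'"
  note c = chart_at_atlas[OF dB fst_carrier] chart_at_dom[OF dB fst_carrier]
  note c' = chart_at_atlas[OF dF snd_carrier] chart_at_dom[OF dF snd_carrier]
  note d = chart_at_atlas[OF dN \<phi>p] chart_at_dom[OF dN \<phi>p]
  have cM: "chart_at M p = ?cM" by (rule chart_at_prod_manifold)
  interpret W: local_warped_product "chart_img ?c" "local_metric B gB ?c" "chart_img ?c'"
    "local_metric F gF ?c'" "f \<circ> chart_inv ?c" "local_metric M g ?cM"
    by (rule local_warped_product_chart[OF c(1) c'(1)])
  let ?U = "{x \<in> chart_img ?cM. \<phi> (chart_inv ?cM x) \<in> chart_dom ?d}"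
  let ?K = "local_metric N gN ?d" and ?\<Phi> = "coord ?d \<circ> \<phi> \<circ> chart_inv ?cM"
  interpret I: local_isometry ?U "local_metric M g ?cM" "chart_img ?d" ?K ?\<Phi>
    by (rule local_isometry_chart[OF c(1) c'(1) d(1)])
  let ?a = "coord ?c (fst p)" and ?b = "coord ?c' (snd p)"
  have a: "?a \<in> chart_img ?c" and b: "?b \<in> chart_img ?c'" using c c' by (auto simp: coord_in_img)
  have coordp: "coord ?cM p = (?a, ?b)" by (simp add: map_prod_def case_prod_unfold)
  have inv: "chart_inv ?cM (?a, ?b) = p"
    using a b c c' by (simp add: chart_inv_prod is_chart_inv_coord atlas_is_chart[OF dB] atlas_is_chart[OF dF])
  have U: "(?a, ?b) \<in> ?U" using a b d inv by simp
  have \<Phi>p: "?\<Phi> (?a, ?b) = coord ?d (\<phi> p)" using inv by simp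
  have K: "?K (?\<Phi> (?a, ?b)) = gN (\<phi> p)"
    unfolding \<Phi>p by (rule local_metric_chart_at[OF dN \<phi>p])
  have G: "local_metric M g ?cM (?a, ?b) = g p"
    using local_metric_chart_at[OF dM p] unfolding cM coordp by simp
  have h: "h p = I.II (?a, ?b)"
    unfolding second_fundamental_form_def Let_def cM coordp I.II_def I.pull_def cov_deriv_def fun_eq_iff
    by simp
  have D: "d\<phi> p = FD ?\<Phi> (?a, ?b)"
    unfolding differential_def cM coordp ..
  show gp: "inner_form (g p)" using metric_field_inner_form[OF I.G U] G by simp
  show "bilinear (h p)" unfolding h by (rule I.bilinear_II[OF U])
  show "linear (d\<phi> p)" unfolding D by (rule I.linear_FD_\<Phi>[OF U])
  have isom: "gN (\<phi> p) (d\<phi> p v) (d\<phi> p w) = g p v w" for v w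
    using I.isom[OF U] unfolding K G D .
  assume XY: "X \<in> dist1 B F p" "Y \<in> dist2 B F p" and unit: "g p X X = 1" "g p Y Y = 1"
  obtain x y where X: "X = (x, 0)" and Y: "Y = (0, y)"
    using XY by (metis (mono_tags) dist1_eq dist2_eq mem_Collect_eq prod.collapse)
  have "g p Y X = 0" using g_orthogonal[OF XY] inner_form_sym[OF gp, of X Y] by simp
  \<comment> \<open>The plane is read in the basis \<open>Y, X\<close>, because the warped curvature
    formula has the vertical vector in its first argument and the horizontal one in the other
    two.\<close>
  then have "sec p X Y = gN (\<phi> p) (riemann_curvature ?K (coord ?d (\<phi> p)) (d\<phi> p Y) (d\<phi> p X) (d\<phi> p X)) (d\<phi> p Y)"
    using sectional_curvature_orthonormal[OF N gN \<phi>p, of "d\<phi> p Y" "d\<phi> p X"] unit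
    by (simp add: isom insert_commute[of "d\<phi> p X"] local_metric_chart_at[OF dN \<phi>p])
  also have "\<dots> = g p (riemann_curvature (local_metric M g ?cM) (?a, ?b) Y X X) Y
      - gN (\<phi> p) (h p X X) (h p Y Y) + gN (\<phi> p) (h p Y X) (h p X Y)"
    using I.gauss_equation[OF U, of X X Y Y] differentiableI[OF W.has_derivative_christoffel_horizontal[OF a b]]
      differentiableI[OF W.has_derivative_christoffel_mixed[OF a b]]
    unfolding K G D[symmetric] h[symmetric] \<Phi>p by (simp add: X Y local_metric_chart_at[OF dN \<phi>p])
  \<comment> \<open>The curvature operator multiplies \<open>Y\<close> by a scalar, and
    \<open>g p Y Y = 1\<close> extracts it.\<close>
  also have "g p (riemann_curvature (local_metric M g ?cM) (?a, ?b) Y X X) Y =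
      - hess (local_metric B gB ?c) (f \<circ> chart_inv ?c) ?a (fst X) (fst X) / f (fst p)"
    using unit(2) c
    by (simp add: X Y W.riemann_curvature_warped[OF a b] bilinear_simps[OF inner_form_bilinear[OF gp]]
        is_chart_inv_coord atlas_is_chart[OF dB] del: scaleR_Pair)
  also have "h p Y X = h p X Y"
    unfolding h I.II_def by (simp add: I.pull_sym[OF U, of Y X] christoffel_sym[OF I.G U, of Y X])
  finally show "sec p X Y = - hess (local_metric B gB ?c) (f \<circ> chart_inv ?c) ?a (fst X) (fst X) / f (fst p)
        - gN (\<phi> p) (h p X X) (h p Y Y) + gN (\<phi> p) (h p X Y) (h p X Y)" by (simp add: comp_def)
qed

text \<open>The differential is linear and injective, so it maps planes to planes; the bound on
  ambient planes bounds the family under the supremum.\<close>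

lemma sec_le_sup:
  assumes "g p X X = 1" "g p Y Y = 1" "g p X Y = 0"
  shows "sec p X Y \<le> sup_sectional M N gN \<phi> p"
proof -
  have inj: "inj (d\<phi> p)" using \<phi> p by (simp add: isometric_immersion_def)
  obtain C where C: "\<And>\<pi>. subspace \<pi> \<Longrightarrow> dim \<pi> = 2 \<Longrightarrow> \<bar>sectional_curvature N gN (\<phi> p) \<pi>\<bar> \<le> C"
    using sectional_curvature_bounded[OF N gN \<phi>p] by blast
  note ind = orthonormal_pair_independent[OF inner_form_g assms]
  have "bdd_above ((\<lambda>\<pi>. sectional_curvature N gN (\<phi> p) (d\<phi> p ` \<pi>)) ` {\<pi>. subspace \<pi> \<and> dim \<pi> = 2})"
  proof (rule bdd_aboveI2)
    fix \<pi> :: "('e1 \<times> 'e2) set" assume "\<pi> \<in> {\<pi>. subspace \<pi> \<and> dim \<pi> = 2}"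
    then have "subspace (d\<phi> p ` \<pi>)" "dim (d\<phi> p ` \<pi>) = 2"
      using linear_subspace_image[OF linear_d\<phi>] dim_image_eq[OF linear_d\<phi>] inj
      by (auto simp: inj_on_subset)
    from C[OF this] show "sectional_curvature N gN (\<phi> p) (d\<phi> p ` \<pi>) \<le> C" by linarith
  qed
  moreover have "span {X, Y} \<in> {\<pi>. subspace \<pi> \<and> dim \<pi> = 2}"
    using ind(1) dim_span_eq_card_independent[OF ind(2)] by simp
  ultimately have "sectional_curvature N gN (\<phi> p) (d\<phi> p ` span {X, Y}) \<le> sup_sectional M N gN \<phi> p"
    unfolding sup_sectional_def by (rule cSUP_upper[rotated])
  then show ?thesis using linear_span_image[OF linear_d\<phi>, of "{X, Y}"] by simp
qed

section \<open>Summation over an adapted orthonormal frame\<close>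

context
  fixes E1 E2
  assumes E1: "orthonormal_basis_of (g p) (dist1 B F p) E1"
    and E2: "orthonormal_basis_of (g p) (dist2 B F p) E2"
begin

lemma E1_dist: "e \<in> E1 \<Longrightarrow> e \<in> dist1 B F p" and E2_dist: "e \<in> E2 \<Longrightarrow> e \<in> dist2 B F p"
  and E1_unit: "e \<in> E1 \<Longrightarrow> g p e e = 1" and E2_unit: "e \<in> E2 \<Longrightarrow> g p e e = 1"
  using E1 E2 by (auto simp: orthonormal_basis_of_def intro: span_base)

lemma finite_E: "finite E1" "finite E2"
  using E1 E2 orthonormal_for_finite[OF inner_form_bilinear[OF inner_form_g]]
  by (auto simp: orthonormal_basis_of_iff)

lemma card_E1: "card E1 = DIM('e1)" and card_E2: "card E2 = DIM('e2)"
proof -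
  have 1: "dist1 B F p = UNIV \<times> {0}" and 2: "dist2 B F p = {0} \<times> UNIV"
    by (auto simp: dist1_eq dist2_eq)
  show "card E1 = DIM('e1)"
    unfolding card_orthonormal_basis[OF inner_form_bilinear[OF inner_form_g] E1] 1
    by (simp add: dim_Times)
  show "card E2 = DIM('e2)"
    unfolding card_orthonormal_basis[OF inner_form_bilinear[OF inner_form_g] E2] 2
    by (simp add: dim_Times)
qed

lemma trace_dist: "trace_over (g p) (dist1 B F p) (h p) = (\<Sum>e\<in>E1. h p e e)"
    "trace_over (g p) (dist2 B F p) (h p) = (\<Sum>e\<in>E2. h p e e)"
  by (rule trace_over_eq[OF inner_form_g bilinear_h E1] trace_over_eq[OF inner_form_g bilinear_h E2])+

text \<open>The distributions are complementary and orthogonal for the warped metric, so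
  \<open>E1\<close> and \<open>E2\<close> together form an orthonormal basis of the tangent
  space.\<close>

lemma trace_UNIV: "trace_over (g p) UNIV (h p) = (\<Sum>e\<in>E1. h p e e) + (\<Sum>e\<in>E2. h p e e)"
proof -
  have disj: "E1 \<inter> E2 = {}"
    using g_orthogonal E1_dist E2_dist E1_unit by fastforce
  have orth: "g p e e' = 0" "g p e' e = 0" if "e \<in> E1" "e' \<in> E2" for e e'
    using g_orthogonal[OF E1_dist[OF that(1)] E2_dist[OF that(2)]] inner_form_sym[OF inner_form_g, of e e'] by auto
  have "orthonormal_for (g p) (E1 \<union> E2)"
    unfolding orthonormal_for_def
  proof (intro ballI)
    fix e e' assume e: "e \<in> E1 \<union> E2" "e' \<in> E1 \<union> E2"
    consider "e \<in> E1" "e' \<in> E1" | "e \<in> E2" "e' \<in> E2" | "e \<in> E1" "e' \<in> E2" | "e \<in> E2" "e' \<in> E1"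
      using e by blast
    then show "g p e e' = (if e = e' then 1 else 0)"
    proof cases
      case 1
      then show ?thesis using E1 by (simp add: orthonormal_basis_of_def)
    next
      case 2
      then show ?thesis using E2 by (simp add: orthonormal_basis_of_def)
    next
      case 3
      then show ?thesis using orth disj by auto
    next
      case 4
      then show ?thesis using orth disj by auto
    qed
  qed
  moreover have "span (E1 \<union> E2) = UNIV"
  proof -
    have "v \<in> span (E1 \<union> E2)" for v
    proof -
      have "(fst v, 0) \<in> span E1" "(0, snd v) \<in> span E2"
        using E1 E2 by (auto simp: orthonormal_basis_of_def dist1_eq dist2_eq)
      then have "(fst v, 0) + (0, snd v) \<in> span (E1 \<union> E2)"
        by (intro span_add) (auto intro: span_mono[THEN subsetD])
      then show ?thesis by simp
    qed
    then show ?thesis by auto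
  qed
  ultimately have "orthonormal_basis_of (g p) UNIV (E1 \<union> E2)" by (simp add: orthonormal_basis_of_iff)
  from trace_over_eq[OF inner_form_g bilinear_h this] show ?thesis
    by (simp only: sum.union_disjoint[OF finite_E disj])
qed

lemma squared_mean_curvature_eq:
  "(real DIM('e1) + real DIM('e2))\<^sup>2 * squared_mean_curvature M g N gN \<phi> p =
    gN (\<phi> p) ((\<Sum>e\<in>E1. h p e e) + (\<Sum>e\<in>E2. h p e e)) ((\<Sum>e\<in>E1. h p e e) + (\<Sum>e\<in>E2. h p e e))"
proof -
  have "real DIM('e1) + real DIM('e2) > 0" by (simp add: add_pos_pos)
  then show ?thesis
    unfolding squared_mean_curvature_def mean_curvature_vector_def trace_UNIV
    by (simp add: bilinear_lmul[OF inner_form_bilinear[OF inner_form_gN]]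
        bilinear_rmul[OF inner_form_bilinear[OF inner_form_gN]] power2_eq_square)
qed

text \<open>On the first distribution the warped metric is the base metric, so the projection of
  \<open>E1\<close> is an orthonormal basis for \<open>gB\<close>, injectively indexed. The sign is
  that of \<open>- div grad\<close>.\<close>

lemma laplacian_eq:
  "laplacian B gB f (fst p) = - (\<Sum>e\<in>E1. hess (local_metric B gB (chart_at B (fst p)))
     (f \<circ> chart_inv (chart_at B (fst p))) (coord (chart_at B (fst p)) (fst p)) (fst e) (fst e))"
proof -
  let ?c = "chart_at B (fst p)"
  note c = chart_at_atlas[OF dB fst_carrier] chart_at_dom[OF dB fst_carrier]
  have inj: "inj_on fst E1"
    using E1_dist by (auto simp: inj_on_def dist1_eq prod_eq_iff)
  have "orthonormal_for (gB (fst p)) (fst ` E1)"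
    unfolding orthonormal_for_def
  proof (intro ballI)
    fix a b assume "a \<in> fst ` E1" "b \<in> fst ` E1"
    then obtain e e' where e: "e \<in> E1" "e' \<in> E1" "a = fst e" "b = fst e'" by auto
    have "g p e e' = gB (fst p) a b"
      using e E1_dist by (simp add: g_eq dist1_eq bilinear_simps[OF inner_form_bilinear[OF inner_form_gF]])
    moreover have "g p e e' = (if e = e' then 1 else 0)" using E1 e by (simp add: orthonormal_basis_of_def)
    moreover have "e = e' \<longleftrightarrow> a = b" using inj e by (auto simp: inj_on_def)
    ultimately show "gB (fst p) a b = (if a = b then 1 else 0)" by simp
  qed
  moreover have "span (fst ` E1) = UNIV"
  proof -
    have "span (fst ` E1) = fst ` dist1 B F p"
      using linear_span_image[OF linear_fst, of E1] E1 by (simp add: orthonormal_basis_of_def)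
    also have "\<dots> = UNIV" by (auto simp: dist1_eq image_iff)
    finally show ?thesis .
  qed
  ultimately have "orthonormal_basis_of (local_metric B gB ?c (coord ?c (fst p))) UNIV (fst ` E1)"
    by (simp add: orthonormal_basis_of_iff local_metric_chart_at[OF dB fst_carrier])
  moreover have "Ck_on 2 (chart_img ?c) (f \<circ> chart_inv ?c)"
    using f c by (simp add: smooth_function_def smooth_on_def)
  ultimately show ?thesis
    using local_div_local_grad[OF metric_field_local_metric[OF dB gB c(1)] local_metric_Ck[OF gB c(1)]
        coord_in_img[OF c(2)]]
    by (simp add: laplacian_def Let_def sum.reindex[OF inj])
qed

text \<open>The Hessian term does not depend on \<open>e'\<close>, so summation over
  \<open>E2\<close> multiplies it by the fibre dimension; the products
  \<open>\<langle>h(e,e), h(e',e')\<rangle>\<close> sum to the inner product of the two traces by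
  bilinearity.\<close>

lemma sum_sec_eq:
  "(\<Sum>e\<in>E1. \<Sum>e'\<in>E2. sec p e e') = real DIM('e2) * (laplacian B gB f (fst p) / f (fst p))
    - gN (\<phi> p) (\<Sum>e\<in>E1. h p e e) (\<Sum>e\<in>E2. h p e e)
    + (\<Sum>e\<in>E1. \<Sum>e'\<in>E2. gN (\<phi> p) (h p e e') (h p e e'))"
proof -
  let ?H = "\<lambda>e. hess (local_metric B gB (chart_at B (fst p))) (f \<circ> chart_inv (chart_at B (fst p)))
          (coord (chart_at B (fst p)) (fst p)) (fst e) (fst e)"
  have "(\<Sum>e\<in>E1. \<Sum>e'\<in>E2. sec p e e') = (\<Sum>e\<in>E1. \<Sum>e'\<in>E2.
      - ?H e / f (fst p) - gN (\<phi> p) (h p e e) (h p e' e') + gN (\<phi> p) (h p e e') (h p e e'))"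
    by (intro sum.cong refl sec_eq E1_dist E2_dist E1_unit E2_unit)
  also have "\<dots> = real DIM('e2) * (- (\<Sum>e\<in>E1. ?H e) / f (fst p))
    - (\<Sum>e\<in>E1. \<Sum>e'\<in>E2. gN (\<phi> p) (h p e e) (h p e' e'))
    + (\<Sum>e\<in>E1. \<Sum>e'\<in>E2. gN (\<phi> p) (h p e e') (h p e e'))"
    by (simp add: sum.distrib sum_subtractf card_E2 sum_distrib_left[symmetric] sum_divide_distrib[symmetric] sum_negf)
  also have "(\<Sum>e\<in>E1. \<Sum>e'\<in>E2. gN (\<phi> p) (h p e e) (h p e' e')) = gN (\<phi> p) (\<Sum>e\<in>E1. h p e e) (\<Sum>e\<in>E2. h p e e)"
    by (simp add: bilinear_sum[OF inner_form_bilinear[OF inner_form_gN]] sum.cartesian_product)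
  finally show ?thesis by (simp add: laplacian_eq comp_def)
qed

text \<open>\<open>\<langle>a, b\<rangle> = |a + b|\<^sup>2/4 - |a - b|\<^sup>2/4\<close> turns the Gauss equation, summed over the mixed planes, into
  the inequality with its defect, a sum of nonnegative terms.\<close>

lemma defect_identity:
  "real DIM('e2) * ((real DIM('e1) + real DIM('e2))\<^sup>2 / (4 * real DIM('e2)) * squared_mean_curvature M g N gN \<phi> p
      + real DIM('e1) * sup_sectional M N gN \<phi> p - laplacian B gB f (fst p) / f (fst p)) =
    gN (\<phi> p) ((\<Sum>e\<in>E1. h p e e) - (\<Sum>e\<in>E2. h p e e)) ((\<Sum>e\<in>E1. h p e e) - (\<Sum>e\<in>E2. h p e e)) / 4
    + (\<Sum>e\<in>E1. \<Sum>e'\<in>E2. sup_sectional M N gN \<phi> p - sec p e e')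
    + (\<Sum>e\<in>E1. \<Sum>e'\<in>E2. gN (\<phi> p) (h p e e') (h p e e'))" (is "?n2 * (?A / (4 * ?n2) * ?H + ?n1 * ?s - ?L) = _")
proof -
  have "?n2 * (?A / (4 * ?n2) * ?H + ?n1 * ?s - ?L) = ?A * ?H / 4 + ?n1 * ?n2 * ?s - ?n2 * ?L"
    by (simp add: field_simps)
  moreover have "(\<Sum>e\<in>E1. \<Sum>e'\<in>E2. ?s - sec p e e') = ?n1 * ?n2 * ?s - (\<Sum>e\<in>E1. \<Sum>e'\<in>E2. sec p e e')"
    by (simp add: sum_subtractf card_E1 card_E2)
  ultimately show ?thesis
    unfolding squared_mean_curvature_eq inner_form_polarization[OF inner_form_gN, symmetric] sum_sec_eq
    by (simp add: algebra_simps)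
qed

section \<open>The pointwise inequality and its equality case\<close>

lemma defect_nonneg:
  "gN (\<phi> p) ((\<Sum>e\<in>E1. h p e e) - (\<Sum>e\<in>E2. h p e e)) ((\<Sum>e\<in>E1. h p e e) - (\<Sum>e\<in>E2. h p e e)) \<ge> 0"
  "e \<in> E1 \<Longrightarrow> e' \<in> E2 \<Longrightarrow> sup_sectional M N gN \<phi> p - sec p e e' \<ge> 0"
  "gN (\<phi> p) (h p e e') (h p e e') \<ge> 0"
  using sec_le_sup[OF E1_unit E2_unit g_orthogonal[OF E1_dist E2_dist]] inner_form_nonneg[OF inner_form_gN]
  by auto

lemma chen_inequality:
  "laplacian B gB f (fst p) / f (fst p) \<le> (real DIM('e1) + real DIM('e2))\<^sup>2 / (4 * real DIM('e2)) *
      squared_mean_curvature M g N gN \<phi> p + real DIM('e1) * sup_sectional M N gN \<phi> p"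
proof -
  have "0 \<le> real DIM('e2) * ((real DIM('e1) + real DIM('e2))\<^sup>2 / (4 * real DIM('e2)) * squared_mean_curvature M g N gN \<phi> p
      + real DIM('e1) * sup_sectional M N gN \<phi> p - laplacian B gB f (fst p) / f (fst p))"
    unfolding defect_identity using defect_nonneg
    by (intro add_nonneg_nonneg sum_nonneg) simp_all
  then show ?thesis by (simp add: zero_le_mult_iff)
qed

lemma chen_equality_iff:
  "laplacian B gB f (fst p) / f (fst p) = (real DIM('e1) + real DIM('e2))\<^sup>2 / (4 * real DIM('e2)) *
      squared_mean_curvature M g N gN \<phi> p + real DIM('e1) * sup_sectional M N gN \<phi> p \<longleftrightarrow>
   (\<Sum>e\<in>E1. h p e e) = (\<Sum>e\<in>E2. h p e e) \<and>
   (\<forall>e\<in>E1. \<forall>e'\<in>E2. sec p e e' = sup_sectional M N gN \<phi> p \<and> h p e e' = 0)" (is "?L = ?R \<longleftrightarrow> _")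
proof -
  \<comment> \<open>The gap is multiplied by the positive fibre dimension to match the defect
    identity; a sum of nonnegative terms then vanishes exactly when each of them does.\<close>
  have "?L = ?R \<longleftrightarrow> real DIM('e2) * (?R - ?L) = 0" by auto
  also have "\<dots> \<longleftrightarrow>
      gN (\<phi> p) ((\<Sum>e\<in>E1. h p e e) - (\<Sum>e\<in>E2. h p e e)) ((\<Sum>e\<in>E1. h p e e) - (\<Sum>e\<in>E2. h p e e)) = 0 \<and>
      (\<forall>e\<in>E1. \<forall>e'\<in>E2. sup_sectional M N gN \<phi> p - sec p e e' = 0) \<and>
      (\<forall>e\<in>E1. \<forall>e'\<in>E2. gN (\<phi> p) (h p e e') (h p e e') = 0)"
    unfolding defect_identity
    using defect_nonneg finite_E
    by (simp add: add_nonneg_eq_0_iff sum_nonneg_eq_0_iff sum_nonneg)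
  also have "\<dots> \<longleftrightarrow> (\<Sum>e\<in>E1. h p e e) - (\<Sum>e\<in>E2. h p e e) = 0 \<and>
      (\<forall>e\<in>E1. \<forall>e'\<in>E2. sup_sectional M N gN \<phi> p - sec p e e' = 0) \<and>
      (\<forall>e\<in>E1. \<forall>e'\<in>E2. h p e e' = 0)"
    by (simp only: inner_form_eq_0_iff[OF inner_form_gN])
  finally show ?thesis
    unfolding right_minus_eq by (metis (no_types, lifting))
qed

end

end

text \<open>Carries conclusions about members of adapted frames over to arbitrary unit vectors of a
  distribution.\<close>

lemma unit_extends_to_basis:
  assumes p: "p \<in> carrier M" and V: "subspace V" and X: "X \<in> V" "g p X X = 1"
  obtains E where "orthonormal_basis_of (g p) V E" "X \<in> E"
  using orthonormal_basis_extend[OF inner_form_g[OF p] V, of "{X}"] X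
  by (auto simp: orthonormal_for_def)

lemma subspace_dist: 
  assumes "p \<in> carrier M"
  shows "subspace (dist1 B F p)" "subspace (dist2 B F p)"
  by (auto simp: subspace_def dist1_eq[OF assms] dist2_eq[OF assms])

text \<open>Equality at a point constrains every adapted frame there. Hence mixed total geodesy
  holds for all frames, and the curvature condition for all unit \<open>X\<close> and
  \<open>Y\<close>, by choosing frames that contain them.\<close>

theorem chen_warped_product:
  fixes n1 n2
  defines "n1 \<equiv> real DIM('e1)" and "n2 \<equiv> real DIM('e2)"
  defines "L \<equiv> \<lambda>p. laplacian B gB f (fst p) / f (fst p)"
    and "R \<equiv> \<lambda>p. (n1 + n2)\<^sup>2 / (4 * n2) * squared_mean_curvature M g N gN \<phi> p + n1 * sup_sectional M N gN \<phi> p"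
  shows "p \<in> carrier M \<Longrightarrow> L p \<le> R p"
    and "(\<forall>p\<in>carrier M. L p = R p) \<longleftrightarrow>
      mixed_totally_geodesic B F g N gN \<phi> \<and>
      (\<forall>p\<in>carrier M. trace_over (g p) (dist1 B F p) (h p) = trace_over (g p) (dist2 B F p) (h p)) \<and>
      (\<forall>p\<in>carrier M. \<forall>X\<in>dist1 B F p. \<forall>Y\<in>dist2 B F p. g p X X = 1 \<longrightarrow> g p Y Y = 1 \<longrightarrow>
         sec p X Y = sup_sectional M N gN \<phi> p)" (is "?eq \<longleftrightarrow> ?mixed \<and> ?tr \<and> ?K")
proof -
  have bases: "\<exists>E1 E2. orthonormal_basis_of (g p) (dist1 B F p) E1 \<and> orthonormal_basis_of (g p) (dist2 B F p) E2"
    if "p \<in> carrier M" for p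
    using orthonormal_basis_exists[OF inner_form_g[OF that]] subspace_dist[OF that] by metis
  show "L p \<le> R p" if p: "p \<in> carrier M"
    using bases[OF p] chen_inequality[OF p] unfolding L_def R_def n1_def n2_def by blast
  show "?eq \<longleftrightarrow> ?mixed \<and> ?tr \<and> ?K"
  proof
    assume eq: ?eq
    have eqD: "(\<Sum>e\<in>E1. h p e e) = (\<Sum>e\<in>E2. h p e e)"
      "\<And>e e'. e \<in> E1 \<Longrightarrow> e' \<in> E2 \<Longrightarrow> sec p e e' = sup_sectional M N gN \<phi> p"
      "\<And>e e'. e \<in> E1 \<Longrightarrow> e' \<in> E2 \<Longrightarrow> h p e e' = 0"
      if p: "p \<in> carrier M" and E: "orthonormal_basis_of (g p) (dist1 B F p) E1"
        "orthonormal_basis_of (g p) (dist2 B F p) E2" for p E1 E2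
      using chen_equality_iff[OF p E] eq p unfolding L_def R_def n1_def n2_def by simp_all
    have ?mixed
      unfolding mixed_totally_geodesic_def
    proof (intro ballI allI impI)
      fix p E1 E2 e e'
      assume "p \<in> carrier M" "orthonormal_basis_of (g p) (dist1 B F p) E1"
        "orthonormal_basis_of (g p) (dist2 B F p) E2" "e \<in> E1" "e' \<in> E2"
      then show "h p e e' = 0" by (rule eqD(3))
    qed
    moreover have ?tr
    proof
      fix p assume p: "p \<in> carrier M"
      obtain E1 E2 where E: "orthonormal_basis_of (g p) (dist1 B F p) E1"
        "orthonormal_basis_of (g p) (dist2 B F p) E2" using bases[OF p] by blast
      show "trace_over (g p) (dist1 B F p) (h p) = trace_over (g p) (dist2 B F p) (h p)"
        unfolding trace_dist[OF p E] by (rule eqD(1)[OF p E])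
    qed
    moreover have ?K
    proof (intro ballI impI)
      fix p X Y
      assume p: "p \<in> carrier M" and X: "X \<in> dist1 B F p" "g p X X = 1"
        and Y: "Y \<in> dist2 B F p" "g p Y Y = 1"
      obtain E1 where E1: "orthonormal_basis_of (g p) (dist1 B F p) E1" "X \<in> E1"
        using unit_extends_to_basis[OF p subspace_dist(1)[OF p] X] .
      obtain E2 where E2: "orthonormal_basis_of (g p) (dist2 B F p) E2" "Y \<in> E2"
        using unit_extends_to_basis[OF p subspace_dist(2)[OF p] Y] .
      show "sec p X Y = sup_sectional M N gN \<phi> p"
        by (rule eqD(2)[OF p E1(1) E2(1) E1(2) E2(2)])
    qed
    ultimately show "?mixed \<and> ?tr \<and> ?K" by blast
  next
    assume r: "?mixed \<and> ?tr \<and> ?K"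
    show ?eq
    proof
      fix p assume p: "p \<in> carrier M"
      \<comment> \<open>For the converse a single adapted frame at \<open>p\<close> is
        enough.\<close>
      obtain E1 E2 where E: "orthonormal_basis_of (g p) (dist1 B F p) E1"
        "orthonormal_basis_of (g p) (dist2 B F p) E2" using bases[OF p] by blast
      have "(\<Sum>e\<in>E1. h p e e) = (\<Sum>e\<in>E2. h p e e)"
        using r p trace_dist[OF p E] by simp
      moreover have "h p e e' = 0" if "e \<in> E1" "e' \<in> E2" for e e'
        using r p E that unfolding mixed_totally_geodesic_def by blast
      moreover have "sec p e e' = sup_sectional M N gN \<phi> p" if "e \<in> E1" "e' \<in> E2" for e e'
        using r p E1_dist[OF p E that(1)] E2_dist[OF p E that(2)] E1_unit[OF p E that(1)]
          E2_unit[OF p E that(2)] by blast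
      ultimately show "L p = R p"
        unfolding L_def R_def n1_def n2_def chen_equality_iff[OF p E] by blast
    qed
  qed
qed

end

theorem theorem3p1:
  fixes B :: "('b::{t2_space,second_countable_topology}, 'e1::euclidean_space) manifold"
    and F :: "('f::{t2_space,second_countable_topology}, 'e2::euclidean_space) manifold"
    and N :: "('n::{t2_space,second_countable_topology}, 'd::euclidean_space) manifold"
    and M :: "('b \<times> 'f, 'e1 \<times> 'e2) manifold"
    and gB :: "('b, 'e1) metric" and gF :: "('f, 'e2) metric" and gN :: "('n, 'd) metric"
    and g :: "('b \<times> 'f, 'e1 \<times> 'e2) metric"
    and f :: "'b \<Rightarrow> real" and \<phi> :: "'b \<times> 'f \<Rightarrow> 'n"
    and n1 n2 n :: real
    and H2 supK :: "'b \<times> 'f \<Rightarrow> real"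
    and h :: "'b \<times> 'f \<Rightarrow> 'e1 \<times> 'e2 \<Rightarrow> 'e1 \<times> 'e2 \<Rightarrow> 'd"
  defines "n1 \<equiv> real DIM('e1)" and "n2 \<equiv> real DIM('e2)" and "n \<equiv> n1 + n2"
    and "M \<equiv> prod_manifold B F" and "g \<equiv> warped_metric B gB F gF f"
    and "h \<equiv> second_fundamental_form M g N gN \<phi>"
    and "H2 \<equiv> squared_mean_curvature M g N gN \<phi>"
    and "supK \<equiv> sup_sectional M N gN \<phi>"
  assumes "smooth_manifold B" and "riemannian_metric B gB"
    and "smooth_manifold F" and "riemannian_metric F gF"
    and "smooth_manifold N" and "riemannian_metric N gN"
    and "smooth_function B f" and "\<forall>x\<in>carrier B. f x > 0"
    and "isometric_immersion M g N gN \<phi>"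
  shows "(\<forall>p\<in>carrier M.
            laplacian B gB f (fst p) / f (fst p) \<le> n\<^sup>2 / (4 * n2) * H2 p + n1 * supK p) \<and>
         ((\<forall>p\<in>carrier M.
            laplacian B gB f (fst p) / f (fst p) = n\<^sup>2 / (4 * n2) * H2 p + n1 * supK p) \<longleftrightarrow>
          mixed_totally_geodesic B F g N gN \<phi> \<and>
          (\<forall>p\<in>carrier M.
             trace_over (g p) (dist1 B F p) (h p) = trace_over (g p) (dist2 B F p) (h p)) \<and>
          (\<forall>p\<in>carrier M. \<forall>X\<in>dist1 B F p. \<forall>Y\<in>dist2 B F p. g p X X = 1 \<longrightarrow> g p Y Y = 1 \<longrightarrow>
             sectional_curvature N gN (\<phi> p)
               (span {differential M N \<phi> p X, differential M N \<phi> p Y}) = supK p))"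
proof -
  interpret warped_immersion B F N gB gF gN f \<phi>
    by unfold_locales (use assms in \<open>simp_all add: M_def g_def\<close>)
  show ?thesis
    unfolding h_def H2_def supK_def n_def n1_def n2_def M_def g_def
    by (intro conjI ballI chen_warped_product)
qed

end
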